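(* Let $u$ be a solution of $$iu_{t}+\Delta u + \mathcal{L}(|u|^{2})u =0,\quad t\geq 0,\ x\in \mathbb{R}^{2},\qquad u(0,x) = u_{0}(x)\in H^{1}(\mathbb{R}^{2}),$$ which blows up in finite time $T^{*}>0$, and let $\lambda(t)>0$ be any function of $t\in[0,T^* )$ such that $\lambda (t)\|\nabla u(t)\|_{2} \rightarrow +\infty$ as $t\uparrow T^{*}$. Then there exists $y(t)\in \mathbb{R}^{2}$, for $t\in[0,T^* )$, such that $$\liminf_{t \uparrow T^{*}}\int_{|x-y(t)|\leq \lambda(t)}|u(t,x)|^{2}\,dx \geq \frac{2}{C_{opt}}.$$
   Context: Functions are complex-valued and $\|\cdot\|_2$ is the $L^2(\mathbb{R}^2)$ norm. Fix $\gamma>0$ and $\nu=1$. The operator $\mathcal{L}$ is $\mathcal{L}=\nu I+\gamma\mathcal{B}$, where $\mathcal{B}$ is the Fourier multiplier operator (bounded on $L^2(\mathbb{R}^2)$) with $\widehat{\mathcal{B}(f)}(\xi)=\frac{\xi_{1}^{2}}{\xi_{1}^{2}+\xi_{2}^{2}}\widehat{f}(\xi)$. The constant $C_{opt}>0$ is the optimal, i.e. smallest, constant such that $$\int_{\mathbb{R}^2} \mathcal{L}(|w|^{2})|w|^{2}\,dx \leq C_{opt}\|\nabla w\|_{2}^{2}\|w\|_{2}^{2}\qquad\text{for all } w\in H^1(\mathbb{R}^2).$$ Solution means the following (Ghidaglia–Saut): for every $u_0\in H^1(\mathbb{R}^2)$ there are a maximal time $T^*\in(0,\infty]$ and a unique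 solution $u$ with $u\in C([0,T^* );H^1(\mathbb{R}^2))\cap C^1([0,T^* );H^{-1}(\mathbb{R}^2))$ and $u\in L^4((0,t)\times\mathbb{R}^2)$ for all $t\in(0,T^* )$, maximal in the sense that if $T^*<\infty$ then $\lim_{t\uparrow T^*}\|u(t)\|_{H^1(\mathbb{R}^2)}=\infty$. The mass $\|u(t)\|_2$ and the energy $E(u(t))=\frac12\int|\nabla u|^2dx-\frac14\int\mathcal{L}(|u|^2)|u|^2dx$ are conserved on $[0,T^* )$. "Blows up in finite time $T^*$" means $T^*<\infty$. *)

theory Defs
  imports "HOL-Analysis.Analysis"
begin

section \<open>The spaces \<open>L\<^sup>2\<close> and \<open>H\<^sup>1\<close> on the plane\<close>

text \<open>Elements of the function spaces are represented by Borel functions; equality in the spaces is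
  equality almost everywhere.\<close>

type_synonym plane = "real ^ 2"
type_synonym fld = "plane \<Rightarrow> complex"

definition L2 :: "fld set" where
  "L2 = {f. f \<in> borel_measurable lborel \<and> integrable lborel (\<lambda>x. (cmod (f x))\<^sup>2)}"

definition L2_norm :: "fld \<Rightarrow> real" where
  "L2_norm f = sqrt (LINT x|lborel. (cmod (f x))\<^sup>2)"

definition partial_deriv :: "2 \<Rightarrow> fld \<Rightarrow> fld" where
  "partial_deriv j f = (\<lambda>x. frechet_derivative f (at x) (axis j 1))"

primrec Ck :: "nat \<Rightarrow> fld \<Rightarrow> bool" where
  "Ck 0 f \<longleftrightarrow> continuous_on UNIV f"
| "Ck (Suc k) f \<longleftrightarrow> (\<forall>x. f differentiable (at x)) \<and> (\<forall>j. Ck k (partial_deriv j f))"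

definition test_function :: "fld \<Rightarrow> bool" where
  "test_function \<phi> \<longleftrightarrow> (\<forall>k. Ck k \<phi>) \<and> (\<exists>K. compact K \<and> (\<forall>x. x \<notin> K \<longrightarrow> \<phi> x = 0))"

definition is_weak_deriv :: "2 \<Rightarrow> fld \<Rightarrow> fld \<Rightarrow> bool" where
  "is_weak_deriv j f g \<longleftrightarrow> g \<in> L2 \<and>
     (\<forall>\<phi>. test_function \<phi> \<longrightarrow>
        (LINT x|lborel. f x * partial_deriv j \<phi> x) = - (LINT x|lborel. g x * \<phi> x))"

definition H1 :: "fld set" where
  "H1 = {f \<in> L2. \<forall>j. \<exists>g. is_weak_deriv j f g}"

text \<open>On \<open>H1\<close> the weak derivative exists and is unique up to a null set.\<close>

definition weak_deriv :: "2 \<Rightarrow> fld \<Rightarrow> fld" where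
  "weak_deriv j f = (SOME g. is_weak_deriv j f g)"

definition grad_norm :: "fld \<Rightarrow> real" where
  "grad_norm f = sqrt (\<Sum>j\<in>UNIV. (L2_norm (weak_deriv j f))\<^sup>2)"

definition H1_norm :: "fld \<Rightarrow> real" where
  "H1_norm f = sqrt ((L2_norm f)\<^sup>2 + (grad_norm f)\<^sup>2)"


section \<open>The space \<open>H\<^sup>-\<^sup>1\<close> as the dual of \<open>H\<^sup>1\<close>\<close>

text \<open>A function or distribution is identified with a linear functional on \<open>H1\<close> through the
  bilinear pairing \<open>\<integral> f \<phi>\<close> (no complex conjugation).\<close>

type_synonym functional = "fld \<Rightarrow> complex"

definition Hm1 :: "functional set" where
  "Hm1 = {F. (\<forall>\<phi>\<in>H1. \<forall>\<psi>\<in>H1. F (\<lambda>x. \<phi> x + \<psi> x) = F \<phi> + F \<psi>) \<and>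
             (\<forall>c. \<forall>\<phi>\<in>H1. F (\<lambda>x. c * \<phi> x) = c * F \<phi>) \<and>
             (\<exists>C. \<forall>\<phi>\<in>H1. cmod (F \<phi>) \<le> C * H1_norm \<phi>)}"

definition Hm1_norm :: "functional \<Rightarrow> real" where
  "Hm1_norm F = (SUP \<phi>\<in>{\<phi>\<in>H1. H1_norm \<phi> \<le> 1}. cmod (F \<phi>))"

definition pairing :: "fld \<Rightarrow> functional" where
  "pairing f = (\<lambda>\<phi>. LINT x|lborel. f x * \<phi> x)"

definition laplacian :: "fld \<Rightarrow> functional" where
  "laplacian f = (\<lambda>\<phi>. - (\<Sum>j\<in>UNIV. LINT x|lborel. weak_deriv j f x * weak_deriv j \<phi> x))"


section \<open>The Fourier multiplier and the operator \<open>\<L>\<close>\<close>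

definition fourier_integral :: "fld \<Rightarrow> fld" where
  "fourier_integral f = (\<lambda>\<xi>. LINT x|lborel. cis (- (x \<bullet> \<xi>)) * f x)"

text \<open>The Fourier transform on \<open>L2\<close> (determined up to a null set) is the \<open>L2\<close>-limit of the Fourier
  integrals of the truncations of \<open>f\<close> to balls. The multiplier below is homogeneous of
  degree 0, so the operator it defines does not depend on the normalisation.\<close>

definition is_fourier :: "fld \<Rightarrow> fld \<Rightarrow> bool" where
  "is_fourier f g \<longleftrightarrow> f \<in> L2 \<and> g \<in> L2 \<and>
     ((\<lambda>R. L2_norm (\<lambda>\<xi>. fourier_integral (\<lambda>x. indicator (cball 0 R) x * f x) \<xi> - g \<xi>))
        \<longlongrightarrow> 0) at_top"

definition multiplier :: "plane \<Rightarrow> real" where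
  "multiplier \<xi> = (\<xi> $ 1)\<^sup>2 / ((\<xi> $ 1)\<^sup>2 + (\<xi> $ 2)\<^sup>2)"

definition B_op :: "fld \<Rightarrow> fld" where
  "B_op f = (SOME h. h \<in> L2 \<and>
     (\<exists>g. is_fourier f g \<and> is_fourier h (\<lambda>\<xi>. complex_of_real (multiplier \<xi>) * g \<xi>)))"

definition L_op :: "real \<Rightarrow> real \<Rightarrow> fld \<Rightarrow> fld" where
  "L_op \<nu> \<gamma> f = (\<lambda>x. complex_of_real \<nu> * f x + complex_of_real \<gamma> * B_op f x)"

definition density :: "fld \<Rightarrow> fld" where
  "density w = (\<lambda>x. complex_of_real ((cmod (w x))\<^sup>2))"

text \<open>The multiplier is real and even, so the integral below is real; \<open>Re\<close> only adjusts the type.\<close>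

definition quartic :: "real \<Rightarrow> real \<Rightarrow> fld \<Rightarrow> real" where
  "quartic \<nu> \<gamma> w = Re (LINT x|lborel. L_op \<nu> \<gamma> (density w) x * density w x)"

definition interpolation_bound :: "real \<Rightarrow> real \<Rightarrow> real \<Rightarrow> bool" where
  "interpolation_bound \<nu> \<gamma> C \<longleftrightarrow>
     (\<forall>w\<in>H1. quartic \<nu> \<gamma> w \<le> C * (grad_norm w)\<^sup>2 * (L2_norm w)\<^sup>2)"

definition optimal_constant :: "real \<Rightarrow> real \<Rightarrow> real \<Rightarrow> bool" where
  "optimal_constant \<nu> \<gamma> C \<longleftrightarrow>
     C > 0 \<and> interpolation_bound \<nu> \<gamma> C \<and> (\<forall>C'. interpolation_bound \<nu> \<gamma> C' \<longrightarrow> C \<le> C')"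


section \<open>The Cauchy problem\<close>

definition energy :: "real \<Rightarrow> real \<Rightarrow> fld \<Rightarrow> real" where
  "energy \<nu> \<gamma> f = (grad_norm f)\<^sup>2 / 2 - quartic \<nu> \<gamma> f / 4"

definition lifespan :: "ereal \<Rightarrow> real set" where
  "lifespan T = {t. 0 \<le> t \<and> ereal t < T}"

definition continuous_H1 :: "ereal \<Rightarrow> (real \<Rightarrow> fld) \<Rightarrow> bool" where
  "continuous_H1 T u \<longleftrightarrow> (\<forall>t\<in>lifespan T. u t \<in> H1 \<and>
     ((\<lambda>s. H1_norm (\<lambda>x. u s x - u t x)) \<longlongrightarrow> 0) (at t within lifespan T))"

text \<open>\<open>C1_Hm1 T u v\<close>: the curve \<open>u\<close> belongs to \<open>C\<^sup>1([0,T); H\<^sup>-\<^sup>1)\<close> and \<open>v\<close> is its time derivative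
  (one-sided at 0).\<close>

definition C1_Hm1 :: "ereal \<Rightarrow> (real \<Rightarrow> fld) \<Rightarrow> (real \<Rightarrow> functional) \<Rightarrow> bool" where
  "C1_Hm1 T u v \<longleftrightarrow> (\<forall>t\<in>lifespan T. pairing (u t) \<in> Hm1 \<and> v t \<in> Hm1 \<and>
     ((\<lambda>s. Hm1_norm (\<lambda>\<phi>. (pairing (u s) \<phi> - pairing (u t) \<phi>) / complex_of_real (s - t) - v t \<phi>))
        \<longlongrightarrow> 0) (at t within lifespan T) \<and>
     ((\<lambda>s. Hm1_norm (\<lambda>\<phi>. v s \<phi> - v t \<phi>)) \<longlongrightarrow> 0) (at t within lifespan T))"

text \<open>Each \<open>u s\<close> is only a representative of its class, so joint measurability
  in \<open>(s, x)\<close> is required of a suitable version \<open>U\<close> of \<open>u\<close>.\<close>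

definition L4_spacetime :: "real \<Rightarrow> (real \<Rightarrow> fld) \<Rightarrow> bool" where
  "L4_spacetime t u \<longleftrightarrow> (\<exists>U :: real \<times> plane \<Rightarrow> complex.
     U \<in> borel_measurable lborel \<and>
     (AE s in lborel. s \<in> {0<..<t} \<longrightarrow> (AE x in lborel. U (s, x) = u s x)) \<and>
     set_integrable lborel ({0<..<t} \<times> UNIV) (\<lambda>p. (cmod (U p)) ^ 4))"

text \<open>Maximal solutions on \<open>[0,T)\<close> of \<open>i u\<^sub>t + \<Delta>u + \<L>(|u|\<^sup>2)u = 0\<close>, an equation in \<open>H\<^sup>-\<^sup>1\<close>, in the
  sense of Ghidaglia and Saut. Conservation of mass and energy, which holds for all of them, is
  part of this notion of solution.\<close>

definition maximal_solution ::
  "real \<Rightarrow> real \<Rightarrow> fld \<Rightarrow> ereal \<Rightarrow> (real \<Rightarrow> fld) \<Rightarrow> bool" where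
  "maximal_solution \<nu> \<gamma> u0 T u \<longleftrightarrow>
     0 < T \<and> continuous_H1 T u \<and>
     (\<exists>v. C1_Hm1 T u v \<and>
        (\<forall>t\<in>lifespan T. \<forall>\<phi>\<in>H1.
           \<i> * v t \<phi> + laplacian (u t) \<phi>
             + pairing (\<lambda>x. L_op \<nu> \<gamma> (density (u t)) x * u t x) \<phi> = 0)) \<and>
     (AE x in lborel. u 0 x = u0 x) \<and>
     (\<forall>t. 0 < t \<and> ereal t < T \<longrightarrow> L4_spacetime t u) \<and>
     (\<forall>T'. T = ereal T' \<longrightarrow> filterlim (\<lambda>t. H1_norm (u t)) at_top (at_left T')) \<and>
     (\<forall>t\<in>lifespan T. L2_norm (u t) = L2_norm u0) \<and>
     (\<forall>t\<in>lifespan T. energy \<nu> \<gamma> (u t) = energy \<nu> \<gamma> u0)"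

end

theory Submission
  imports "HOL-Probability.Characteristic_Functions" Defs
begin

text \<open>Let \<open>G(t) = \<parallel>\<nabla>u(t)\<parallel>\<close>, which tends to infinity as \<open>t\<close> approaches \<open>T\<close>, and let \<open>Q(w) = \<integral> \<L>(|w|\<^sup>2)|w|\<^sup>2\<close> be the
  quartic functional. Conservation of the energy says \<open>Q(u(t)) = 2 G(t)\<^sup>2 - 4 E\<close>, so the interpolation
  inequality \<open>Q(w) \<le> C \<parallel>\<nabla>w\<parallel>\<^sup>2 \<parallel>w\<parallel>\<^sup>2\<close>, divided by \<open>G\<^sup>2\<close>, forces the mass of \<open>u(t)\<close> to be at least \<open>2 / C\<close> in the
  limit. Concentration follows by localising this inequality: up to errors \<open>o(G\<^sup>2)\<close>, the factor \<open>\<parallel>w\<parallel>\<^sup>2\<close> may be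
  replaced by the largest mass \<open>S\<close> of \<open>w\<close> in a ball of radius \<open>s\<close>, provided that \<open>s G\<close> is large (\<open>localised_interpolation\<close>).

  For this, multiply \<open>w\<close> by a smooth window \<open>\<eta>((x - y) / s)\<close> supported in the ball about \<open>y\<close>, apply the
  interpolation inequality to each product, where the mass is at most \<open>S\<close>, and integrate over all centres \<open>y\<close>.
  On the right this produces \<open>s\<^sup>2 \<integral>\<eta>\<^sup>2\<close> times \<open>C S G\<^sup>2\<close>, and an error from the gradient of the window
  which does not grow with \<open>s\<close> (\<open>cut_grad_average\<close>).
  On the left, a local quartic term would give exactly \<open>s\<^sup>2 \<integral>\<eta>\<^sup>4\<close> times itself. The term with \<open>\<B>\<close> is
  nonlocal, but on the Fourier side the average over \<open>y\<close> only replaces the multiplier by its mean against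
  a probability density at frequency scale \<open>1 / s\<close> (\<open>window_average\<close>). Because the multiplier is
  homogeneous of degree \<open>0\<close> and smooth away from the origin, the change is small at frequencies much larger
  than \<open>1 / s\<close>; on the low frequencies, up to a small multiple of \<open>G\<close>, the transform of \<open>|w|\<^sup>2\<close> is bounded by the
  mass, so that they contribute a small multiple of \<open>G\<^sup>2\<close> (\<open>cut_interaction_lower\<close>). Since the
  multiplier is nonnegative, \<open>Q\<close> also controls \<open>\<integral>|w|\<^sup>4\<close>. Finally \<open>\<integral>\<eta>\<^sup>4 / \<integral>\<eta>\<^sup>2\<close>
  can be brought as close to \<open>1\<close> as desired, by windows close to the indicator of a square (\<open>sharp_window\<close>).

  This argument rests on the identity \<open>Q(w) = (2\<pi>)\<^sup>-\<^sup>2 \<integral> (1 + \<gamma> m(\<xi>)) |(|w|\<^sup>2)\<^sup>^(\<xi>)|\<^sup>2 d\<xi>\<close>, where \<open>m\<close> is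
  the multiplier (\<open>quartic_fourier\<close>), hence on the \<open>L\<^sup>2\<close> theory of the Fourier transform: Plancherel's
  theorem and surjectivity. It needs \<open>u(t) \<in> L\<^sup>4\<close> for every \<open>t\<close> in \<open>(0, T)\<close> (\<open>solution_L4\<close>), and that the gradient
  norm may be computed from the product rule, that is, uniqueness of weak derivatives
  (\<open>weak_deriv_unique\<close>).\<close>

section \<open>The space \<open>L\<^sup>2\<close>\<close>

lemma measurable_cnj [measurable]: "cnj \<in> borel_measurable borel"
  by (intro borel_measurable_continuous_onI continuous_intros)

lemma L2_measurable: "f \<in> L2 \<Longrightarrow> f \<in> borel_measurable borel"
  by (simp add: L2_def)

lemma L2_integrable: "f \<in> L2 \<Longrightarrow> integrable lborel (\<lambda>x. (cmod (f x))\<^sup>2)"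
  by (simp add: L2_def)

lemma L2_norm_nonneg [simp]: "0 \<le> L2_norm f"
  by (simp add: L2_norm_def)

lemma L2_norm_sq: "(L2_norm f)\<^sup>2 = (LINT x|lborel. (cmod (f x))\<^sup>2)"
  by (simp add: L2_norm_def)

lemma L2_nn_integral:
  assumes "f \<in> L2"
  shows "(\<integral>\<^sup>+x. ennreal ((cmod (f x))\<^sup>2) \<partial>lborel) = ennreal ((L2_norm f)\<^sup>2)"
  unfolding L2_norm_sq by (intro nn_integral_eq_integral L2_integrable assms) auto

lemma L2I_nn:
  assumes "f \<in> borel_measurable borel"
    and "(\<integral>\<^sup>+x. ennreal ((cmod (f x))\<^sup>2) \<partial>lborel) \<le> ennreal C" and "C \<ge> 0"
  shows "f \<in> L2" "(L2_norm f)\<^sup>2 \<le> C"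
proof -
  have "(\<integral>\<^sup>+x. ennreal (norm ((cmod (f x))\<^sup>2)) \<partial>lborel) < \<infinity>"
    using assms(2) by (auto simp: le_less_trans)
  with assms(1) show f: "f \<in> L2"
    by (auto simp: L2_def integrable_iff_bounded)
  from L2_nn_integral[OF f] assms show "(L2_norm f)\<^sup>2 \<le> C" by simp
qed

lemma L2_bound:
  assumes "g \<in> L2" "f \<in> borel_measurable borel" "\<And>x. cmod (f x) \<le> c * cmod (g x)"
  shows "f \<in> L2"
proof -
  have "integrable lborel (\<lambda>x. (cmod (f x))\<^sup>2)"
  proof (rule Bochner_Integration.integrable_bound)
    show "integrable lborel (\<lambda>x. c\<^sup>2 * (cmod (g x))\<^sup>2)"
      using L2_integrable[OF assms(1)] by simp
    show "AE x in lborel. norm ((cmod (f x))\<^sup>2) \<le> norm (c\<^sup>2 * (cmod (g x))\<^sup>2)"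
      using power_mono[OF assms(3), of _ 2] by (auto simp: power_mult_distrib)
  qed (use assms in measurable)
  with assms show ?thesis by (simp add: L2_def)
qed

lemma L2_cmult: "f \<in> L2 \<Longrightarrow> (\<lambda>x. c * f x) \<in> L2"
  by (rule L2_bound[where c = "cmod c"]) (auto simp: norm_mult dest!: L2_measurable)

lemma L2_norm_cmult: "L2_norm (\<lambda>x. c * f x) = cmod c * L2_norm f"
  by (simp add: L2_norm_def norm_mult power_mult_distrib real_sqrt_mult)

lemma L2_cnj: "f \<in> L2 \<Longrightarrow> (\<lambda>x. cnj (f x)) \<in> L2"
  by (rule L2_bound[where c = 1]) (auto dest!: L2_measurable)

lemma L2_norm_cnj: "L2_norm (\<lambda>x. cnj (f x)) = L2_norm f"
  by (simp add: L2_norm_def)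

lemma L2_add:
  assumes "f \<in> L2" "g \<in> L2" shows "(\<lambda>x. f x + g x) \<in> L2"
proof -
  have "integrable lborel (\<lambda>x. (cmod (f x + g x))\<^sup>2)"
  proof (rule Bochner_Integration.integrable_bound)
    show "integrable lborel (\<lambda>x. 2 * (cmod (f x))\<^sup>2 + 2 * (cmod (g x))\<^sup>2)"
      using assms[THEN L2_integrable] by simp
    have "(cmod (f x + g x))\<^sup>2 \<le> 2 * (cmod (f x))\<^sup>2 + 2 * (cmod (g x))\<^sup>2" for x
    proof -
      have "(cmod (f x + g x))\<^sup>2 \<le> (cmod (f x) + cmod (g x))\<^sup>2"
        by (intro power_mono norm_triangle_ineq) auto
      also have "\<dots> \<le> 2 * (cmod (f x))\<^sup>2 + 2 * (cmod (g x))\<^sup>2"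
        using sum_squares_bound[of "cmod (f x)" "cmod (g x)"] by (simp add: power2_sum)
      finally show ?thesis .
    qed
    then show "AE x in lborel. norm ((cmod (f x + g x))\<^sup>2)
        \<le> norm (2 * (cmod (f x))\<^sup>2 + 2 * (cmod (g x))\<^sup>2)"
      by simp
  qed (use assms[THEN L2_measurable] in measurable)
  with assms[THEN L2_measurable] show ?thesis by (simp add: L2_def)
qed

lemma L2_diff: "f \<in> L2 \<Longrightarrow> g \<in> L2 \<Longrightarrow> (\<lambda>x. f x - g x) \<in> L2"
  using L2_add[of f "\<lambda>x. (-1) * g x"] L2_cmult[of g "-1"] by simp

lemma L2_integrable_mult:
  assumes "f \<in> L2" "g \<in> L2" shows "integrable lborel (\<lambda>x. f x * g x)"
proof (rule Bochner_Integration.integrable_bound)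
  show "integrable lborel (\<lambda>x. (cmod (f x))\<^sup>2 + (cmod (g x))\<^sup>2)"
    using assms[THEN L2_integrable] by simp
  have "cmod (f x * g x) \<le> (cmod (f x))\<^sup>2 + (cmod (g x))\<^sup>2" for x
  proof -
    have "2 * (cmod (f x) * cmod (g x)) \<le> (cmod (f x))\<^sup>2 + (cmod (g x))\<^sup>2"
      using sum_squares_bound[of "cmod (f x)" "cmod (g x)"] by simp
    moreover have "0 \<le> cmod (f x) * cmod (g x)" by simp
    ultimately show ?thesis unfolding norm_mult by linarith
  qed
  then show "AE x in lborel. norm (f x * g x) \<le> norm ((cmod (f x))\<^sup>2 + (cmod (g x))\<^sup>2)"
    by simp
qed (use assms[THEN L2_measurable] in measurable)

lemma L2_Cauchy_Schwarz_nn: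
  assumes "f \<in> L2" "g \<in> L2"
  shows "(LINT x|lborel. cmod (f x) * cmod (g x)) \<le> L2_norm f * L2_norm g"
proof -
  note [measurable] = assms[THEN L2_measurable]
  have int: "integrable lborel (\<lambda>x. cmod (f x) * cmod (g x))"
    using integrable_norm[OF L2_integrable_mult[OF assms]] by (simp add: norm_mult)
  have "ennreal ((LINT x|lborel. cmod (f x) * cmod (g x))\<^sup>2) =
      (\<integral>\<^sup>+x. ennreal (cmod (f x)) * ennreal (cmod (g x)) \<partial>lborel)\<^sup>2"
    by (subst ennreal_power[symmetric], simp)
      (subst nn_integral_eq_integral[OF int, symmetric], auto simp: ennreal_mult)
  also have "\<dots> \<le> (\<integral>\<^sup>+x. (ennreal (cmod (f x)))\<^sup>2 \<partial>lborel) * (\<integral>\<^sup>+x. (ennreal (cmod (g x)))\<^sup>2 \<partial>lborel)"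
    by (rule Cauchy_Schwarz_nn_integral) auto
  also have "\<dots> = ennreal ((L2_norm f * L2_norm g)\<^sup>2)"
    using assms[THEN L2_nn_integral] by (simp add: ennreal_power power_mult_distrib ennreal_mult)
  finally have "(LINT x|lborel. cmod (f x) * cmod (g x))\<^sup>2 \<le> (L2_norm f * L2_norm g)\<^sup>2"
    by (simp add: ennreal_le_iff)
  then show ?thesis by (rule power2_le_imp_le) simp
qed

lemma L2_Cauchy_Schwarz:
  assumes "f \<in> L2" "g \<in> L2"
  shows "cmod (LINT x|lborel. f x * g x) \<le> L2_norm f * L2_norm g"
  using integral_norm_bound[of lborel "\<lambda>x. f x * g x"] L2_Cauchy_Schwarz_nn[OF assms]
  by (simp add: norm_mult)

lemma L2_norm_sq_add:
  assumes "f \<in> L2" "g \<in> L2"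
  shows "(L2_norm (\<lambda>x. f x + g x))\<^sup>2 =
    (L2_norm f)\<^sup>2 + (L2_norm g)\<^sup>2 + 2 * Re (LINT x|lborel. f x * cnj (g x))"
proof -
  have "(cmod (f x + g x))\<^sup>2 = (cmod (f x))\<^sup>2 + (cmod (g x))\<^sup>2 + 2 * Re (f x * cnj (g x))" for x
    by (simp add: cmod_power2 power2_sum algebra_simps)
  moreover have "integrable lborel (\<lambda>x. f x * cnj (g x))"
    by (intro L2_integrable_mult L2_cnj assms)
  ultimately show ?thesis
    using assms[THEN L2_integrable] unfolding L2_norm_sq by (simp del: times_complex.sel)
qed

lemma L2_norm_triangle:
  assumes "f \<in> L2" "g \<in> L2"
  shows "L2_norm (\<lambda>x. f x + g x) \<le> L2_norm f + L2_norm g"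
proof (rule power2_le_imp_le)
  have "Re (LINT x|lborel. f x * cnj (g x)) \<le> L2_norm f * L2_norm g"
    using L2_Cauchy_Schwarz[OF assms(1) L2_cnj[OF assms(2)]] complex_Re_le_cmod order_trans
    by (fastforce simp: L2_norm_cnj)
  then show "(L2_norm (\<lambda>x. f x + g x))\<^sup>2 \<le> (L2_norm f + L2_norm g)\<^sup>2"
    by (simp add: L2_norm_sq_add[OF assms] power2_sum)
qed simp

lemma L2_norm_minus_commute: "L2_norm (\<lambda>x. f x - g x) = L2_norm (\<lambda>x. g x - f x)"
  by (simp add: L2_norm_def norm_minus_commute)

lemma L2_norm_triangle_diff:
  assumes "f \<in> L2" "g \<in> L2" "h \<in> L2"
  shows "L2_norm (\<lambda>x. f x - h x) \<le> L2_norm (\<lambda>x. f x - g x) + L2_norm (\<lambda>x. g x - h x)"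
  using L2_norm_triangle[OF L2_diff[OF assms(1,2)] L2_diff[OF assms(2,3)]] by simp

lemma L2_norm_diff_le:
  assumes "f \<in> L2" "g \<in> L2"
  shows "\<bar>L2_norm f - L2_norm g\<bar> \<le> L2_norm (\<lambda>x. f x - g x)"
  using L2_norm_triangle[OF L2_diff[OF assms] assms(2)]
    L2_norm_triangle[OF L2_diff[OF assms(2,1)] assms(1)] L2_norm_minus_commute[of f g] by simp

lemma L2_norm_cong_AE:
  assumes "f \<in> borel_measurable borel" "g \<in> borel_measurable borel" "AE x in lborel. f x = g x"
  shows "L2_norm f = L2_norm g"
  unfolding L2_norm_def
  by (rule arg_cong[where f = sqrt], rule integral_cong_AE) (use assms in auto)

lemma L2_norm_zero_AE:
  assumes "f \<in> L2" "L2_norm f = 0" shows "AE x in lborel. f x = 0"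
proof -
  have "(LINT x|lborel. (cmod (f x))\<^sup>2) = 0"
    using assms(2) L2_norm_sq[of f] by simp
  then show ?thesis
    using integral_nonneg_eq_0_iff_AE[OF L2_integrable[OF assms(1)]] by simp
qed

lemma L2_limit_unique:
  assumes "g \<in> L2" "h \<in> L2" "\<And>R. f R \<in> L2" "F \<noteq> bot"
    and "((\<lambda>R. L2_norm (\<lambda>x. f R x - g x)) \<longlongrightarrow> 0) F"
    and "((\<lambda>R. L2_norm (\<lambda>x. f R x - h x)) \<longlongrightarrow> 0) F"
  shows "AE x in lborel. g x = h x"
proof -
  have "L2_norm (\<lambda>x. g x - h x) \<le> L2_norm (\<lambda>x. f R x - g x) + L2_norm (\<lambda>x. f R x - h x)" for R
    using L2_norm_triangle_diff[OF assms(1) assms(3)[of R] assms(2)]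
      L2_norm_minus_commute[of g "f R"] by simp
  then have "L2_norm (\<lambda>x. g x - h x) \<le> 0 + 0"
    using assms(4) by (intro tendsto_lowerbound[OF tendsto_add[OF assms(5,6)]]) auto
  then show ?thesis
    using L2_norm_zero_AE[OF L2_diff[OF assms(1,2)]] L2_norm_nonneg[of "\<lambda>x. g x - h x"] by simp
qed

lemma L2_dominated_tendsto:
  assumes "g \<in> L2" "\<And>n. f n \<in> borel_measurable borel"
    and "AE x in lborel. (\<lambda>n. f n x) \<longlonglongrightarrow> 0" "\<And>n x. cmod (f n x) \<le> c * cmod (g x)"
  shows "(\<lambda>n. L2_norm (f n)) \<longlonglongrightarrow> 0"
proof -
  have "(\<lambda>n. LINT x|lborel. (cmod (f n x))\<^sup>2) \<longlonglongrightarrow> (LINT (x::plane)|lborel. (0::real))"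
  proof (rule integral_dominated_convergence)
    show "integrable lborel (\<lambda>x. c\<^sup>2 * (cmod (g x))\<^sup>2)"
      using L2_integrable[OF assms(1)] by simp
    show "AE x in lborel. (\<lambda>n. (cmod (f n x))\<^sup>2) \<longlonglongrightarrow> 0"
      using assms(3) by eventually_elim (use tendsto_power tendsto_norm_zero in fastforce)
    show "AE x in lborel. norm ((cmod (f n x))\<^sup>2) \<le> c\<^sup>2 * (cmod (g x))\<^sup>2" for n
      using power_mono[OF assms(4), of _ _ 2] by (auto simp: power_mult_distrib)
  qed (use assms in auto)
  then show ?thesis unfolding L2_norm_def using tendsto_real_sqrt by fastforce
qed

lemma L2_AE_subseq:
  assumes "\<And>n. f n \<in> L2" "g \<in> L2" "(\<lambda>n. L2_norm (\<lambda>x. f n x - g x)) \<longlonglongrightarrow> 0"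
  obtains r :: "nat \<Rightarrow> nat" where "strict_mono r" "AE x in lborel. (\<lambda>n. f (r n) x) \<longlonglongrightarrow> g x"
proof -
  have "(\<lambda>n. LINT x|lborel. norm ((cmod (f n x - g x))\<^sup>2 :: real)) \<longlonglongrightarrow> 0"
    using tendsto_power[OF assms(3), of 2] by (simp add: L2_norm_sq)
  from tendsto_L1_AE_subseq[OF _ this] obtain r where r: "strict_mono r"
    "AE x in lborel. (\<lambda>n. (cmod (f (r n) x - g x))\<^sup>2) \<longlonglongrightarrow> 0"
    using L2_integrable[OF L2_diff[OF assms(1,2)]] by auto
  have "AE x in lborel. (\<lambda>n. f (r n) x) \<longlonglongrightarrow> g x"
    using r(2)
  proof eventually_elim
    case (elim x)
    then have "(\<lambda>n. cmod (f (r n) x - g x)) \<longlonglongrightarrow> 0"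
      using tendsto_real_sqrt[OF elim] by simp
    then show ?case by (simp add: LIM_zero_iff tendsto_norm_zero_iff)
  qed
  with r(1) show ?thesis by (rule that)
qed

lemma summable_weighted_squares:
  fixes a :: "nat \<Rightarrow> real"
  assumes "(\<Sum>k. ennreal (4^k * (a k)\<^sup>2)) \<noteq> \<infinity>" "\<And>k. a k \<ge> 0"
  shows "summable a"
proof -
  define S where "S = (\<Sum>k. ennreal (4^k * (a k)\<^sup>2))"
  obtain C where C: "C \<ge> 0" "S = ennreal C"
    using assms(1) unfolding S_def[symmetric] by (cases S) auto
  have "a k \<le> sqrt C * (1/2)^k" for k
  proof -
    have "ennreal (4^k * (a k)\<^sup>2) \<le> ennreal C"
    proof -
      have "(\<Sum>j\<in>{k}. ennreal (4^j * (a j)\<^sup>2)) \<le> S"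
        unfolding S_def by (rule sum_le_suminf) auto
      moreover have "(\<Sum>j\<in>{k}. ennreal (4^j * (a j)\<^sup>2)) = ennreal (4^k * (a k)\<^sup>2)"
        by simp
      ultimately show ?thesis unfolding C(2) by (simp only:)
    qed
    then have "4^k * (a k)\<^sup>2 \<le> C" using C(1) by (simp add: ennreal_le_iff)
    moreover have "(2^k)\<^sup>2 = (4::real)^k"
      using power_mult[of "2::real" k 2] power_mult[of "2::real" 2 k] by (simp add: mult.commute)
    ultimately have "(2^k * a k)\<^sup>2 \<le> (sqrt C)\<^sup>2"
      using C(1) by (simp only: power_mult_distrib) simp
    then have "2^k * a k \<le> sqrt C"
      by (rule power2_le_imp_le) (use C in simp)
    then show ?thesis by (simp add: power_one_over pos_le_divide_eq mult.commute)
  qed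
  then show ?thesis
    using assms(2)
    by (intro summable_comparison_test'[OF summable_mult[OF summable_geometric[of "1/2"]], of 0 a "sqrt C"])
      auto
qed

text \<open>Riesz--Fischer. Along a subsequence with \<open>\<parallel>d\<^sub>k\<parallel>\<^sup>2 \<le> 8\<^sup>-\<^sup>k\<close> for the increments \<open>d\<^sub>k\<close>, the sum of
  \<open>4\<^sup>k |d\<^sub>k|\<^sup>2\<close> is integrable, so that almost everywhere \<open>|d\<^sub>k| = O(2\<^sup>-\<^sup>k)\<close> and the
  subsequence converges; Fatou's lemma turns this into convergence in norm.\<close>

lemma L2_complete:
  assumes f: "\<And>n. f n \<in> L2"
    and Cauchy: "\<And>e. e > 0 \<Longrightarrow> \<exists>N. \<forall>m\<ge>N. \<forall>n\<ge>N. L2_norm (\<lambda>x. f m x - f n x) < e"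
  obtains g where "g \<in> L2" "(\<lambda>n. L2_norm (\<lambda>x. f n x - g x)) \<longlonglongrightarrow> 0"
proof -
  note [measurable] = f[THEN L2_measurable]
  have "\<exists>N. \<forall>m\<ge>N. \<forall>n\<ge>N. L2_norm (\<lambda>x. f m x - f n x) < sqrt ((1/8)^k)" for k :: nat
    by (rule Cauchy) simp
  then obtain N where N: "\<And>k m n. m \<ge> N k \<Longrightarrow> n \<ge> N k \<Longrightarrow> L2_norm (\<lambda>x. f m x - f n x) < sqrt ((1/8)^k)"
    by metis
  define r where "r k = (\<Sum>i\<le>k. N i) + k" for k
  have rN: "r j \<ge> N k" if "j \<ge> k" for j k
  proof -
    have "N k \<le> (\<Sum>i\<le>j. N i)" using that by (intro member_le_sum) auto
    then show ?thesis by (simp add: r_def)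
  qed
  have r_ge: "r k \<ge> k" for k by (simp add: r_def)
  define d where "d k x = f (r (Suc k)) x - f (r k) x" for k x
  have [measurable]: "d k \<in> borel_measurable borel" for k
    unfolding d_def by measurable
  have dL2: "d k \<in> L2" for k
    unfolding d_def by (intro L2_diff f)
  have dnorm: "(L2_norm (d k))\<^sup>2 \<le> (1/8)^k" for k
  proof -
    have "L2_norm (d k) \<le> sqrt ((1/8)^k)"
      unfolding d_def using N[OF rN rN, of k "Suc k" k] by simp
    from power_mono[OF this, of 2] show ?thesis by simp
  qed
  have "(\<integral>\<^sup>+x. (\<Sum>k. ennreal (4^k * (cmod (d k x))\<^sup>2)) \<partial>lborel) =
      (\<Sum>k. \<integral>\<^sup>+x. ennreal (4^k * (cmod (d k x))\<^sup>2) \<partial>lborel)"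
    by (rule nn_integral_suminf) measurable
  also have "\<dots> = (\<Sum>k. ennreal (4^k * (L2_norm (d k))\<^sup>2))"
    by (intro suminf_cong) (simp add: ennreal_mult' nn_integral_cmult L2_nn_integral[OF dL2])
  also have "\<dots> \<le> (\<Sum>k. ennreal ((1/2)^k))"
  proof (intro suminf_le ennreal_leI)
    fix k :: nat
    have "4^k * (L2_norm (d k))\<^sup>2 \<le> 4^k * (1/8)^k" using dnorm by (intro mult_left_mono) auto
    also have "\<dots> = ((1/2)::real)^k" by (simp flip: power_mult_distrib)
    finally show "4^k * (L2_norm (d k))\<^sup>2 \<le> (1/2)^k" .
  qed auto
  also have "\<dots> = ennreal (\<Sum>k. (1/2)^k)"
    by (rule suminf_ennreal2) (auto simp: summable_geometric)
  finally have fin: "(\<integral>\<^sup>+x. (\<Sum>k. ennreal (4^k * (cmod (d k x))\<^sup>2)) \<partial>lborel) \<noteq> \<infinity>"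
    by (auto simp: top_unique)
  have "AE x in lborel. (\<Sum>k. ennreal (4^k * (cmod (d k x))\<^sup>2)) \<noteq> \<infinity>"
    by (rule nn_integral_noteq_infinite[OF _ fin]) measurable
  then have conv: "AE x in lborel. convergent (\<lambda>k. f (r k) x)"
  proof eventually_elim
    case (elim x)
    then have "summable (\<lambda>k. cmod (d k x))"
      by (intro summable_weighted_squares) auto
    then have "summable (\<lambda>k. d k x)" by (rule summable_norm_cancel)
    then have "convergent (\<lambda>n. \<Sum>k<n. d k x)" by (simp add: summable_iff_convergent)
    moreover have "(\<Sum>k<n. d k x) = f (r n) x - f (r 0) x" for n
      unfolding d_def by (rule sum_lessThan_telescope)
    ultimately have "convergent (\<lambda>n. (f (r n) x - f (r 0) x) + f (r 0) x)"
      by (intro convergent_add convergent_const) simp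
    then show ?case by simp
  qed
  define g where "g x = lim (\<lambda>k. f (r k) x)" for x
  have [measurable]: "g \<in> borel_measurable borel"
    unfolding g_def by measurable
  have lim: "AE x in lborel. (\<lambda>k. f (r k) x) \<longlonglongrightarrow> g x"
    using conv by eventually_elim (simp add: g_def convergent_LIMSEQ_iff)
  have key: "(\<integral>\<^sup>+x. ennreal ((cmod (f n x - g x))\<^sup>2) \<partial>lborel) \<le> ennreal (e\<^sup>2)"
    if e: "e > 0" and M: "\<And>m. m \<ge> M \<Longrightarrow> L2_norm (\<lambda>x. f n x - f m x) < e" for n e M
  proof -
    have "(\<integral>\<^sup>+x. ennreal ((cmod (f n x - g x))\<^sup>2) \<partial>lborel) \<le>
        (\<integral>\<^sup>+x. liminf (\<lambda>k. ennreal ((cmod (f n x - f (r k) x))\<^sup>2)) \<partial>lborel)"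
    proof (rule nn_integral_mono_AE, use lim in eventually_elim)
      case (elim x)
      have "(\<lambda>k. ennreal ((cmod (f n x - f (r k) x))\<^sup>2)) \<longlonglongrightarrow> ennreal ((cmod (f n x - g x))\<^sup>2)"
        by (intro tendsto_ennrealI tendsto_intros elim)
      from lim_imp_Liminf[OF sequentially_bot this] show ?case by simp
    qed
    also have "\<dots> \<le> liminf (\<lambda>k. \<integral>\<^sup>+x. ennreal ((cmod (f n x - f (r k) x))\<^sup>2) \<partial>lborel)"
      by (rule nn_integral_liminf) measurable
    also have "\<dots> \<le> ennreal (e\<^sup>2)"
    proof (rule Liminf_le)
      show "eventually (\<lambda>k. (\<integral>\<^sup>+x. ennreal ((cmod (f n x - f (r k) x))\<^sup>2) \<partial>lborel) \<le> ennreal (e\<^sup>2)) sequentially"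
      proof (rule eventually_sequentiallyI[of M])
        fix k assume "M \<le> k"
        then have "L2_norm (\<lambda>x. f n x - f (r k) x) < e" using r_ge[of k] by (intro M) simp
        from power_mono[OF less_imp_le[OF this], of 2]
        show "(\<integral>\<^sup>+x. ennreal ((cmod (f n x - f (r k) x))\<^sup>2) \<partial>lborel) \<le> ennreal (e\<^sup>2)"
          by (subst L2_nn_integral[OF L2_diff[OF f f]]) (simp add: ennreal_leI)
      qed
    qed simp
    finally show ?thesis .
  qed
  have gL2: "g \<in> L2"
  proof -
    obtain N1 where N1: "\<forall>m\<ge>N1. \<forall>n\<ge>N1. L2_norm (\<lambda>x. f m x - f n x) < 1"
      using Cauchy[of 1] by auto
    have "(\<lambda>x. f N1 x - g x) \<in> L2"
      by (rule L2I_nn[OF _ key[of 1 N1 N1]]) (use N1 in auto)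
    from L2_diff[OF f[of N1] this] show ?thesis by simp
  qed
  have "(\<lambda>n. L2_norm (\<lambda>x. f n x - g x)) \<longlonglongrightarrow> 0"
  proof (rule LIMSEQ_I)
    fix e :: real assume e: "e > 0"
    obtain M where M: "\<forall>m\<ge>M. \<forall>n\<ge>M. L2_norm (\<lambda>x. f m x - f n x) < e/2"
      using Cauchy[of "e/2"] e by auto
    have "norm (L2_norm (\<lambda>x. f n x - g x) - 0) < e" if "n \<ge> M" for n
    proof -
      have "(L2_norm (\<lambda>x. f n x - g x))\<^sup>2 \<le> (e/2)\<^sup>2"
        by (rule L2I_nn(2)[OF _ key[of "e/2" M n]]) (use M e that in auto)
      then have "L2_norm (\<lambda>x. f n x - g x) \<le> e/2"
        by (rule power2_le_imp_le) (use e in simp)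
      then show ?thesis using e by simp
    qed
    then show "\<exists>no. \<forall>n\<ge>no. norm (L2_norm (\<lambda>x. f n x - g x) - 0) < e" by blast
  qed
  with gL2 show ?thesis by (rule that)
qed

section \<open>Integrals over the plane\<close>

lemma nn_integral_plane_affine:
  fixes f :: "plane \<Rightarrow> ennreal"
  assumes "f \<in> borel_measurable borel" "c \<noteq> 0"
  shows "(\<integral>\<^sup>+x. f x \<partial>lborel) = ennreal (c\<^sup>2) * (\<integral>\<^sup>+x. f (t + c *\<^sub>R x) \<partial>lborel)"
  using assms by (subst lborel_affine[OF assms(2), of t])
    (simp add: nn_integral_density nn_integral_distr nn_integral_cmult)

lemma
  fixes f :: "plane \<Rightarrow> 'b::{banach, second_countable_topology}"
  assumes "f \<in> borel_measurable borel" "c \<noteq> 0"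
  shows integrable_plane_affine: "integrable lborel (\<lambda>x. f (t + c *\<^sub>R x)) \<longleftrightarrow> integrable lborel f"
    and integral_plane_affine: "(LINT x|lborel. f (t + c *\<^sub>R x)) = (LINT x|lborel. f x) /\<^sub>R c\<^sup>2"
proof -
  note [measurable] = assms(1)
  have "integrable lborel f \<longleftrightarrow>
      integrable (Nonnegative_Lebesgue_Integration.density (distr lborel borel (\<lambda>x. t + c *\<^sub>R x)) (\<lambda>_. \<bar>c\<bar>^DIM(plane))) f"
    using lborel_affine[OF assms(2), of t] by simp
  also have "\<dots> \<longleftrightarrow> integrable lborel (\<lambda>x. f (t + c *\<^sub>R x))"
    using assms(2) integrable_scaleR_right[of "inverse (c\<^sup>2)" lborel "\<lambda>x. c\<^sup>2 *\<^sub>R f (t + c *\<^sub>R x)"]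
    by (subst integrable_density) (auto simp: integrable_distr_eq)
  finally show "integrable lborel (\<lambda>x. f (t + c *\<^sub>R x)) \<longleftrightarrow> integrable lborel f" ..
  have "(LINT x|lborel. f x) =
      (LINT x|Nonnegative_Lebesgue_Integration.density (distr lborel borel (\<lambda>x. t + c *\<^sub>R x)) (\<lambda>_. \<bar>c\<bar>^DIM(plane)). f x)"
    using lborel_affine[OF assms(2), of t] by simp
  also have "\<dots> = c\<^sup>2 *\<^sub>R (LINT x|lborel. f (t + c *\<^sub>R x))"
    by (subst integral_density) (auto simp: integral_distr)
  finally show "(LINT x|lborel. f (t + c *\<^sub>R x)) = (LINT x|lborel. f x) /\<^sub>R c\<^sup>2"
    using assms(2) by simp
qed

lemma
  fixes f :: "plane \<Rightarrow> 'b::{banach, second_countable_topology}"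
  assumes "f \<in> borel_measurable borel"
  shows integrable_plane_shift: "integrable lborel (\<lambda>x. f (x + t)) \<longleftrightarrow> integrable lborel f"
    and integral_plane_shift: "(LINT x|lborel. f (x + t)) = (LINT x|lborel. f x)"
  using integrable_plane_affine[OF assms, of 1 t] integral_plane_affine[OF assms, of 1 t]
  by (simp_all add: add.commute)

lemma nn_integral_plane_shift:
  fixes f :: "plane \<Rightarrow> ennreal"
  assumes "f \<in> borel_measurable borel"
  shows "(\<integral>\<^sup>+x. f (x + t) \<partial>lborel) = (\<integral>\<^sup>+x. f x \<partial>lborel)"
  using nn_integral_plane_affine[OF assms, of 1 t] by (simp add: add.commute)

lemma
  fixes f :: "'a::euclidean_space \<Rightarrow> real \<Rightarrow> complex"
  assumes "\<And>b. b \<in> Basis \<Longrightarrow> integrable lborel (f b)"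
  shows integrable_lborel_prod: "integrable lborel (\<lambda>x::'a. \<Prod>b\<in>Basis. f b (x \<bullet> b))"
    and integral_lborel_prod:
      "(LINT (x::'a)|lborel. (\<Prod>b\<in>Basis. f b (x \<bullet> b))) = (\<Prod>b\<in>Basis. (LINT t|lborel. f b t))"
proof -
  interpret product_sigma_finite "\<lambda>_::'a. lborel :: real measure" ..
  have [measurable]: "f b \<in> borel_measurable borel" if "b \<in> Basis" for b
    using borel_measurable_integrable[OF assms[OF that]] by simp
  have m: "(\<lambda>x::'a. \<Prod>b\<in>Basis. f b (x \<bullet> b)) \<in> borel_measurable borel"
    by measurable
  show "integrable lborel (\<lambda>x::'a. \<Prod>b\<in>Basis. f b (x \<bullet> b))"
    by (subst lborel_eq, subst integrable_distr_eq[OF _ m])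
      (auto simp: inner_sum_left_Basis intro!: product_integrable_prod assms cong: prod.cong)
  show "(LINT (x::'a)|lborel. (\<Prod>b\<in>Basis. f b (x \<bullet> b))) = (\<Prod>b\<in>Basis. (LINT t|lborel. f b t))"
    by (subst lborel_eq, subst integral_distr[OF _ m])
      (auto simp: inner_sum_left_Basis intro!: product_integral_prod assms cong: prod.cong)
qed

section \<open>The Fourier transform of integrable functions\<close>

lemma cis_measurable [measurable]: "cis \<in> borel_measurable borel"
  by (intro borel_measurable_continuous_onI continuous_intros)

lemma fourier_measurable [measurable]:
  assumes [measurable]: "f \<in> borel_measurable borel"
  shows "fourier_integral f \<in> borel_measurable borel"
  unfolding fourier_integral_def by measurable

lemma integrable_cis_mult:
  fixes f :: "plane \<Rightarrow> complex"
  assumes "integrable lborel f" and [measurable]: "t \<in> borel_measurable borel"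
  shows "integrable lborel (\<lambda>x. cis (t x) * f x)"
  by (rule Bochner_Integration.integrable_bound[OF assms(1)])
    (use assms(1)[THEN borel_measurable_integrable] in \<open>auto simp: norm_mult\<close>)

lemma fourier_bound:
  "cmod (fourier_integral f \<xi>) \<le> (LINT x|lborel. cmod (f x))"
  unfolding fourier_integral_def
  using integral_norm_bound[of lborel "\<lambda>x. cis (- (x \<bullet> \<xi>)) * f x"] by (simp add: norm_mult)

lemma fourier_add:
  assumes "integrable lborel f" "integrable lborel g"
  shows "fourier_integral (\<lambda>x. f x + g x) \<xi> = fourier_integral f \<xi> + fourier_integral g \<xi>"
  unfolding fourier_integral_def using assms[THEN integrable_cis_mult, of "\<lambda>x. - (x \<bullet> \<xi>)"]
  by (simp add: ring_distribs)

lemma fourier_diff: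
  assumes "integrable lborel f" "integrable lborel g"
  shows "fourier_integral (\<lambda>x. f x - g x) \<xi> = fourier_integral f \<xi> - fourier_integral g \<xi>"
  unfolding fourier_integral_def using assms[THEN integrable_cis_mult, of "\<lambda>x. - (x \<bullet> \<xi>)"]
  by (simp add: ring_distribs)

lemma integrable_pair_mult:
  fixes f g :: "plane \<Rightarrow> complex"
  assumes "integrable lborel f" "integrable lborel g"
  shows "integrable (lborel \<Otimes>\<^sub>M lborel) (\<lambda>(x, y). f x * g y)"
proof (rule lborel_pair.Fubini_integrable)
  note [measurable] = assms[THEN borel_measurable_integrable]
  show "(\<lambda>(x, y). f x * g y) \<in> borel_measurable (lborel \<Otimes>\<^sub>M lborel)" by measurable
  show "integrable lborel (\<lambda>x. LINT y|lborel. norm (case (x, y) of (x, y) \<Rightarrow> f x * g y))"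
    using assms by (simp add: norm_mult)
  show "AE x in lborel. integrable lborel (\<lambda>y. case (x, y) of (x, y) \<Rightarrow> f x * g y)"
    using assms by simp
qed

lemma fourier_duality:
  assumes "integrable lborel f" "integrable lborel g"
  shows "(LINT \<xi>|lborel. fourier_integral f \<xi> * g \<xi>) = (LINT x|lborel. f x * fourier_integral g x)"
proof -
  note [measurable] = assms[THEN borel_measurable_integrable]
  have int: "integrable (lborel \<Otimes>\<^sub>M lborel) (\<lambda>(x, \<xi>). cis (- (x \<bullet> \<xi>)) * (f x * g \<xi>))"
    by (rule Bochner_Integration.integrable_bound[OF integrable_pair_mult[OF assms]])
      (auto simp: norm_mult case_prod_beta)
  have "(LINT \<xi>|lborel. fourier_integral f \<xi> * g \<xi>) =
      (LINT \<xi>|lborel. LINT x|lborel. cis (- (x \<bullet> \<xi>)) * (f x * g \<xi>))"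
    unfolding fourier_integral_def by (subst integral_mult_left_zero[symmetric]) (simp add: mult.assoc)
  also have "\<dots> = (LINT x|lborel. LINT \<xi>|lborel. cis (- (x \<bullet> \<xi>)) * (f x * g \<xi>))"
    by (rule lborel_pair.Fubini_integral[OF int])
  also have "\<dots> = (LINT x|lborel. f x * fourier_integral g x)"
    unfolding fourier_integral_def
    by (subst integral_mult_right_zero[symmetric]) (simp add: ac_simps inner_commute)
  finally show ?thesis .
qed

lemma fourier_cis_mult:
  "fourier_integral (\<lambda>x. cis (x \<bullet> \<eta>) * f x) \<xi> = fourier_integral f (\<xi> - \<eta>)"
  unfolding fourier_integral_def
  by (simp add: inner_diff_right cis_mult flip: mult.assoc)

subsection \<open>Gaussians\<close>

lemma
  shows integrable_gauss_real: "integrable lborel (\<lambda>x. exp (- (x\<^sup>2) / 2) :: real)"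
    and integral_gauss_real: "(LINT x|lborel. exp (- (x\<^sup>2) / 2) :: real) = sqrt (2 * pi)"
    and fourier_gauss_real:
    "(LINT x|lborel. cis (- (x * t)) * complex_of_real (exp (- (x\<^sup>2) / 2))) =
      complex_of_real (sqrt (2 * pi) * exp (- (t\<^sup>2) / 2))"
proof -
  have eq: "exp (- (x\<^sup>2) / 2) = sqrt (2 * pi) * std_normal_density x" for x :: real
    by (simp add: std_normal_density_def)
  show "integrable lborel (\<lambda>x. exp (- (x\<^sup>2) / 2) :: real)"
    unfolding eq by (intro integrable_mult_right integrable_normal_density) simp
  show "(LINT x|lborel. exp (- (x\<^sup>2) / 2) :: real) = sqrt (2 * pi)"
    unfolding eq by simp
  have "complex_of_real (exp (- (t\<^sup>2) / 2)) = char std_normal_distribution (- t)"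
    by (simp add: char_std_normal_distribution)
  also have "\<dots> = (LINT x|lborel. std_normal_density x *\<^sub>R iexp (- t * x))"
    unfolding char_def by (subst integral_density) auto
  also have "(\<lambda>x. std_normal_density x *\<^sub>R iexp (- t * x)) =
      (\<lambda>x. complex_of_real (1 / sqrt (2 * pi)) * (cis (- (x * t)) * complex_of_real (exp (- (x\<^sup>2) / 2))))"
    by (simp add: std_normal_density_def cis_conv_exp scaleR_conv_of_real ac_simps fun_eq_iff)
  also have "(LINT x|lborel. \<dots> x) = complex_of_real (1 / sqrt (2 * pi)) *
      (LINT x|lborel. cis (- (x * t)) * complex_of_real (exp (- (x\<^sup>2) / 2)))"
    by (rule integral_mult_right_zero)
  finally show "(LINT x|lborel. cis (- (x * t)) * complex_of_real (exp (- (x\<^sup>2) / 2))) =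
      complex_of_real (sqrt (2 * pi) * exp (- (t\<^sup>2) / 2))"
    by (simp add: field_simps)
qed

definition gauss :: "real \<Rightarrow> fld" where
  "gauss a = (\<lambda>x. complex_of_real (exp (- ((norm x)\<^sup>2) / (2 * a\<^sup>2))))"

lemma gauss_measurable [measurable]: "gauss a \<in> borel_measurable borel"
  unfolding gauss_def by measurable

lemma gauss_1_prod:
  "cis (- (x \<bullet> \<xi>)) * gauss 1 x =
    (\<Prod>b\<in>Basis. cis (- ((x \<bullet> b) * (\<xi> \<bullet> b))) * complex_of_real (exp (- ((x \<bullet> b)\<^sup>2) / 2)))"
proof -
  have "cis (- (x \<bullet> \<xi>)) = exp (\<Sum>b\<in>Basis. \<i> * of_real (- ((x \<bullet> b) * (\<xi> \<bullet> b))))"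
    by (subst euclidean_inner[of x \<xi>]) (simp add: cis_conv_exp sum_distrib_left sum_negf)
  moreover have "gauss 1 x = exp (\<Sum>b\<in>Basis. complex_of_real (- ((x \<bullet> b)\<^sup>2) / 2))"
  proof -
    have "(norm x)\<^sup>2 = (\<Sum>b\<in>Basis. (x \<bullet> b)\<^sup>2)"
      unfolding power2_norm_eq_inner using euclidean_inner[of x x] by (simp add: power2_eq_square)
    then have "(\<Sum>b\<in>Basis. - ((x \<bullet> b)\<^sup>2) / 2) = - ((norm x)\<^sup>2) / (2 * 1\<^sup>2)"
      by (simp add: sum_negf flip: sum_divide_distrib)
    then show ?thesis
      unfolding gauss_def by (simp only: of_real_sum[symmetric] exp_of_real)
  qed
  ultimately show ?thesis
    by (simp add: exp_sum prod.distrib cis_conv_exp flip: exp_of_real)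
qed

lemma integrable_gauss_1: "integrable lborel (gauss 1)"
proof -
  have "integrable lborel (\<lambda>x::plane. \<Prod>b\<in>Basis. complex_of_real (exp (- ((x \<bullet> b)\<^sup>2) / 2)))"
    by (rule integrable_lborel_prod) (intro integrable_of_real integrable_gauss_real)
  moreover have "gauss 1 = (\<lambda>x. \<Prod>b\<in>Basis. complex_of_real (exp (- ((x \<bullet> b)\<^sup>2) / 2)))"
    using gauss_1_prod[of _ 0] by (simp add: fun_eq_iff)
  ultimately show ?thesis by simp
qed

lemma fourier_gauss_1: "fourier_integral (gauss 1) \<xi> = 2 * pi * gauss 1 \<xi>"
proof -
  have int: "integrable lborel (\<lambda>x. cis (- (x * t)) * complex_of_real (exp (- (x\<^sup>2) / 2)))" for t :: real
    by (rule Bochner_Integration.integrable_bound[OF integrable_gauss_real]) (auto simp: norm_mult)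
  have "fourier_integral (gauss 1) \<xi> =
      (\<Prod>b\<in>Basis. complex_of_real (sqrt (2 * pi) * exp (- ((\<xi> \<bullet> b)\<^sup>2) / 2)))"
    unfolding fourier_integral_def gauss_1_prod
    by (subst integral_lborel_prod) (simp_all only: fourier_gauss_real int)
  also have "\<dots> = complex_of_real (sqrt (2 * pi)) ^ 2 * gauss 1 \<xi>"
    using gauss_1_prod[of \<xi> 0] by (simp add: prod.distrib)
  also have "complex_of_real (sqrt (2 * pi)) ^ 2 = 2 * pi"
    by (simp flip: of_real_power)
  finally show ?thesis .
qed

lemma gauss_scale: "a \<noteq> 0 \<Longrightarrow> gauss a (a *\<^sub>R x) = gauss 1 x"
  by (simp add: gauss_def power_mult_distrib)

lemma integrable_gauss: "a \<noteq> 0 \<Longrightarrow> integrable lborel (gauss a)"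
  using integrable_plane_affine[of "gauss a" a 0] integrable_gauss_1 by (simp add: gauss_scale)

lemma fourier_gauss:
  assumes "a \<noteq> 0"
  shows "fourier_integral (gauss a) \<xi> = 2 * pi * a\<^sup>2 * gauss 1 (a *\<^sub>R \<xi>)"
proof -
  have "(LINT x|lborel. cis (- ((0 + a *\<^sub>R x) \<bullet> \<xi>)) * gauss a (0 + a *\<^sub>R x)) = fourier_integral (gauss a) \<xi> /\<^sub>R a\<^sup>2"
    unfolding fourier_integral_def by (rule integral_plane_affine) (use assms in auto)
  also have "(LINT x|lborel. cis (- ((0 + a *\<^sub>R x) \<bullet> \<xi>)) * gauss a (0 + a *\<^sub>R x)) =
      fourier_integral (gauss 1) (a *\<^sub>R \<xi>)"
    unfolding fourier_integral_def using assms by (simp add: gauss_scale)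
  finally show ?thesis
    using assms by (simp add: fourier_gauss_1 scaleR_conv_of_real field_simps)
qed

lemma integral_gauss_1: "(LINT x|lborel. gauss 1 x) = 2 * pi"
  using fourier_gauss_1[of 0] by (simp add: fourier_integral_def gauss_def)


subsection \<open>Continuity of translations in \<open>L\<^sup>2\<close>\<close>

lemma L2_shift:
  assumes "f \<in> L2" shows "(\<lambda>x. f (x + h)) \<in> L2" "L2_norm (\<lambda>x. f (x + h)) = L2_norm f"
proof -
  note [measurable] = L2_measurable[OF assms]
  have m: "(\<lambda>x. (cmod (f x))\<^sup>2) \<in> borel_measurable borel" by measurable
  have "(\<lambda>x. f (x + h)) \<in> borel_measurable borel" by measurable
  with L2_integrable[OF assms] integrable_plane_shift[OF m, of h]
  show "(\<lambda>x. f (x + h)) \<in> L2" by (simp add: L2_def)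
  show "L2_norm (\<lambda>x. f (x + h)) = L2_norm f"
    unfolding L2_norm_def using integral_plane_shift[OF m, of h] by simp
qed

text \<open>Continuity at \<open>0\<close> of the translations of \<open>f\<close>. The functions with this property form a closed
  subspace, which contains the indicators of open sets and hence everything.\<close>

definition shift_cont :: "fld \<Rightarrow> bool" where
  "shift_cont f \<longleftrightarrow> f \<in> L2 \<and>
    (\<forall>h. h \<longlonglongrightarrow> 0 \<longrightarrow> (\<lambda>n. L2_norm (\<lambda>x. f (x + h n) - f x)) \<longlonglongrightarrow> 0)"

lemma shift_cont_add:
  assumes "shift_cont f" "shift_cont g" shows "shift_cont (\<lambda>x. f x + g x)"
  unfolding shift_cont_def
proof (intro conjI allI impI)
  have f: "f \<in> L2" and g: "g \<in> L2" using assms by (auto simp: shift_cont_def)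
  show "(\<lambda>x. f x + g x) \<in> L2" by (intro L2_add f g)
  fix h :: "nat \<Rightarrow> plane" assume h: "h \<longlonglongrightarrow> 0"
  have lim: "(\<lambda>n. L2_norm (\<lambda>x. f (x + h n) - f x) + L2_norm (\<lambda>x. g (x + h n) - g x)) \<longlonglongrightarrow> 0 + 0"
    using assms h by (intro tendsto_add) (auto simp: shift_cont_def)
  show "(\<lambda>n. L2_norm (\<lambda>x. f (x + h n) + g (x + h n) - (f x + g x))) \<longlonglongrightarrow> 0"
  proof (rule tendsto_sandwich[OF _ _ tendsto_const lim[simplified]])
    show "eventually (\<lambda>n. L2_norm (\<lambda>x. f (x + h n) + g (x + h n) - (f x + g x)) \<le>
        L2_norm (\<lambda>x. f (x + h n) - f x) + L2_norm (\<lambda>x. g (x + h n) - g x)) sequentially"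
    proof (rule always_eventually, rule allI)
      fix n
      show "L2_norm (\<lambda>x. f (x + h n) + g (x + h n) - (f x + g x)) \<le>
        L2_norm (\<lambda>x. f (x + h n) - f x) + L2_norm (\<lambda>x. g (x + h n) - g x)"
        using L2_norm_triangle[OF L2_diff[OF L2_shift(1)[OF f, of "h n"] f]
            L2_diff[OF L2_shift(1)[OF g, of "h n"] g]]
        by (simp add: algebra_simps)
    qed
  qed simp
qed

lemma shift_cont_cmult:
  assumes "shift_cont f" shows "shift_cont (\<lambda>x. c * f x)"
proof -
  have "(\<lambda>n. cmod c * L2_norm (\<lambda>x. f (x + h n) - f x)) \<longlonglongrightarrow> 0" if "h \<longlonglongrightarrow> 0" for h
    using assms that by (intro tendsto_mult_right_zero) (auto simp: shift_cont_def)
  with assms show ?thesis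
    unfolding shift_cont_def by (auto simp: L2_cmult simp flip: L2_norm_cmult right_diff_distrib)
qed

lemma shift_cont_zero: "shift_cont (\<lambda>x. 0)"
  by (auto simp: shift_cont_def L2_def L2_norm_def)

lemma shift_cont_sum:
  "(\<And>i. i \<in> I \<Longrightarrow> shift_cont (f i)) \<Longrightarrow> shift_cont (\<lambda>x. \<Sum>i\<in>I. f i x)"
  by (induction I rule: infinite_finite_induct) (auto simp: shift_cont_zero shift_cont_add)

lemma shift_cont_limit:
  assumes f: "f \<in> L2" and appr: "\<And>e. e > 0 \<Longrightarrow> \<exists>g. shift_cont g \<and> L2_norm (\<lambda>x. f x - g x) < e"
  shows "shift_cont f"
  unfolding shift_cont_def
proof (intro conjI allI impI f)
  fix h :: "nat \<Rightarrow> plane" assume h: "h \<longlonglongrightarrow> 0"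
  show "(\<lambda>n. L2_norm (\<lambda>x. f (x + h n) - f x)) \<longlonglongrightarrow> 0"
  proof (rule LIMSEQ_I)
    fix e :: real assume "e > 0"
    then obtain g where g: "shift_cont g" "L2_norm (\<lambda>x. f x - g x) < e/3"
      using appr[of "e/3"] by auto
    then have gL2: "g \<in> L2" and "(\<lambda>n. L2_norm (\<lambda>x. g (x + h n) - g x)) \<longlonglongrightarrow> 0"
      using h by (auto simp: shift_cont_def)
    from LIMSEQ_D[OF this(2), of "e/3"] \<open>e > 0\<close>
    obtain N where N: "\<And>n. n \<ge> N \<Longrightarrow> L2_norm (\<lambda>x. g (x + h n) - g x) < e/3" by auto
    have "norm (L2_norm (\<lambda>x. f (x + h n) - f x) - 0) < e" if "n \<ge> N" for n
    proof -
      note s = L2_shift(1)[OF f, of "h n"] L2_shift(1)[OF gL2, of "h n"]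
      have "L2_norm (\<lambda>x. f (x + h n) - f x) \<le>
          L2_norm (\<lambda>x. f (x + h n) - g (x + h n)) + L2_norm (\<lambda>x. g (x + h n) - f x)"
        by (rule L2_norm_triangle_diff[OF s f])
      also have "L2_norm (\<lambda>x. g (x + h n) - f x) \<le>
          L2_norm (\<lambda>x. g (x + h n) - g x) + L2_norm (\<lambda>x. g x - f x)"
        by (rule L2_norm_triangle_diff[OF s(2) gL2 f])
      also have "L2_norm (\<lambda>x. f (x + h n) - g (x + h n)) = L2_norm (\<lambda>x. f x - g x)"
        using L2_shift(2)[OF L2_diff[OF f gL2], of "h n"] .
      finally show ?thesis
        using N[OF that] g(2) L2_norm_minus_commute[of g f] by simp
    qed
    then show "\<exists>no. \<forall>n\<ge>no. norm (L2_norm (\<lambda>x. f (x + h n) - f x) - 0) < e" by blast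
  qed
qed

lemma indicator_L2:
  assumes "B \<in> sets borel" "emeasure lborel B < \<infinity>"
  shows "(\<lambda>x. indicator B x :: complex) \<in> L2"
    and "(L2_norm (\<lambda>x. indicator B x))\<^sup>2 = measure lborel B"
proof -
  have eq: "(cmod (indicator B x))\<^sup>2 = (indicator B x :: real)" for x
    by (auto simp: indicator_def)
  show "(\<lambda>x. indicator B x :: complex) \<in> L2"
    using assms by (simp add: L2_def eq)
  show "(L2_norm (\<lambda>x. indicator B x))\<^sup>2 = measure lborel B"
    using assms by (simp add: L2_norm_sq eq)
qed

text \<open>For an open set \<open>U\<close> the functions \<open>1\<^sub>U(x) 1\<^sub>U(x + h)\<close> tend to \<open>1\<^sub>U\<close> everywhere, since a point of
  \<open>U\<close> stays in \<open>U\<close> under small translations; and \<open>\<parallel>1\<^sub>U(\<cdot> + h) - 1\<^sub>U\<parallel>\<^sup>2 = 2 \<integral> (1\<^sub>U(x) - 1\<^sub>U(x) 1\<^sub>U(x + h)) dx\<close>.\<close>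

lemma shift_cont_open:
  assumes U: "open U" "emeasure lborel U < \<infinity>"
  shows "shift_cont (\<lambda>x. indicator U x)"
proof -
  let ?u = "\<lambda>x. indicator U x :: real"
  have [measurable]: "U \<in> sets borel" using U by simp
  have iu: "integrable lborel ?u" using U(2) by simp
  have L2: "(\<lambda>x. indicator U x :: complex) \<in> L2" by (intro indicator_L2) (use U in auto)
  have "(\<lambda>n. L2_norm (\<lambda>x. indicator U (x + h n) - indicator U x)) \<longlonglongrightarrow> 0" if h: "h \<longlonglongrightarrow> 0" for h
  proof -
    have lim: "(\<lambda>n. LINT x|lborel. ?u x * ?u (x + h n)) \<longlonglongrightarrow> (LINT x|lborel. ?u x)"
    proof (rule integral_dominated_convergence[OF _ _ iu])
      have "(\<lambda>n. ?u x * ?u (x + h n)) \<longlonglongrightarrow> ?u x" for x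
      proof (cases "x \<in> U")
        case True
        have "(\<lambda>n. x + h n) \<longlonglongrightarrow> x" using tendsto_add[OF tendsto_const[of x] h] by simp
        from topological_tendstoD[OF this U(1) True]
        have "eventually (\<lambda>n. ?u x * ?u (x + h n) = ?u x) sequentially"
          by eventually_elim (use True in auto)
        then show ?thesis by (rule tendsto_eventually)
      qed simp
      then show "AE x in lborel. (\<lambda>n. ?u x * ?u (x + h n)) \<longlonglongrightarrow> ?u x" by simp
      show "AE x in lborel. norm (?u x * ?u (x + h n)) \<le> ?u x" for n
        by (auto simp: indicator_def)
    qed measurable
    have "(L2_norm (\<lambda>x. indicator U (x + h n) - indicator U x))\<^sup>2 =
        2 * (LINT x|lborel. ?u x) - 2 * (LINT x|lborel. ?u x * ?u (x + h n))" for n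
    proof -
      have i1: "integrable lborel (\<lambda>x. ?u (x + h n))" and e1: "(LINT x|lborel. ?u (x + h n)) = (LINT x|lborel. ?u x)"
        using integrable_plane_shift[of ?u "h n"] integral_plane_shift[of ?u "h n"] iu by auto
      have i2: "integrable lborel (\<lambda>x. ?u x * ?u (x + h n))"
        by (rule Bochner_Integration.integrable_bound[OF iu]) (auto simp: indicator_def)
      have "(cmod (indicator U (x + h n) - indicator U x))\<^sup>2 =
          ?u (x + h n) + ?u x - 2 * (?u x * ?u (x + h n))" for x
        by (auto simp: indicator_def)
      then show ?thesis using i1 e1 i2 iu unfolding L2_norm_sq by simp
    qed
    moreover have "(\<lambda>n. 2 * (LINT x|lborel. ?u x) - 2 * (LINT x|lborel. ?u x * ?u (x + h n)))
        \<longlonglongrightarrow> 2 * (LINT x|lborel. ?u x) - 2 * (LINT x|lborel. ?u x)"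
      by (intro tendsto_intros lim)
    ultimately have "(\<lambda>n. (L2_norm (\<lambda>x. indicator U (x + h n) - indicator U x))\<^sup>2) \<longlonglongrightarrow> 0" by simp
    from tendsto_real_sqrt[OF this] show ?thesis by simp
  qed
  with L2 show ?thesis unfolding shift_cont_def by blast
qed

lemma shift_cont_indicator:
  assumes B: "B \<in> sets borel" "emeasure lborel B < \<infinity>"
  shows "shift_cont (\<lambda>x. indicator B x)"
proof (rule shift_cont_limit)
  show "(\<lambda>x. indicator B x :: complex) \<in> L2" by (rule indicator_L2[OF B])
  fix e :: real assume e: "e > 0"
  obtain U where U: "open U" "B \<subseteq> U" "U - B \<in> lmeasurable" "emeasure lebesgue (U - B) < ennreal (e\<^sup>2)"
    using sets_lebesgue_outer_open[of B "e\<^sup>2"] B e by auto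
  have UB: "U - B \<in> sets borel" using U(1) B(1) by auto
  have em: "emeasure lborel (U - B) < ennreal (e\<^sup>2)" using U(4) UB by simp
  then have fin: "emeasure lborel (U - B) < \<infinity>" by (rule less_trans) simp
  have "emeasure lborel U \<le> emeasure lborel B + emeasure lborel (U - B)"
    using emeasure_subadditive[of B lborel "U - B"] B UB U(2) by (simp add: Un_absorb1)
  also have "\<dots> < \<infinity>" using B(2) fin by simp
  finally have "shift_cont (\<lambda>x. indicator U x)" using U(1) by (intro shift_cont_open)
  moreover have "L2_norm (\<lambda>x. indicator B x - indicator U x) < e"
  proof (rule power_less_imp_less_base)
    have "L2_norm (\<lambda>x. indicator B x - indicator U x) = L2_norm (\<lambda>x. indicator (U - B) x)"
      unfolding L2_norm_def using U(2)
      by (intro arg_cong[where f = sqrt] Bochner_Integration.integral_cong) (auto simp: indicator_def)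
    then have "(L2_norm (\<lambda>x. indicator B x - indicator U x))\<^sup>2 = measure lborel (U - B)"
      using indicator_L2(2)[OF UB fin] by simp
    also have "\<dots> < e\<^sup>2"
      using em fin e by (simp add: emeasure_eq_ennreal_measure ennreal_less_iff)
    finally show "(L2_norm (\<lambda>x. indicator B x - indicator U x))\<^sup>2 < e\<^sup>2" .
  qed (use e in simp)
  ultimately show "\<exists>g. shift_cont g \<and> L2_norm (\<lambda>x. indicator B x - g x) < e" by blast
qed

lemma shift_cont_simple:
  assumes s: "simple_function borel s" "s \<in> L2" shows "shift_cont s"
proof -
  have fin: "finite (range s)" using simple_functionD(1)[OF s(1)] by simp
  have "(\<Sum>y\<in>range s. y * indicator (s -` {y}) x) = (\<Sum>y\<in>range s. if y = s x then y else 0)" for x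
    by (intro sum.cong) (auto simp: indicator_def)
  with fin have rep: "(\<lambda>x. \<Sum>y\<in>range s. y * indicator (s -` {y}) x) = s"
    by (simp add: fun_eq_iff)
  have "shift_cont (\<lambda>x. y * indicator (s -` {y}) x)" if "y \<in> range s" for y
  proof (cases "y = 0")
    case True then show ?thesis by (simp add: shift_cont_zero)
  next
    case False
    have B: "s -` {y} \<in> sets borel"
      using L2_measurable[OF s(2)] by (rule measurable_sets_borel) simp
    have "(\<lambda>x. indicator (s -` {y}) x :: complex) \<in> L2"
    proof (rule L2_bound[OF s(2)])
      show "cmod (indicator (s -` {y}) x) \<le> inverse (cmod y) * cmod (s x)" for x
        using False by (auto simp: indicator_def)
    qed (use B in measurable)
    then have "integrable lborel (\<lambda>x. (cmod (indicator (s -` {y}) x))\<^sup>2)" by (rule L2_integrable)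
    also have "(\<lambda>x. (cmod (indicator (s -` {y}) x))\<^sup>2) = (\<lambda>x. indicator (s -` {y}) x :: real)"
      by (auto simp: indicator_def fun_eq_iff)
    finally have "emeasure lborel (s -` {y}) < \<infinity>"
      using B by (simp add: integrable_indicator_iff)
    with B show ?thesis by (intro shift_cont_cmult shift_cont_indicator)
  qed
  then have "shift_cont (\<lambda>x. \<Sum>y\<in>range s. y * indicator (s -` {y}) x)" by (rule shift_cont_sum)
  then show ?thesis unfolding rep .
qed

lemma L2_shift_cont:
  assumes f: "f \<in> L2" shows "shift_cont f"
proof (rule shift_cont_limit[OF f])
  fix e :: real assume e: "e > 0"
  note [measurable] = L2_measurable[OF f]
  obtain s where s: "\<And>i. simple_function borel (s i)" "\<And>x. (\<lambda>i. s i x) \<longlonglongrightarrow> f x"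
    "\<And>i x. norm (s i x) \<le> 2 * norm (f x)"
    using borel_measurable_implies_sequence_metric[of f borel 0] by auto
  have [measurable]: "s i \<in> borel_measurable borel" for i
    using s(1) by (rule borel_measurable_simple_function)
  have sL2: "s i \<in> L2" for i by (rule L2_bound[OF f _ s(3)]) measurable
  have "(\<lambda>i. L2_norm (\<lambda>x. f x - s i x)) \<longlonglongrightarrow> 0"
  proof (rule L2_dominated_tendsto[OF f])
    show "cmod (f x - s i x) \<le> 3 * cmod (f x)" for i x
      using norm_triangle_ineq4[of "f x" "s i x"] s(3)[of i x] by simp
    have "(\<lambda>i. f x - s i x) \<longlonglongrightarrow> 0" for x
      using tendsto_diff[OF tendsto_const s(2)[of x], of "f x"] by simp
    then show "AE x in lborel. (\<lambda>i. f x - s i x) \<longlonglongrightarrow> 0" by simp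
  qed measurable
  from LIMSEQ_D[OF this e] obtain i where "L2_norm (\<lambda>x. f x - s i x) < e" by auto
  with shift_cont_simple[OF s(1) sL2] show "\<exists>g. shift_cont g \<and> L2_norm (\<lambda>x. f x - g x) < e" by blast
qed

lemma L2_shift_tendsto:
  "f \<in> L2 \<Longrightarrow> h \<longlonglongrightarrow> 0 \<Longrightarrow> (\<lambda>n. L2_norm (\<lambda>x. f (x + h n) - f x)) \<longlonglongrightarrow> 0"
  using L2_shift_cont by (auto simp: shift_cont_def)

section \<open>Plancherel's theorem\<close>

lemma gauss_cnj [simp]: "cnj (gauss a x) = gauss a x"
  by (simp add: gauss_def)

lemma gauss_minus [simp]: "gauss a (- x) = gauss a x"
  by (simp add: gauss_def)

lemma fourier_gauss_mult_integrable:
  assumes f: "integrable lborel f" and a: "a \<noteq> 0"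
  shows "integrable lborel (\<lambda>\<xi>. cnj (fourier_integral f \<xi>) * gauss a \<xi>)"
proof (rule Bochner_Integration.integrable_bound)
  note [measurable] = borel_measurable_integrable[OF f]
  show "integrable lborel (\<lambda>\<xi>. complex_of_real (LINT x|lborel. cmod (f x)) * gauss a \<xi>)"
    by (intro integrable_mult_right integrable_gauss a)
  show "AE \<xi> in lborel. norm (cnj (fourier_integral f \<xi>) * gauss a \<xi>) \<le>
      norm (complex_of_real (LINT x|lborel. cmod (f x)) * gauss a \<xi>)"
    using fourier_bound[of f] by (auto simp: norm_mult intro!: mult_right_mono)
  show "(\<lambda>\<xi>. cnj (fourier_integral f \<xi>) * gauss a \<xi>) \<in> borel_measurable lborel"
    by measurable
qed

text \<open>Duality is used twice to move both transforms to the Gaussian. The substitution \<open>y = x - u / a\<close> makes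
  the transformed Gaussian independent of \<open>a\<close>, so that \<open>a\<close> only scales the argument of the
  autocorrelation.\<close>

lemma fourier_gauss_weighted:
  assumes f: "integrable lborel f" "f \<in> L2" and a: "a \<noteq> 0"
  shows "(LINT \<xi>|lborel. fourier_integral f \<xi> * (cnj (fourier_integral f \<xi>) * gauss a \<xi>)) =
    2 * pi * (LINT u|lborel. gauss 1 u * (LINT x|lborel. f x * cnj (f (x + (- 1 / a) *\<^sub>R u))))"
proof -
  note [measurable] = borel_measurable_integrable[OF f(1)]
  define g where "g \<xi> = cnj (fourier_integral f \<xi>) * gauss a \<xi>" for \<xi>
  have g: "integrable lborel g"
    unfolding g_def by (rule fourier_gauss_mult_integrable[OF f(1) a])
  have gx: "fourier_integral g x = 2 * pi * (LINT u|lborel. cnj (f (x + (- 1 / a) *\<^sub>R u)) * gauss 1 u)" for x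
  proof -
    have int: "integrable lborel (\<lambda>\<xi>. cis (\<xi> \<bullet> x) * gauss a \<xi>)"
      by (intro integrable_cis_mult integrable_gauss a) measurable
    have "fourier_integral g x = cnj (LINT \<xi>|lborel. fourier_integral f \<xi> * (cis (\<xi> \<bullet> x) * gauss a \<xi>))"
      unfolding fourier_integral_def[of g] g_def
      by (simp add: cis_cnj ac_simps flip: Bochner_Integration.integral_cnj)
    also have "(LINT \<xi>|lborel. fourier_integral f \<xi> * (cis (\<xi> \<bullet> x) * gauss a \<xi>)) =
        (LINT y|lborel. f y * (2 * pi * a\<^sup>2 * gauss 1 (a *\<^sub>R (y - x))))"
      by (subst fourier_duality[OF f(1) int]) (simp add: fourier_cis_mult fourier_gauss[OF a])
    also have "\<dots> = ((LINT u|lborel. f (x + (- 1 / a) *\<^sub>R u) *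
        (2 * pi * a\<^sup>2 * gauss 1 (a *\<^sub>R (x + (- 1 / a) *\<^sub>R u - x))))) /\<^sub>R a\<^sup>2"
      using a by (subst integral_plane_affine[of _ "- 1 / a" x]) (auto simp: field_simps)
    also have "\<dots> = 2 * pi * (LINT u|lborel. f (x + (- 1 / a) *\<^sub>R u) * gauss 1 u)"
    proof -
      have "f (x + (- 1 / a) *\<^sub>R u) * (2 * pi * a\<^sup>2 * gauss 1 (a *\<^sub>R (x + (- 1 / a) *\<^sub>R u - x))) =
          complex_of_real (2 * pi * a\<^sup>2) * (f (x + (- 1 / a) *\<^sub>R u) * gauss 1 u)" for u
        using a by simp
      then show ?thesis
        unfolding integral_mult_right_zero[symmetric] using a by (simp only: integral_mult_right_zero) (simp add: scaleR_conv_of_real)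
    qed
    finally have "fourier_integral g x = 2 * pi * cnj (LINT u|lborel. f (x + (- 1 / a) *\<^sub>R u) * gauss 1 u)"
      by simp
    then show ?thesis by (simp flip: Bochner_Integration.integral_cnj)
  qed
  let ?K = "\<lambda>u x. gauss 1 u * (f x * cnj (f (x + (- 1 / a) *\<^sub>R u)))"
  have inner: "integrable lborel (\<lambda>x. f x * cnj (f (x + (- 1 / a) *\<^sub>R u)))" for u
    by (intro L2_integrable_mult f L2_cnj L2_shift)
  have int: "integrable (lborel \<Otimes>\<^sub>M lborel) (\<lambda>(u, x). ?K u x)"
  proof (rule lborel_pair.Fubini_integrable)
    show "(\<lambda>(u, x). ?K u x) \<in> borel_measurable (lborel \<Otimes>\<^sub>M lborel)" by measurable
    show "AE u in lborel. integrable lborel (\<lambda>x. case (u, x) of (u, x) \<Rightarrow> ?K u x)"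
      using inner by simp
    show "integrable lborel (\<lambda>u. LINT x|lborel. norm (case (u, x) of (u, x) \<Rightarrow> ?K u x))"
    proof (rule Bochner_Integration.integrable_bound)
      show "integrable lborel (\<lambda>u. complex_of_real ((L2_norm f)\<^sup>2) * gauss 1 u)"
        by (intro integrable_mult_right integrable_gauss_1)
      have "norm (LINT x|lborel. norm (?K u x)) \<le> norm (complex_of_real ((L2_norm f)\<^sup>2) * gauss 1 u)" for u
      proof -
        have "(LINT x|lborel. cmod (f x) * cmod (cnj (f (x + (- 1 / a) *\<^sub>R u)))) \<le> L2_norm f * L2_norm f"
          using L2_Cauchy_Schwarz_nn[OF f(2) L2_cnj[OF L2_shift(1)[OF f(2)]], of "(- 1 / a) *\<^sub>R u"]
            L2_shift(2)[OF f(2), of "(- 1 / a) *\<^sub>R u"]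
          by (simp add: L2_norm_cnj)
        then have "cmod (gauss 1 u) * (LINT x|lborel. cmod (f x) * cmod (cnj (f (x + (- 1 / a) *\<^sub>R u)))) \<le>
            cmod (gauss 1 u) * (L2_norm f * L2_norm f)"
          by (rule mult_left_mono) simp
        also have "cmod (gauss 1 u) * (LINT x|lborel. cmod (f x) * cmod (cnj (f (x + (- 1 / a) *\<^sub>R u)))) =
            (LINT x|lborel. norm (?K u x))"
          by (subst integral_mult_right_zero[symmetric]) (simp only: norm_mult)
        finally show ?thesis
          by (subst real_norm_def, subst abs_of_nonneg)
            (simp_all add: integral_nonneg norm_mult power2_eq_square ac_simps)
      qed
      then show "AE u in lborel. norm (LINT x|lborel. norm (case (u, x) of (u, x) \<Rightarrow> ?K u x)) \<le>
          norm (complex_of_real ((L2_norm f)\<^sup>2) * gauss 1 u)" by simp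
    qed measurable
  qed
  have "(LINT \<xi>|lborel. fourier_integral f \<xi> * g \<xi>) = (LINT x|lborel. f x * fourier_integral g x)"
    by (rule fourier_duality[OF f(1) g])
  also have "\<dots> = (LINT x|lborel. 2 * pi * (LINT u|lborel. ?K u x))"
  proof (intro Bochner_Integration.integral_cong refl)
    fix x
    have "(LINT u|lborel. ?K u x) = f x * (LINT u|lborel. cnj (f (x + (- 1 / a) *\<^sub>R u)) * gauss 1 u)"
      by (subst integral_mult_right_zero[symmetric]) (simp add: ac_simps)
    then show "f x * fourier_integral g x = 2 * pi * (LINT u|lborel. ?K u x)"
      by (simp add: gx)
  qed
  also have "\<dots> = 2 * pi * (LINT x|lborel. LINT u|lborel. ?K u x)" by simp
  also have "(LINT x|lborel. LINT u|lborel. ?K u x) = (LINT u|lborel. LINT x|lborel. ?K u x)"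
    by (rule lborel_pair.Fubini_integral[OF int])
  also have "\<dots> = (LINT u|lborel. gauss 1 u * (LINT x|lborel. f x * cnj (f (x + (- 1 / a) *\<^sub>R u))))"
    by simp
  finally show ?thesis by (simp add: g_def)
qed

text \<open>Weighting \<open>|f\<^sup>^|\<^sup>2\<close> with a wide Gaussian gives the average of the autocorrelation of \<open>f\<close> against
  a narrow one. The autocorrelation is continuous at \<open>0\<close>, because translations are continuous
  in \<open>L\<^sup>2\<close>, and takes the value \<open>\<parallel>f\<parallel>\<^sup>2\<close> there.\<close>

lemma fourier_gauss_limit:
  assumes f: "integrable lborel f" "f \<in> L2"
  shows "(\<lambda>n. LINT \<xi>|lborel. (cmod (fourier_integral f \<xi>))\<^sup>2 * exp (- ((norm \<xi>)\<^sup>2) / (2 * (real (Suc n))\<^sup>2)))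
    \<longlonglongrightarrow> (2 * pi)\<^sup>2 * (L2_norm f)\<^sup>2"
proof -
  note [measurable] = borel_measurable_integrable[OF f(1)]
  define A where "A h = (LINT x|lborel. f x * cnj (f (x + h)))" for h
  have [measurable]: "A \<in> borel_measurable borel" unfolding A_def by measurable
  have A_bound: "cmod (A h) \<le> (L2_norm f)\<^sup>2" for h
    using L2_Cauchy_Schwarz[OF f(2) L2_cnj[OF L2_shift(1)[OF f(2)]]] L2_shift(2)[OF f(2)]
    by (simp add: A_def L2_norm_cnj power2_eq_square)
  have A0: "A 0 = (L2_norm f)\<^sup>2"
    unfolding A_def L2_norm_sq integral_complex_of_real[symmetric]
    by (simp only: complex_norm_square add_0_right)
  have A_diff: "cmod (A h - A 0) \<le> L2_norm f * L2_norm (\<lambda>x. f (x + h) - f x)" for h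
  proof -
    have i: "integrable lborel (\<lambda>x. f x * cnj (f (x + k)))" for k
      by (intro L2_integrable_mult f L2_cnj L2_shift)
    have "A h - A 0 = (LINT x|lborel. f x * cnj (f (x + h) - f x))"
      unfolding A_def using i[of h] i[of 0] by (simp add: ring_distribs)
    also have "cmod \<dots> \<le> L2_norm f * L2_norm (\<lambda>x. cnj (f (x + h) - f x))"
      by (intro L2_Cauchy_Schwarz L2_cnj L2_diff L2_shift f)
    finally show ?thesis by (simp only: L2_norm_cnj)
  qed
  let ?h = "\<lambda>u n. (- 1 / real (Suc n)) *\<^sub>R u"
  have A_lim: "(\<lambda>n. A (?h u n)) \<longlonglongrightarrow> A 0" for u
  proof -
    have "(\<lambda>n. - inverse (real (Suc n))) \<longlonglongrightarrow> - 0"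
      by (intro tendsto_minus LIMSEQ_inverse_real_of_nat)
    from tendsto_scaleR[OF this tendsto_const[of u]] have "?h u \<longlonglongrightarrow> 0"
      by (simp add: field_simps)
    from tendsto_mult_right_zero[OF L2_shift_tendsto[OF f(2) this]]
    have "(\<lambda>n. L2_norm f * L2_norm (\<lambda>x. f (x + ?h u n) - f x)) \<longlonglongrightarrow> 0" .
    then have "(\<lambda>n. A (?h u n) - A 0) \<longlonglongrightarrow> 0"
      by (rule Lim_null_comparison[OF always_eventually, rule_format, rotated]) (rule A_diff)
    then show ?thesis by (simp add: LIM_zero_iff)
  qed
  have lim: "(\<lambda>n. LINT u|lborel. gauss 1 u * A (?h u n)) \<longlonglongrightarrow> (LINT u|lborel. gauss 1 u * A 0)"
  proof (rule integral_dominated_convergence)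
    show "integrable lborel (\<lambda>u. cmod (gauss 1 u) * (L2_norm f)\<^sup>2)"
      by (intro integrable_mult_left integrable_norm integrable_gauss_1)
    show "AE u in lborel. (\<lambda>n. gauss 1 u * A (?h u n)) \<longlonglongrightarrow> gauss 1 u * A 0"
      by (intro always_eventually allI tendsto_intros A_lim)
    show "AE u in lborel. norm (gauss 1 u * A (?h u n)) \<le> cmod (gauss 1 u) * (L2_norm f)\<^sup>2" for n
      by (auto simp: norm_mult intro!: mult_left_mono A_bound)
  qed measurable
  have "(LINT \<xi>|lborel. (cmod (fourier_integral f \<xi>))\<^sup>2 * exp (- ((norm \<xi>)\<^sup>2) / (2 * (real (Suc n))\<^sup>2))) =
      Re (2 * pi * (LINT u|lborel. gauss 1 u * A (?h u n)))" for n
  proof -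
    have "complex_of_real ((cmod (fourier_integral f \<xi>))\<^sup>2 * exp (- ((norm \<xi>)\<^sup>2) / (2 * (real (Suc n))\<^sup>2))) =
        fourier_integral f \<xi> * (cnj (fourier_integral f \<xi>) * gauss (real (Suc n)) \<xi>)" for \<xi>
      by (simp only: gauss_def of_real_mult complex_norm_square mult.assoc)
    then have "complex_of_real (LINT \<xi>|lborel. (cmod (fourier_integral f \<xi>))\<^sup>2 * exp (- ((norm \<xi>)\<^sup>2) / (2 * (real (Suc n))\<^sup>2))) =
        2 * pi * (LINT u|lborel. gauss 1 u * A (?h u n))"
      using fourier_gauss_weighted[OF f, of "real (Suc n)"]
      by (simp add: A_def flip: integral_complex_of_real del: of_nat_Suc)
    from arg_cong[OF this, of Re] show ?thesis by simp
  qed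
  moreover have "(\<lambda>n. Re (2 * pi * (LINT u|lborel. gauss 1 u * A (?h u n)))) \<longlonglongrightarrow>
      Re (2 * pi * (LINT u|lborel. gauss 1 u * A 0))"
    by (intro tendsto_intros lim)
  moreover have "Re (2 * pi * (LINT u|lborel. gauss 1 u * A 0)) = (2 * pi)\<^sup>2 * (L2_norm f)\<^sup>2"
    by (simp add: integral_gauss_1 A0 power2_eq_square)
  ultimately show ?thesis by (simp only:)
qed

text \<open>Fatou's lemma along widening Gaussians shows that \<open>|f\<^sup>^|\<^sup>2\<close> is integrable; it then dominates its
  weighted versions, and the limits agree.\<close>

theorem Plancherel:
  assumes f: "integrable lborel f" "f \<in> L2"
  shows "fourier_integral f \<in> L2" "L2_norm (fourier_integral f) = 2 * pi * L2_norm f"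
proof -
  note [measurable] = borel_measurable_integrable[OF f(1)]
  let ?F = "fourier_integral f"
  let ?e = "\<lambda>n \<xi>. exp (- ((norm \<xi>)\<^sup>2) / (2 * (real (Suc n))\<^sup>2)) :: real"
  have int: "integrable lborel (\<lambda>\<xi>. (cmod (?F \<xi>))\<^sup>2 * ?e n \<xi>)" for n
  proof (rule Bochner_Integration.integrable_bound)
    show "integrable lborel (\<lambda>\<xi>. (LINT x|lborel. cmod (f x)) *\<^sub>R (cnj (?F \<xi>) * gauss (real (Suc n)) \<xi>))"
      by (intro integrable_scaleR_right fourier_gauss_mult_integrable f(1)) simp
    show "AE \<xi> in lborel. norm ((cmod (?F \<xi>))\<^sup>2 * ?e n \<xi>) \<le>
        norm ((LINT x|lborel. cmod (f x)) *\<^sub>R (cnj (?F \<xi>) * gauss (real (Suc n)) \<xi>))"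
    proof (rule always_eventually, rule allI)
      fix \<xi> :: plane
      have "norm ((cmod (?F \<xi>))\<^sup>2 * ?e n \<xi>) = cmod (?F \<xi>) * (cmod (?F \<xi>) * ?e n \<xi>)"
        by (simp add: power2_eq_square)
      also have "\<dots> \<le> (LINT x|lborel. cmod (f x)) * (cmod (?F \<xi>) * ?e n \<xi>)"
        by (intro mult_right_mono fourier_bound) auto
      also have "\<dots> = norm ((LINT x|lborel. cmod (f x)) *\<^sub>R (cnj (?F \<xi>) * gauss (real (Suc n)) \<xi>))"
        by (simp add: norm_mult gauss_def abs_of_nonneg)
      finally show "norm ((cmod (?F \<xi>))\<^sup>2 * ?e n \<xi>) \<le>
        norm ((LINT x|lborel. cmod (f x)) *\<^sub>R (cnj (?F \<xi>) * gauss (real (Suc n)) \<xi>))" .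
    qed
  qed measurable
  have e_lim: "(\<lambda>n. ?e n \<xi>) \<longlonglongrightarrow> 1" for \<xi> :: plane
  proof -
    have "(\<lambda>n. - ((norm \<xi>)\<^sup>2) / 2 * (inverse (real (Suc n)))\<^sup>2) \<longlonglongrightarrow> - ((norm \<xi>)\<^sup>2) / 2 * 0\<^sup>2"
      by (intro tendsto_intros LIMSEQ_inverse_real_of_nat)
    from tendsto_exp[OF this] show ?thesis by (simp add: field_simps)
  qed
  have "(\<integral>\<^sup>+\<xi>. ennreal ((cmod (?F \<xi>))\<^sup>2) \<partial>lborel) \<le>
      (\<integral>\<^sup>+\<xi>. liminf (\<lambda>n. ennreal ((cmod (?F \<xi>))\<^sup>2 * ?e n \<xi>)) \<partial>lborel)"
  proof (rule nn_integral_mono)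
    fix \<xi> :: plane
    have "(\<lambda>n. ennreal ((cmod (?F \<xi>))\<^sup>2 * ?e n \<xi>)) \<longlonglongrightarrow> ennreal ((cmod (?F \<xi>))\<^sup>2 * 1)"
      by (intro tendsto_ennrealI tendsto_intros e_lim)
    from lim_imp_Liminf[OF sequentially_bot this]
    show "ennreal ((cmod (?F \<xi>))\<^sup>2) \<le> liminf (\<lambda>n. ennreal ((cmod (?F \<xi>))\<^sup>2 * ?e n \<xi>))" by simp
  qed
  also have "\<dots> \<le> liminf (\<lambda>n. \<integral>\<^sup>+\<xi>. ennreal ((cmod (?F \<xi>))\<^sup>2 * ?e n \<xi>) \<partial>lborel)"
    by (rule nn_integral_liminf) measurable
  also have "\<dots> = liminf (\<lambda>n. ennreal (LINT \<xi>|lborel. (cmod (?F \<xi>))\<^sup>2 * ?e n \<xi>))"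
    by (subst nn_integral_eq_integral[OF int]) auto
  also have "\<dots> = ennreal ((2 * pi)\<^sup>2 * (L2_norm f)\<^sup>2)"
    by (intro lim_imp_Liminf tendsto_ennrealI fourier_gauss_limit f) simp
  finally show L2: "?F \<in> L2" by (intro L2I_nn(1)) auto
  have "(\<lambda>n. LINT \<xi>|lborel. (cmod (?F \<xi>))\<^sup>2 * ?e n \<xi>) \<longlonglongrightarrow> (LINT \<xi>|lborel. (cmod (?F \<xi>))\<^sup>2)"
  proof (rule integral_dominated_convergence[OF _ _ L2_integrable[OF L2]])
    show "AE \<xi> in lborel. (\<lambda>n. (cmod (?F \<xi>))\<^sup>2 * ?e n \<xi>) \<longlonglongrightarrow> (cmod (?F \<xi>))\<^sup>2"
      using tendsto_mult[OF tendsto_const e_lim] by fastforce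
    show "AE \<xi> in lborel. norm ((cmod (?F \<xi>))\<^sup>2 * ?e n \<xi>) \<le> (cmod (?F \<xi>))\<^sup>2" for n
      by (auto simp: abs_mult intro!: mult_left_le)
  qed measurable
  from LIMSEQ_unique[OF this fourier_gauss_limit[OF f]]
  have "(L2_norm ?F)\<^sup>2 = (2 * pi * L2_norm f)\<^sup>2" by (simp add: L2_norm_sq power_mult_distrib)
  then show "L2_norm ?F = 2 * pi * L2_norm f"
    by (simp add: power2_eq_iff_nonneg)
qed


section \<open>The Fourier transform on \<open>L\<^sup>2\<close>\<close>

lemma L2_norm_tendsto:
  assumes "\<And>n. f n \<in> L2" "g \<in> L2" "((\<lambda>n. L2_norm (\<lambda>x. f n x - g x)) \<longlongrightarrow> 0) F"
  shows "((\<lambda>n. L2_norm (f n)) \<longlongrightarrow> L2_norm g) F"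
proof -
  have "((\<lambda>n. L2_norm (f n) - L2_norm g) \<longlongrightarrow> 0) F"
    by (rule Lim_null_comparison[OF _ assms(3)])
      (use L2_norm_diff_le[OF assms(1,2)] in \<open>auto intro: always_eventually\<close>)
  then show ?thesis by (simp add: LIM_zero_iff)
qed

lemma L2_pairing_tendsto:
  assumes "\<And>n. f n \<in> L2" "g \<in> L2" "k \<in> L2" "((\<lambda>n. L2_norm (\<lambda>x. f n x - g x)) \<longlongrightarrow> 0) F"
  shows "((\<lambda>n. LINT x|lborel. k x * cnj (f n x)) \<longlongrightarrow> (LINT x|lborel. k x * cnj (g x))) F"
proof -
  have "cmod ((LINT x|lborel. k x * cnj (f n x)) - (LINT x|lborel. k x * cnj (g x))) \<le>
      L2_norm k * L2_norm (\<lambda>x. f n x - g x)" for n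
  proof -
    have "(LINT x|lborel. k x * cnj (f n x)) - (LINT x|lborel. k x * cnj (g x)) =
        (LINT x|lborel. k x * cnj (f n x - g x))"
      using L2_integrable_mult[OF assms(3) L2_cnj[OF assms(1)], of n]
        L2_integrable_mult[OF assms(3) L2_cnj[OF assms(2)]]
      by (simp add: ring_distribs)
    also have "cmod \<dots> \<le> L2_norm k * L2_norm (\<lambda>x. cnj (f n x - g x))"
      by (intro L2_Cauchy_Schwarz L2_cnj L2_diff assms)
    finally show ?thesis by (simp only: L2_norm_cnj)
  qed
  moreover have "((\<lambda>n. L2_norm k * L2_norm (\<lambda>x. f n x - g x)) \<longlongrightarrow> 0) F"
    by (rule tendsto_mult_right_zero[OF assms(4)])
  ultimately have "((\<lambda>n. (LINT x|lborel. k x * cnj (f n x)) - (LINT x|lborel. k x * cnj (g x))) \<longlongrightarrow> 0) F"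
    by (rule Lim_null_comparison[OF always_eventually[rule_format]])
  then show ?thesis by (simp add: LIM_zero_iff)
qed

lemma trunc_L2:
  assumes "f \<in> L2"
  shows "(\<lambda>x. indicator (cball 0 R) x * f x) \<in> L2"
    and "integrable lborel (\<lambda>x. indicator (cball 0 R) x * f x)"
proof -
  note [measurable] = L2_measurable[OF assms]
  show "(\<lambda>x. indicator (cball 0 R) x * f x) \<in> L2"
    by (rule L2_bound[OF assms, where c = 1]) (auto simp: indicator_def)
  show "integrable lborel (\<lambda>x. indicator (cball 0 R) x * f x)"
    by (intro L2_integrable_mult indicator_L2 assms emeasure_lborel_cball_finite) auto
qed

lemma trunc_tendsto:
  assumes "f \<in> L2"
  shows "((\<lambda>R. L2_norm (\<lambda>x. indicator (cball 0 R) x * f x - f x)) \<longlongrightarrow> 0) at_top"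
proof (rule tendsto_at_topI_sequentially)
  fix X :: "nat \<Rightarrow> real" assume X: "filterlim X at_top sequentially"
  note [measurable] = L2_measurable[OF assms]
  show "(\<lambda>n. L2_norm (\<lambda>x. indicator (cball 0 (X n)) x * f x - f x)) \<longlonglongrightarrow> 0"
  proof (rule L2_dominated_tendsto[OF assms])
    have "(\<lambda>n. indicator (cball 0 (X n)) x * f x - f x) \<longlonglongrightarrow> 0" for x
    proof (rule tendsto_eventually)
      have "eventually (\<lambda>n. norm x \<le> X n) sequentially"
        using X by (simp add: filterlim_at_top)
      then show "eventually (\<lambda>n. indicator (cball 0 (X n)) x * f x - f x = 0) sequentially"
        by eventually_elim (simp add: indicator_def)
    qed
    then show "AE x in lborel. (\<lambda>n. indicator (cball 0 (X n)) x * f x - f x) \<longlonglongrightarrow> 0" by simp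
    show "cmod (indicator (cball 0 (X n)) x * f x - f x) \<le> 1 * cmod (f x)" for n x
      by (auto simp: indicator_def)
    show "(\<lambda>x. indicator (cball 0 (X n)) x * f x - f x) \<in> borel_measurable borel" for n
      by (intro L2_measurable L2_diff trunc_L2 assms)
  qed
qed

lemma is_fourier_L2: "is_fourier f g \<Longrightarrow> f \<in> L2" "is_fourier f g \<Longrightarrow> g \<in> L2"
  by (auto simp: is_fourier_def)

lemma fourier_trunc_L2:
  assumes "f \<in> L2"
  shows "fourier_integral (\<lambda>x. indicator (cball 0 R) x * f x) \<in> L2"
  using Plancherel(1) trunc_L2[OF assms] by blast

lemma is_fourier_L1:
  assumes f: "integrable lborel f" "f \<in> L2"
  shows "is_fourier f (fourier_integral f)"
  unfolding is_fourier_def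
proof (intro conjI f Plancherel)
  let ?t = "\<lambda>R x. indicator (cball 0 R) x * f x"
  have "L2_norm (\<lambda>\<xi>. fourier_integral (?t R) \<xi> - fourier_integral f \<xi>) = 2 * pi * L2_norm (\<lambda>x. ?t R x - f x)" for R
  proof -
    have "(\<lambda>\<xi>. fourier_integral (?t R) \<xi> - fourier_integral f \<xi>) = fourier_integral (\<lambda>x. ?t R x - f x)"
      using fourier_diff[OF trunc_L2(2)[OF f(2)] f(1)] by (simp add: fun_eq_iff)
    then show ?thesis
      using Plancherel(2)[of "\<lambda>x. ?t R x - f x"] trunc_L2[OF f(2), of R] f
      by (simp add: L2_diff)
  qed
  with tendsto_mult_right_zero[OF trunc_tendsto[OF f(2)], of "2 * pi"]
  show "((\<lambda>R. L2_norm (\<lambda>\<xi>. fourier_integral (?t R) \<xi> - fourier_integral f \<xi>)) \<longlongrightarrow> 0) at_top"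
    by simp
qed

lemma is_fourier_norm:
  assumes "is_fourier f g" shows "L2_norm g = 2 * pi * L2_norm f"
proof -
  let ?t = "\<lambda>R x. indicator (cball 0 R) x * f x"
  note L2 = is_fourier_L2[OF assms]
  have "((\<lambda>R. L2_norm (fourier_integral (?t R))) \<longlongrightarrow> L2_norm g) at_top"
    using assms by (intro L2_norm_tendsto fourier_trunc_L2 L2) (simp add: is_fourier_def)
  moreover have "((\<lambda>R. 2 * pi * L2_norm (?t R)) \<longlongrightarrow> 2 * pi * L2_norm f) at_top"
    by (intro tendsto_mult tendsto_const L2_norm_tendsto trunc_L2 trunc_tendsto L2)
  moreover have "L2_norm (fourier_integral (?t R)) = 2 * pi * L2_norm (?t R)" for R
    by (intro Plancherel trunc_L2 L2)
  ultimately show ?thesis by (intro tendsto_unique[OF trivial_limit_at_top_linorder]) auto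
qed

lemma is_fourier_unique:
  assumes "is_fourier f g" "is_fourier f g'" shows "AE \<xi> in lborel. g \<xi> = g' \<xi>"
  by (rule L2_limit_unique[where F = at_top and f = "\<lambda>R. fourier_integral (\<lambda>x. indicator (cball 0 R) x * f x)"])
    (use assms fourier_trunc_L2 in \<open>auto simp: is_fourier_def\<close>)

lemma is_fourier_add:
  assumes "is_fourier f g" "is_fourier f' g'"
  shows "is_fourier (\<lambda>x. f x + f' x) (\<lambda>x. g x + g' x)"
  unfolding is_fourier_def
proof (intro conjI L2_add is_fourier_L2[OF assms(1)] is_fourier_L2[OF assms(2)])
  let ?t = "\<lambda>f R x. indicator (cball 0 R) x * f x :: complex"
  note L2 = is_fourier_L2[OF assms(1)] is_fourier_L2[OF assms(2)]
  have lim: "((\<lambda>R. L2_norm (\<lambda>\<xi>. fourier_integral (?t f R) \<xi> - g \<xi>) +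
      L2_norm (\<lambda>\<xi>. fourier_integral (?t f' R) \<xi> - g' \<xi>)) \<longlongrightarrow> 0 + 0) at_top"
    using assms by (intro tendsto_add) (auto simp: is_fourier_def)
  show "((\<lambda>R. L2_norm (\<lambda>\<xi>. fourier_integral (\<lambda>x. indicator (cball 0 R) x * (f x + f' x)) \<xi> - (g \<xi> + g' \<xi>)))
      \<longlongrightarrow> 0) at_top"
  proof (rule tendsto_sandwich[OF _ _ tendsto_const lim[simplified]])
    have "L2_norm (\<lambda>\<xi>. fourier_integral (\<lambda>x. indicator (cball 0 R) x * (f x + f' x)) \<xi> - (g \<xi> + g' \<xi>)) \<le>
      L2_norm (\<lambda>\<xi>. fourier_integral (?t f R) \<xi> - g \<xi>) + L2_norm (\<lambda>\<xi>. fourier_integral (?t f' R) \<xi> - g' \<xi>)" for R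
    proof -
      have "fourier_integral (\<lambda>x. indicator (cball 0 R) x * (f x + f' x)) \<xi> - (g \<xi> + g' \<xi>) =
          (fourier_integral (?t f R) \<xi> - g \<xi>) + (fourier_integral (?t f' R) \<xi> - g' \<xi>)" for \<xi>
        using fourier_add[OF trunc_L2(2)[OF L2(1), of R] trunc_L2(2)[OF L2(3), of R], of \<xi>]
        by (simp add: ring_distribs)
      then show ?thesis
        using L2_norm_triangle[OF L2_diff[OF fourier_trunc_L2[OF L2(1), of R] L2(2)]
            L2_diff[OF fourier_trunc_L2[OF L2(3), of R] L2(4)]]
        by (simp only:)
    qed
    then show "eventually (\<lambda>R. L2_norm (\<lambda>\<xi>. fourier_integral (\<lambda>x. indicator (cball 0 R) x * (f x + f' x)) \<xi> - (g \<xi> + g' \<xi>))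
      \<le> L2_norm (\<lambda>\<xi>. fourier_integral (?t f R) \<xi> - g \<xi>) + L2_norm (\<lambda>\<xi>. fourier_integral (?t f' R) \<xi> - g' \<xi>)) at_top"
      by simp
  qed simp
qed

lemma L2_reflect:
  assumes "f \<in> L2" shows "(\<lambda>x. f (- x)) \<in> L2" "L2_norm (\<lambda>x. f (- x)) = L2_norm f"
proof -
  note [measurable] = L2_measurable[OF assms]
  have m: "(\<lambda>x. (cmod (f x))\<^sup>2) \<in> borel_measurable borel" by measurable
  have "(\<lambda>x. f (- x)) \<in> borel_measurable borel" by measurable
  with L2_integrable[OF assms] integrable_plane_affine[OF m, of "-1" 0]
  show "(\<lambda>x. f (- x)) \<in> L2" by (simp add: L2_def)
  show "L2_norm (\<lambda>x. f (- x)) = L2_norm f"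
    unfolding L2_norm_def using integral_plane_affine[OF m, of "-1" 0] by simp
qed

lemma L2_norm_sq_diff:
  assumes "f \<in> L2" "g \<in> L2"
  shows "(L2_norm (\<lambda>x. f x - g x))\<^sup>2 =
    (L2_norm f)\<^sup>2 + (L2_norm g)\<^sup>2 - 2 * Re (LINT x|lborel. f x * cnj (g x))"
  using L2_norm_sq_add[OF assms(1) L2_cmult[OF assms(2), of "-1"]] L2_norm_cmult[of "-1" g]
  by simp

text \<open>Surjectivity of the transform. The inverse transforms \<open>h\<^sub>n\<close> of the truncations of \<open>G\<close> converge
  in \<open>L\<^sup>2\<close> to some \<open>h\<close>. With \<open>h\<^sub>R\<close> the truncation of \<open>h\<close>, moving the transform to the other factor
  gives \<open>\<langle>h\<^sub>R\<^sup>^, G\<rangle> = (2\<pi>)\<^sup>2 \<parallel>h\<^sub>R\<parallel>\<^sup>2\<close>, and therefore \<open>\<parallel>h\<^sub>R\<^sup>^ - G\<parallel>\<^sup>2 = (2\<pi>)\<^sup>2 (\<parallel>h\<parallel>\<^sup>2 - \<parallel>h\<^sub>R\<parallel>\<^sup>2)\<close>,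
  which tends to \<open>0\<close>.\<close>

theorem is_fourier_surj:
  assumes G: "G \<in> L2"
  obtains h where "is_fourier h G"
proof -
  define Gn where "Gn n = (\<lambda>\<xi>. indicator (cball 0 (real n)) \<xi> * G \<xi>)" for n :: nat
  have Gn: "Gn n \<in> L2" "integrable lborel (Gn n)" for n
    unfolding Gn_def by (intro trunc_L2 G)+
  have Gn_lim: "(\<lambda>n. L2_norm (\<lambda>\<xi>. Gn n \<xi> - G \<xi>)) \<longlonglongrightarrow> 0"
    unfolding Gn_def by (rule filterlim_compose[OF trunc_tendsto[OF G] filterlim_real_sequentially])
  define c :: complex where "c = inverse ((2 * pi)\<^sup>2)"
  have cmod_c: "cmod c = inverse ((2 * pi)\<^sup>2)"
    unfolding c_def by (simp add: norm_inverse norm_power norm_mult)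
  define hn where "hn n = (\<lambda>x. c * fourier_integral (Gn n) (- x))" for n
  have hn: "hn n \<in> L2" for n
    unfolding hn_def by (intro L2_cmult L2_reflect Plancherel Gn)
  have inv_norm: "L2_norm (\<lambda>x. c * fourier_integral \<phi> (- x)) = L2_norm \<phi> / (2 * pi)"
    if "integrable lborel \<phi>" "\<phi> \<in> L2" for \<phi>
    using Plancherel[OF that] L2_reflect(2)[of "fourier_integral \<phi>"]
    by (simp add: L2_norm_cmult cmod_c field_simps power2_eq_square)
  have hn_norm: "L2_norm (hn n) = L2_norm (Gn n) / (2 * pi)" for n
    unfolding hn_def by (intro inv_norm Gn)
  have hn_diff: "L2_norm (\<lambda>x. hn m x - hn n x) = L2_norm (\<lambda>\<xi>. Gn m \<xi> - Gn n \<xi>) / (2 * pi)" for m n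
    using inv_norm[of "\<lambda>\<xi>. Gn m \<xi> - Gn n \<xi>"] Gn[of m] Gn[of n]
    by (simp add: hn_def fourier_diff L2_diff right_diff_distrib)
  obtain h where h: "h \<in> L2" "(\<lambda>n. L2_norm (\<lambda>x. hn n x - h x)) \<longlonglongrightarrow> 0"
  proof (rule L2_complete[of hn])
    fix e :: real assume e: "e > 0"
    then have "pi * e > 0" by simp
    from LIMSEQ_D[OF Gn_lim this]
    obtain N where N: "\<And>n. n \<ge> N \<Longrightarrow> L2_norm (\<lambda>\<xi>. Gn n \<xi> - G \<xi>) < pi * e" by auto
    have "L2_norm (\<lambda>x. hn m x - hn n x) < e" if "m \<ge> N" "n \<ge> N" for m n
    proof -
      have "L2_norm (\<lambda>\<xi>. Gn m \<xi> - Gn n \<xi>) \<le> L2_norm (\<lambda>\<xi>. Gn m \<xi> - G \<xi>) + L2_norm (\<lambda>\<xi>. Gn n \<xi> - G \<xi>)"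
        using L2_norm_triangle_diff[OF Gn(1)[of m] G Gn(1)[of n]] L2_norm_minus_commute[of G "Gn n"]
        by simp
      also have "\<dots> < 2 * pi * e" using N[OF that(1)] N[OF that(2)] by simp
      finally show ?thesis by (simp add: hn_diff field_simps)
    qed
    then show "\<exists>N. \<forall>m\<ge>N. \<forall>n\<ge>N. L2_norm (\<lambda>x. hn m x - hn n x) < e" by blast
  qed (use hn in auto)
  have h_norm: "L2_norm G = 2 * pi * L2_norm h"
  proof -
    have "(\<lambda>n. L2_norm (Gn n) / (2 * pi)) \<longlonglongrightarrow> L2_norm h"
      using L2_norm_tendsto[OF hn h] by (simp only: hn_norm)
    moreover have "(\<lambda>n. L2_norm (Gn n) / (2 * pi)) \<longlonglongrightarrow> L2_norm G / (2 * pi)"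
      by (intro tendsto_divide L2_norm_tendsto Gn G Gn_lim tendsto_const) simp
    ultimately have "L2_norm h = L2_norm G / (2 * pi)" by (rule LIMSEQ_unique)
    then show ?thesis by simp
  qed
  let ?t = "\<lambda>R x. indicator (cball 0 R) x * h x"
  let ?F = "\<lambda>R. fourier_integral (?t R)"
  note t = trunc_L2[OF h(1)]
  have F: "?F R \<in> L2" for R by (intro Plancherel t)
  have pair: "(LINT \<xi>|lborel. ?F R \<xi> * cnj (G \<xi>)) = (2 * pi)\<^sup>2 * (L2_norm (?t R))\<^sup>2" for R
  proof -
    have "(LINT \<xi>|lborel. ?F R \<xi> * cnj (Gn n \<xi>)) = (2 * pi)\<^sup>2 * (LINT x|lborel. ?t R x * cnj (hn n x))" for n
    proof -
      have "fourier_integral (\<lambda>\<xi>. cnj (Gn n \<xi>)) x = (2 * pi)\<^sup>2 * cnj (hn n x)" for x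
        unfolding hn_def c_def fourier_integral_def
        by (simp add: cis_cnj flip: Bochner_Integration.integral_cnj)
      then show ?thesis
        by (subst fourier_duality[OF t(2) integrable_cnj[OF Gn(2)]])
          (subst integral_mult_right_zero[symmetric], simp add: ac_simps)
    qed
    moreover have "(\<lambda>n. LINT \<xi>|lborel. ?F R \<xi> * cnj (Gn n \<xi>)) \<longlonglongrightarrow> (LINT \<xi>|lborel. ?F R \<xi> * cnj (G \<xi>))"
      by (intro L2_pairing_tendsto Gn G F Gn_lim)
    moreover have "(\<lambda>n. (2 * pi)\<^sup>2 * (LINT x|lborel. ?t R x * cnj (hn n x))) \<longlonglongrightarrow>
        complex_of_real ((2 * pi)\<^sup>2) * (LINT x|lborel. ?t R x * cnj (h x))"
      by (intro tendsto_mult tendsto_const L2_pairing_tendsto hn h t)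
    ultimately have "(LINT \<xi>|lborel. ?F R \<xi> * cnj (G \<xi>)) = (2 * pi)\<^sup>2 * (LINT x|lborel. ?t R x * cnj (h x))"
      by (intro LIMSEQ_unique) auto
    also have "(LINT x|lborel. ?t R x * cnj (h x)) = complex_of_real ((L2_norm (?t R))\<^sup>2)"
    proof -
      have "?t R x * cnj (h x) = complex_of_real ((cmod (?t R x))\<^sup>2)" for x
        unfolding complex_norm_square by (auto simp: indicator_def)
      then show ?thesis unfolding L2_norm_sq by (simp only: integral_complex_of_real)
    qed
    finally show ?thesis by simp
  qed
  have "(L2_norm (\<lambda>\<xi>. ?F R \<xi> - G \<xi>))\<^sup>2 = (2 * pi)\<^sup>2 * ((L2_norm h)\<^sup>2 - (L2_norm (?t R))\<^sup>2)" for R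
    unfolding L2_norm_sq_diff[OF F G] pair
    using Plancherel(2)[OF t(2,1), of R] h_norm by (simp add: power_mult_distrib algebra_simps)
  moreover have "((\<lambda>R. (2 * pi)\<^sup>2 * ((L2_norm h)\<^sup>2 - (L2_norm (?t R))\<^sup>2)) \<longlongrightarrow>
      (2 * pi)\<^sup>2 * ((L2_norm h)\<^sup>2 - (L2_norm h)\<^sup>2)) at_top"
    by (intro tendsto_intros L2_norm_tendsto t h trunc_tendsto)
  ultimately have "((\<lambda>R. (L2_norm (\<lambda>\<xi>. ?F R \<xi> - G \<xi>))\<^sup>2) \<longlongrightarrow> 0) at_top" by simp
  from tendsto_real_sqrt[OF this] have "is_fourier h G"
    using h G by (simp add: is_fourier_def)
  then show ?thesis by (rule that)
qed

section \<open>The quartic functional on the Fourier side\<close>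

lemma multiplier_bounds: "0 \<le> multiplier \<xi>" "multiplier \<xi> \<le> 1"
proof -
  show "0 \<le> multiplier \<xi>" by (simp add: multiplier_def)
  show "multiplier \<xi> \<le> 1"
    unfolding multiplier_def
    by (cases "(\<xi> $ 1)\<^sup>2 + (\<xi> $ 2)\<^sup>2 > 0") (simp_all add: not_sum_power2_lt_zero not_less sum_power2_le_zero_iff)
qed

lemma multiplier_measurable [measurable]: "multiplier \<in> borel_measurable borel"
  unfolding multiplier_def[abs_def]
  by (intro borel_measurable_divide borel_measurable_continuous_onI continuous_intros)

lemma multiplier_L2:
  assumes "g \<in> L2" shows "(\<lambda>\<xi>. complex_of_real (multiplier \<xi>) * g \<xi>) \<in> L2"
proof (rule L2_bound[OF assms, where c = 1])
  note [measurable] = L2_measurable[OF assms]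
  show "(\<lambda>\<xi>. complex_of_real (multiplier \<xi>) * g \<xi>) \<in> borel_measurable borel" by measurable
  show "cmod (complex_of_real (multiplier \<xi>) * g \<xi>) \<le> 1 * cmod (g \<xi>)" for \<xi>
    using multiplier_bounds[of \<xi>] by (auto simp: norm_mult intro: mult_left_le_one_le)
qed

text \<open>Surjectivity of the transform makes the choice in the definition of \<open>\<B>\<close> a choice from a nonempty set.\<close>

lemma B_op_fourier:
  assumes "integrable lborel f" "f \<in> L2"
  obtains g where "is_fourier f g" "is_fourier (B_op f) (\<lambda>\<xi>. complex_of_real (multiplier \<xi>) * g \<xi>)"
proof -
  obtain h where "is_fourier h (\<lambda>\<xi>. complex_of_real (multiplier \<xi>) * fourier_integral f \<xi>)"
    using is_fourier_surj[OF multiplier_L2[OF Plancherel(1)[OF assms]]] .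
  then have "\<exists>h. h \<in> L2 \<and> (\<exists>g. is_fourier f g \<and> is_fourier h (\<lambda>\<xi>. complex_of_real (multiplier \<xi>) * g \<xi>))"
    using is_fourier_L1[OF assms] is_fourier_L2 by blast
  from someI_ex[OF this] show ?thesis using that unfolding B_op_def by blast
qed

lemma density_L1: "w \<in> L2 \<Longrightarrow> integrable lborel (density w)"
  unfolding density_def by (intro integrable_of_real L2_integrable)

text \<open>The quartic functional in Fourier variables. The operator \<open>\<B>\<close> is only reached through norms,
  so the mixed term is recovered by polarisation.\<close>

theorem quartic_fourier:
  assumes w: "w \<in> L2" "density w \<in> L2"
  shows "quartic 1 \<gamma> w =
    (LINT \<xi>|lborel. (1 + \<gamma> * multiplier \<xi>) * (cmod (fourier_integral (density w) \<xi>))\<^sup>2) / (2 * pi)\<^sup>2"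
proof -
  let ?r = "density w" and ?h = "B_op (density w)" and ?F = "fourier_integral (density w)"
  note L1 = density_L1[OF w(1)]
  obtain g where g: "is_fourier ?r g" "is_fourier ?h (\<lambda>\<xi>. complex_of_real (multiplier \<xi>) * g \<xi>)"
    using B_op_fourier[OF L1 w(2)] .
  note gL2 = is_fourier_L2[OF g(1)] and hL2 = is_fourier_L2[OF g(2)]
  note [measurable] = L2_measurable[OF gL2(2)] L2_measurable[OF w(2)]
  have AE: "AE \<xi> in lborel. g \<xi> = ?F \<xi>"
    by (rule is_fourier_unique[OF g(1) is_fourier_L1[OF L1 w(2)]])
  have cnj: "cnj (?r x) = ?r x" for x by (simp add: density_def)
  have mixed: "Re (LINT x|lborel. ?h x * cnj (?r x)) = (LINT \<xi>|lborel. multiplier \<xi> * (cmod (?F \<xi>))\<^sup>2) / (2 * pi)\<^sup>2"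
  proof -
    let ?mg = "\<lambda>\<xi>. complex_of_real (multiplier \<xi>) * g \<xi>"
    have 1: "2 * Re (LINT x|lborel. ?h x * cnj (?r x)) =
        (L2_norm (\<lambda>x. ?h x + ?r x))\<^sup>2 - (L2_norm ?h)\<^sup>2 - (L2_norm ?r)\<^sup>2"
      using L2_norm_sq_add[OF hL2(1) gL2(1)] by simp
    have "((L2_norm (\<lambda>x. ?h x + ?r x))\<^sup>2 - (L2_norm ?h)\<^sup>2 - (L2_norm ?r)\<^sup>2) * (2 * pi)\<^sup>2 = (L2_norm (\<lambda>\<xi>. ?mg \<xi> + g \<xi>))\<^sup>2 - (L2_norm ?mg)\<^sup>2 - (L2_norm g)\<^sup>2"
      using is_fourier_norm[OF is_fourier_add[OF g(2,1)]] is_fourier_norm[OF g(1)] is_fourier_norm[OF g(2)]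
      by (simp add: power_mult_distrib algebra_simps)
    also have "\<dots> = 2 * Re (LINT \<xi>|lborel. ?mg \<xi> * cnj (g \<xi>))"
      using L2_norm_sq_add[OF hL2(2) gL2(2)] by simp
    also have "(LINT \<xi>|lborel. ?mg \<xi> * cnj (g \<xi>)) = complex_of_real (LINT \<xi>|lborel. multiplier \<xi> * (cmod (g \<xi>))\<^sup>2)"
      unfolding integral_complex_of_real[symmetric]
      by (simp only: mult.assoc of_real_mult complex_norm_square)
    also have "(LINT \<xi>|lborel. multiplier \<xi> * (cmod (g \<xi>))\<^sup>2) = (LINT \<xi>|lborel. multiplier \<xi> * (cmod (?F \<xi>))\<^sup>2)"
      by (rule integral_cong_AE) (use AE in auto)
    finally show ?thesis unfolding 1[symmetric] by (simp add: field_simps)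
  qed
  have "quartic 1 \<gamma> w = Re (LINT x|lborel. ?r x * cnj (?r x) + complex_of_real \<gamma> * (?h x * cnj (?r x)))"
    unfolding quartic_def L_op_def by (simp add: cnj algebra_simps)
  also have "\<dots> = Re (LINT x|lborel. ?r x * cnj (?r x)) + \<gamma> * Re (LINT x|lborel. ?h x * cnj (?r x))"
    using L2_integrable_mult[OF gL2(1) L2_cnj[OF gL2(1)]] L2_integrable_mult[OF hL2(1) L2_cnj[OF gL2(1)]]
    by simp
  also have "(LINT x|lborel. ?r x * cnj (?r x)) = complex_of_real ((L2_norm ?r)\<^sup>2)"
    unfolding L2_norm_sq integral_complex_of_real[symmetric] by (simp only: complex_norm_square)
  also have "(L2_norm ?r)\<^sup>2 = (LINT \<xi>|lborel. (cmod (?F \<xi>))\<^sup>2) / (2 * pi)\<^sup>2"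
    unfolding L2_norm_sq[of ?F, symmetric] Plancherel(2)[OF L1 w(2)] by (simp add: power_mult_distrib)
  finally have "quartic 1 \<gamma> w = ((LINT \<xi>|lborel. (cmod (?F \<xi>))\<^sup>2) + \<gamma> * (LINT \<xi>|lborel. multiplier \<xi> * (cmod (?F \<xi>))\<^sup>2)) / (2 * pi)\<^sup>2"
    by (simp add: mixed add_divide_distrib)
  also have "(LINT \<xi>|lborel. (cmod (?F \<xi>))\<^sup>2) + \<gamma> * (LINT \<xi>|lborel. multiplier \<xi> * (cmod (?F \<xi>))\<^sup>2) =
      (LINT \<xi>|lborel. (1 + \<gamma> * multiplier \<xi>) * (cmod (?F \<xi>))\<^sup>2)"
  proof -
    note i = L2_integrable[OF Plancherel(1)[OF L1 w(2)]]
    have "integrable lborel (\<lambda>\<xi>. multiplier \<xi> * (cmod (?F \<xi>))\<^sup>2)"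
      by (rule Bochner_Integration.integrable_bound[OF i])
        (use multiplier_bounds in \<open>auto simp: abs_mult intro!: mult_left_le_one_le\<close>)
    with i show ?thesis by (simp add: ring_distribs mult.assoc)
  qed
  finally show ?thesis .
qed

text \<open>For \<open>\<gamma> \<ge> 0\<close> the integrand is nonnegative, which makes Tonelli's theorem available, and at least
  \<open>|(|w|\<^sup>2)\<^sup>^|\<^sup>2\<close>.\<close>

lemma quartic_nn_integral:
  assumes w: "w \<in> L2" "density w \<in> L2" and g: "\<gamma> \<ge> 0"
  shows "(\<integral>\<^sup>+\<xi>. ennreal (1 + \<gamma> * multiplier \<xi>) * ennreal ((cmod (fourier_integral (density w) \<xi>))\<^sup>2) \<partial>lborel) =
      ennreal ((2 * pi)\<^sup>2 * quartic 1 \<gamma> w)"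
    and "(L2_norm (density w))\<^sup>2 \<le> quartic 1 \<gamma> w"
proof -
  let ?F = "fourier_integral (density w)"
  note P = Plancherel[OF density_L1[OF w(1)] w(2)]
  note [measurable] = L2_measurable[OF P(1)]
  have b: "0 \<le> \<gamma> * multiplier \<xi>" "\<gamma> * multiplier \<xi> \<le> \<gamma>" for \<xi>
    using multiplier_bounds[of \<xi>] g by (auto intro: mult_left_le)
  have int: "integrable lborel (\<lambda>\<xi>. (1 + \<gamma> * multiplier \<xi>) * (cmod (?F \<xi>))\<^sup>2)"
  proof (rule Bochner_Integration.integrable_bound)
    show "integrable lborel (\<lambda>\<xi>. (1 + \<gamma>) * (cmod (?F \<xi>))\<^sup>2)"
      by (intro integrable_mult_right L2_integrable P)
    show "AE \<xi> in lborel. norm ((1 + \<gamma> * multiplier \<xi>) * (cmod (?F \<xi>))\<^sup>2) \<le> norm ((1 + \<gamma>) * (cmod (?F \<xi>))\<^sup>2)"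
      using b g by (auto simp: abs_mult intro!: mult_right_mono)
  qed measurable
  have q: "(LINT \<xi>|lborel. (1 + \<gamma> * multiplier \<xi>) * (cmod (?F \<xi>))\<^sup>2) = (2 * pi)\<^sup>2 * quartic 1 \<gamma> w"
    by (simp add: quartic_fourier[OF w])
  have "(\<integral>\<^sup>+\<xi>. ennreal (1 + \<gamma> * multiplier \<xi>) * ennreal ((cmod (?F \<xi>))\<^sup>2) \<partial>lborel) =
      (\<integral>\<^sup>+\<xi>. ennreal ((1 + \<gamma> * multiplier \<xi>) * (cmod (?F \<xi>))\<^sup>2) \<partial>lborel)"
    using b by (intro nn_integral_cong) (simp add: ennreal_mult)
  also have "\<dots> = ennreal ((2 * pi)\<^sup>2 * quartic 1 \<gamma> w)"
    unfolding q[symmetric] using b by (intro nn_integral_eq_integral int) auto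
  finally show "(\<integral>\<^sup>+\<xi>. ennreal (1 + \<gamma> * multiplier \<xi>) * ennreal ((cmod (?F \<xi>))\<^sup>2) \<partial>lborel) =
      ennreal ((2 * pi)\<^sup>2 * quartic 1 \<gamma> w)" .
  have "(LINT \<xi>|lborel. (cmod (?F \<xi>))\<^sup>2) \<le> (LINT \<xi>|lborel. (1 + \<gamma> * multiplier \<xi>) * (cmod (?F \<xi>))\<^sup>2)"
    using b by (intro integral_mono int L2_integrable P) (simp add: mult_le_cancel_right1)
  then have "(2 * pi)\<^sup>2 * (L2_norm (density w))\<^sup>2 \<le> (2 * pi)\<^sup>2 * quartic 1 \<gamma> w"
    unfolding q L2_norm_sq[symmetric] P(2) by (simp add: power_mult_distrib)
  then show "(L2_norm (density w))\<^sup>2 \<le> quartic 1 \<gamma> w" by simp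
qed

section \<open>Smooth cutoff functions\<close>

definition flat_exp :: "real poly \<Rightarrow> real \<Rightarrow> real" where
  "flat_exp p x = (if x > 0 then poly p (1 / x) * exp (- (1 / x)) else 0)"

lemma poly_times_exp_tendsto_0: "((\<lambda>y. poly p y * exp (- y)) \<longlongrightarrow> 0) at_top" for p :: "real poly"
proof -
  have "((\<lambda>y. \<Sum>i\<le>degree p. coeff p i * (y ^ i / exp y)) \<longlongrightarrow> (\<Sum>i\<le>degree p. coeff p i * 0)) at_top"
    by (intro tendsto_sum tendsto_mult tendsto_const tendsto_power_div_exp_0)
  then show ?thesis
    by (simp add: poly_altdef sum_distrib_right exp_minus divide_inverse mult.assoc)
qed

text \<open>Every derivative of \<open>exp (- 1 / x)\<close> is again a polynomial in \<open>1 / x\<close> times \<open>exp (- 1 / x)\<close>, and such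
  functions extend by \<open>0\<close> in a differentiable way.\<close>

lemma flat_exp_deriv:
  "(flat_exp p has_real_derivative flat_exp ([:0, 0, 1:] * (p - pderiv p)) x) (at x)"
proof -
  consider "x > 0" | "x < 0" | "x = 0" by linarith
  then show ?thesis
  proof cases
    case 1
    have "((\<lambda>x. poly p (1 / x) * exp (- (1 / x))) has_real_derivative
        flat_exp ([:0, 0, 1:] * (p - pderiv p)) x) (at x)"
      using 1 by (auto intro!: derivative_eq_intros DERIV_chain2[OF poly_DERIV]
          simp: flat_exp_def field_simps power2_eq_square)
    moreover have "eventually (\<lambda>y. y \<in> {0<..}) (nhds x)"
      using 1 by (intro eventually_nhds_in_open) auto
    then have "eventually (\<lambda>y. flat_exp p y = poly p (1 / y) * exp (- (1 / y))) (nhds x)"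
      by eventually_elim (simp add: flat_exp_def)
    ultimately show ?thesis by (subst DERIV_cong_ev[OF refl _ refl]) auto
  next
    case 2
    have "eventually (\<lambda>y. y \<in> {..<0}) (nhds x)"
      using 2 by (intro eventually_nhds_in_open) auto
    then have "eventually (\<lambda>y. flat_exp p y = 0) (nhds x)"
      by eventually_elim (simp add: flat_exp_def)
    then show ?thesis using 2 by (subst DERIV_cong_ev[OF refl _ refl]) (auto simp: flat_exp_def)
  next
    case 3
    have "((\<lambda>y. poly (pCons 0 p) y * exp (- y)) \<longlongrightarrow> 0) at_top"
      by (rule poly_times_exp_tendsto_0)
    from filterlim_compose[OF this filterlim_inverse_at_top_right]
    have "((\<lambda>h. poly (pCons 0 p) (inverse h) * exp (- inverse h)) \<longlongrightarrow> 0) (at_right 0)" .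
    moreover have "eventually (\<lambda>h. poly (pCons 0 p) (inverse h) * exp (- inverse h) = (flat_exp p h - flat_exp p 0) / h) (at_right 0)"
      by (rule eventually_mono[OF eventually_at_right_less[of 0]]) (simp add: flat_exp_def field_simps)
    ultimately have right: "((\<lambda>h. (flat_exp p h - flat_exp p 0) / h) \<longlongrightarrow> 0) (at_right 0)"
      by (rule Lim_transform_eventually)
    have "eventually (\<lambda>h. (flat_exp p h - flat_exp p 0) / h = 0) (at_left (0::real))"
      unfolding eventually_at_filter by (auto simp: flat_exp_def)
    then have "((\<lambda>h. (flat_exp p h - flat_exp p 0) / h) \<longlongrightarrow> 0) (at_left 0)"
      by (rule tendsto_eventually)
    with right have "((\<lambda>h. (flat_exp p h - flat_exp p 0) / h) \<longlongrightarrow> 0) (at 0)"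
      by (simp add: filterlim_split_at)
    with 3 show ?thesis by (simp add: has_field_derivative_iff flat_exp_def)
  qed
qed

subsection \<open>Calculus of the classes \<open>C\<^sup>k\<close>\<close>

lemma partial_derivI:
  "(f has_derivative D) (at x) \<Longrightarrow> partial_deriv j f x = D (axis j 1)"
  by (simp add: partial_deriv_def frechet_derivative_at[symmetric])

lemma differentiable_partial:
  assumes "f differentiable (at x)"
  obtains D where "(f has_derivative D) (at x)" "\<And>j. partial_deriv j f x = D (axis j 1)"
  using assms partial_derivI unfolding differentiable_def by blast

lemma Ck_SucD: "Ck (Suc k) f \<Longrightarrow> Ck k f"
proof (induction k arbitrary: f)
  case 0
  then have "f differentiable (at x)" for x by simp
  then show ?case
    by (auto intro!: continuous_at_imp_continuous_on differentiable_imp_continuous_within)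
qed auto

lemma Ck_const: "Ck k (\<lambda>x. c)"
proof (induction k arbitrary: c)
  case (Suc k)
  have "partial_deriv j (\<lambda>x. c) = (\<lambda>x. 0)" for j
    by (rule ext, subst partial_derivI[OF has_derivative_const]) simp
  then show ?case using Suc[of 0] by simp
qed simp

lemma partial_deriv_add:
  assumes "f differentiable (at x)" "g differentiable (at x)"
  shows "partial_deriv j (\<lambda>x. f x + g x) x = partial_deriv j f x + partial_deriv j g x"
  using assms
  by (elim differentiable_partial) (simp add: partial_derivI[OF has_derivative_add])

lemma partial_deriv_mult:
  fixes f g :: fld
  assumes "f differentiable (at x)" "g differentiable (at x)"
  shows "partial_deriv j (\<lambda>x. f x * g x) x = f x * partial_deriv j g x + partial_deriv j f x * g x"
  using assms
  by (elim differentiable_partial) (simp add: partial_derivI[OF has_derivative_mult])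

lemma Ck_add: "Ck k f \<Longrightarrow> Ck k g \<Longrightarrow> Ck k (\<lambda>x. f x + g x)"
proof (induction k arbitrary: f g)
  case (Suc k)
  then have "partial_deriv j (\<lambda>x. f x + g x) = (\<lambda>x. partial_deriv j f x + partial_deriv j g x)" for j
    by (auto simp: fun_eq_iff partial_deriv_add)
  with Suc show ?case by auto
qed (auto intro: continuous_intros)

lemma Ck_mult: "Ck k f \<Longrightarrow> Ck k g \<Longrightarrow> Ck k (\<lambda>x. f x * g x)"
proof (induction k arbitrary: f g)
  case (Suc k)
  have eq: "partial_deriv j (\<lambda>x. f x * g x) = (\<lambda>x. f x * partial_deriv j g x + partial_deriv j f x * g x)" for j
    using Suc.prems by (auto simp: fun_eq_iff partial_deriv_mult)
  have "Ck k f" "Ck k g" using Suc.prems by (blast dest: Ck_SucD)+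
  with Suc show ?case unfolding Ck.simps(2) eq by (auto intro!: Ck_add)
qed (auto intro: continuous_intros)

lemma Ck_power: "Ck k f \<Longrightarrow> Ck k (\<lambda>x. f x ^ n)"
  by (induction n) (auto intro: Ck_const Ck_mult)

lemma
  fixes f :: fld
  assumes f: "\<And>x. f differentiable (at x)"
  shows differentiable_affine: "(\<lambda>x. f (t + c *\<^sub>R x)) differentiable (at x)"
    and partial_deriv_affine:
      "partial_deriv j (\<lambda>x. f (t + c *\<^sub>R x)) x = complex_of_real c * partial_deriv j f (t + c *\<^sub>R x)"
proof -
  let ?D = "frechet_derivative f (at (t + c *\<^sub>R x))"
  have "((\<lambda>x. t + c *\<^sub>R x) has_derivative (\<lambda>h. c *\<^sub>R h)) (at x)"
    by (auto intro!: derivative_eq_intros)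
  moreover have "(f has_derivative ?D) (at (t + c *\<^sub>R x))"
    using f by (simp add: frechet_derivative_works[symmetric])
  ultimately have d: "((\<lambda>x. f (t + c *\<^sub>R x)) has_derivative (\<lambda>h. ?D (c *\<^sub>R h))) (at x)"
    by (rule has_derivative_compose)
  then show "(\<lambda>x. f (t + c *\<^sub>R x)) differentiable (at x)"
    unfolding differentiable_def by blast
  have "linear ?D" by (intro linear_frechet_derivative f)
  from linear_scale[OF this] partial_derivI[OF d]
  show "partial_deriv j (\<lambda>x. f (t + c *\<^sub>R x)) x = complex_of_real c * partial_deriv j f (t + c *\<^sub>R x)"
    unfolding partial_deriv_def[of j f] by (simp flip: scaleR_conv_of_real)
qed

lemma Ck_affine: "Ck k f \<Longrightarrow> Ck k (\<lambda>x. f (t + c *\<^sub>R x))"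
proof (induction k arbitrary: f)
  case 0
  then show ?case by (auto intro!: continuous_on_compose2[of UNIV f] continuous_intros)
next
  case (Suc k)
  then have "partial_deriv j (\<lambda>x. f (t + c *\<^sub>R x)) = (\<lambda>x. complex_of_real c * partial_deriv j f (t + c *\<^sub>R x))" for j
    by (auto simp: fun_eq_iff partial_deriv_affine)
  with Suc show ?case by (auto intro!: Ck_mult Ck_const differentiable_affine)
qed

lemma Ck_flat_exp: "Ck k (\<lambda>x. complex_of_real (flat_exp p (c * (x $ j) + d)))"
proof (induction k arbitrary: p)
  case 0
  have "continuous_on UNIV (flat_exp p)"
    using flat_exp_deriv by (auto intro!: continuous_at_imp_continuous_on DERIV_isCont)
  then show ?case by (auto intro!: continuous_intros continuous_on_compose2[of UNIV "flat_exp p"])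
next
  case (Suc k)
  let ?p = "[:0, 0, 1:] * (p - pderiv p)"
  have d: "((\<lambda>x. complex_of_real (flat_exp p (c * (x $ j) + d))) has_derivative
      (\<lambda>h. complex_of_real (c * (h $ j) * flat_exp ?p (c * (x $ j) + d)))) (at x)" for x :: plane
  proof -
    have "((\<lambda>x. c * (x $ j) + d) has_derivative (\<lambda>h. c * (h $ j))) (at x)"
      by (auto intro!: derivative_eq_intros bounded_linear.has_derivative[OF bounded_linear_vec_nth])
    from has_derivative_of_real[OF has_derivative_compose[OF this flat_exp_deriv[unfolded has_field_derivative_def]]]
    show ?thesis by (simp add: mult.commute)
  qed
  have "partial_deriv i (\<lambda>x. complex_of_real (flat_exp p (c * (x $ j) + d))) =
      (\<lambda>x. complex_of_real (if i = j then c else 0) * complex_of_real (flat_exp ?p (c * (x $ j) + d)))" for i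
    by (rule ext, subst partial_derivI[OF d]) (auto simp: axis_def)
  with Suc[of ?p] d show ?case by (auto simp: differentiable_def simp del: of_real_mult intro!: Ck_mult Ck_const)
qed

subsection \<open>Cutoff functions of boxes\<close>

definition bump :: "plane \<Rightarrow> plane \<Rightarrow> plane \<Rightarrow> real" where
  "bump a b x = flat_exp 1 (x $ 1 - a $ 1) * flat_exp 1 (b $ 1 - x $ 1) *
    (flat_exp 1 (x $ 2 - a $ 2) * flat_exp 1 (b $ 2 - x $ 2))"

text \<open>Powers of \<open>1 - bump\<close> tend to \<open>0\<close> exactly where the bump is positive; this gives smooth
  approximations of the indicator of a box.\<close>

definition cutoff :: "nat \<Rightarrow> plane \<Rightarrow> plane \<Rightarrow> plane \<Rightarrow> real" where
  "cutoff n a b x = 1 - (1 - bump a b x) ^ n"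

lemma flat_exp_1_bounds: "0 \<le> flat_exp 1 t" "flat_exp 1 t < 1" "0 < flat_exp 1 t \<longleftrightarrow> 0 < t"
  by (auto simp: flat_exp_def)

lemma bump_bounds: "0 \<le> bump a b x" "bump a b x < 1"
proof -
  have *: "0 \<le> s * t \<and> s * t < 1" if "0 \<le> s \<and> s < 1" "0 \<le> t \<and> t < 1" for s t :: real
    using mult_strict_mono[of s 1 t 1] that by auto
  show "0 \<le> bump a b x" "bump a b x < 1"
    unfolding bump_def using flat_exp_1_bounds * by meson+
qed

lemma bump_pos: "0 < bump a b x \<longleftrightarrow> x \<in> box a b"
proof -
  have "0 < s * t \<longleftrightarrow> 0 < s \<and> 0 < t" if "0 \<le> s" "0 \<le> t" for s t :: real
    using that by (auto simp: zero_less_mult_iff)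
  then show ?thesis
    unfolding bump_def using flat_exp_1_bounds
    by (simp add: mem_box_cart forall_2 conj_ac)
qed

lemma cutoff_bounds: "0 \<le> cutoff n a b x" "cutoff n a b x \<le> 1"
  unfolding cutoff_def using bump_bounds[of a b x] by (auto intro: power_le_one)

lemma cutoff_outside: "x \<notin> box a b \<Longrightarrow> cutoff n a b x = 0"
  using bump_pos[of a b x] bump_bounds[of a b x] by (simp add: cutoff_def)

lemma cutoff_tendsto: "(\<lambda>n. cutoff n a b x) \<longlonglongrightarrow> indicator (box a b) x"
proof (cases "x \<in> box a b")
  case True
  then have "(\<lambda>n. (1 - bump a b x) ^ n) \<longlonglongrightarrow> 0"
    using bump_pos[of a b x] bump_bounds[of a b x] by (intro LIMSEQ_power_zero) auto
  from tendsto_diff[OF tendsto_const this, of 1] True show ?thesis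
    by (simp add: cutoff_def)
qed (simp add: cutoff_outside)

lemma Ck_cutoff: "Ck k (\<lambda>x. complex_of_real (cutoff n a b x))"
proof -
  have 1: "Ck k (\<lambda>x. complex_of_real (flat_exp 1 (x $ j - d)))" for j d
    using Ck_flat_exp[of k 1 1 j "- d"] by simp
  have 2: "Ck k (\<lambda>x. complex_of_real (flat_exp 1 (d - x $ j)))" for j d
    using Ck_flat_exp[of k 1 "-1" j d] by simp
  have 3: "Ck k (\<lambda>x. complex_of_real (bump a b x))"
    unfolding bump_def of_real_mult by (intro Ck_mult 1 2)
  have "Ck k (\<lambda>x. 1 + (-1) * (1 + (-1) * complex_of_real (bump a b x)) ^ n)"
    by (intro Ck_add Ck_mult Ck_const Ck_power 3)
  then show ?thesis by (simp add: cutoff_def)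
qed

lemma test_cutoff: "test_function (\<lambda>x. complex_of_real (cutoff n a b x))"
  unfolding test_function_def
proof (intro conjI allI Ck_cutoff exI[of _ "cbox a b"] impI)
  show "complex_of_real (cutoff n a b x) = 0" if "x \<notin> cbox a b" for x
    using that box_subset_cbox[of a b] by (auto intro!: cutoff_outside)
qed simp

subsection \<open>Test functions\<close>

lemma test_function_diff: "test_function \<phi> \<Longrightarrow> \<phi> differentiable (at x)"
  unfolding test_function_def using Ck.simps(2)[of 0 \<phi>] by blast

lemma test_function_mult: "test_function \<phi> \<Longrightarrow> test_function \<psi> \<Longrightarrow> test_function (\<lambda>x. \<phi> x * \<psi> x)"
  unfolding test_function_def by (auto intro: Ck_mult)

lemma test_function_partial: "test_function \<phi> \<Longrightarrow> test_function (partial_deriv j \<phi>)"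
proof -
  assume t: "test_function \<phi>"
  then obtain K where K: "compact K" "\<And>x. x \<notin> K \<Longrightarrow> \<phi> x = 0"
    unfolding test_function_def by blast
  have "Ck (Suc k) \<phi>" for k using t unfolding test_function_def by blast
  then have "Ck k (partial_deriv j \<phi>)" for k by simp
  moreover have "partial_deriv j \<phi> x = 0" if "x \<notin> K" for x
  proof -
    have "eventually (\<lambda>y. y \<in> - K) (nhds x)"
      using that K(1) by (intro eventually_nhds_in_open) (auto intro: compact_imp_closed simp: open_Compl)
    then have ev: "eventually (\<lambda>y. 0 = \<phi> y) (at x)"
      unfolding eventually_at_filter by eventually_elim (use K in auto)
    have "((\<lambda>y. 0) has_derivative (\<lambda>h. 0)) (at x)" by simp
    then have "(\<phi> has_derivative (\<lambda>h. 0)) (at x)"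
      by (rule has_derivative_transform_eventually[OF _ ev]) (use K that in auto)
    from partial_derivI[OF this] show ?thesis .
  qed
  ultimately show ?thesis using K(1) unfolding test_function_def by blast
qed

lemma test_function_bounded_measurable:
  assumes "test_function \<phi>"
  shows "\<phi> \<in> borel_measurable borel" "\<exists>B\<ge>0. \<forall>x. cmod (\<phi> x) \<le> B" "\<phi> \<in> L2"
proof -
  obtain K where K: "compact K" "\<And>x. x \<notin> K \<Longrightarrow> \<phi> x = 0"
    using assms unfolding test_function_def by blast
  have cont: "continuous_on UNIV \<phi>"
    using assms unfolding test_function_def using Ck.simps(1) by blast
  then show m: "\<phi> \<in> borel_measurable borel" by (rule borel_measurable_continuous_onI)
  have "bounded (\<phi> ` K)"
    using K(1) cont by (intro compact_imp_bounded compact_continuous_image) (auto intro: continuous_on_subset)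
  then obtain B where B: "B > 0" "\<And>x. x \<in> K \<Longrightarrow> cmod (\<phi> x) \<le> B"
    unfolding bounded_pos by auto
  then have *: "cmod (\<phi> x) \<le> B * cmod (indicator K x)" for x
    using K(2)[of x] by (cases "x \<in> K") auto
  have "cmod (\<phi> x) \<le> B" for x
    using B K(2)[of x] by (cases "x \<in> K") auto
  then show "\<exists>B\<ge>0. \<forall>x. cmod (\<phi> x) \<le> B"
    using B(1) less_imp_le by blast
  show "\<phi> \<in> L2"
    by (rule L2_bound[OF indicator_L2(1)[OF borel_compact[OF K(1)] emeasure_compact_finite[OF K(1)]] m *])
qed

section \<open>Weak derivatives\<close>

text \<open>The positive and the negative part of \<open>G\<close> are the densities of two measures that agree on boxes,
  and boxes form a generating system stable under intersection.\<close>

lemma AE_zero_if_box_integrals_zero: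
  fixes G :: "plane \<Rightarrow> real"
  assumes [measurable]: "G \<in> borel_measurable borel"
    and int: "\<And>a b. integrable lborel (\<lambda>x. indicator (box a b) x * G x)"
    and zero: "\<And>a b. (LINT x|lborel. indicator (box a b) x * G x) = 0"
  shows "AE x in lborel. G x = 0"
proof -
  let ?D = "Nonnegative_Lebesgue_Integration.density lborel"
  have em: "emeasure (?D (\<lambda>x. ennreal (s * G x))) (box a b) =
      ennreal (LINT x|lborel. max 0 (s * (indicator (box a b) x * G x)))" for s a b
  proof -
    have i: "integrable lborel (\<lambda>x. max 0 (s * (indicator (box a b) x * G x)))"
      by (intro integrable_max integrable_zero integrable_mult_right int)
    have "emeasure (?D (\<lambda>x. ennreal (s * G x))) (box a b) =
        (\<integral>\<^sup>+x. ennreal (s * G x) * indicator (box a b) x \<partial>lborel)"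
      by (rule emeasure_density) auto
    also have "\<dots> = (\<integral>\<^sup>+x. ennreal (max 0 (s * (indicator (box a b) x * G x))) \<partial>lborel)"
      by (intro nn_integral_cong) (auto simp: indicator_def max_def ennreal_neg)
    also have "\<dots> = ennreal (LINT x|lborel. max 0 (s * (indicator (box a b) x * G x)))"
      by (intro nn_integral_eq_integral i) auto
    finally show ?thesis .
  qed
  have eq: "emeasure (?D (\<lambda>x. ennreal (1 * G x))) (box a b) = emeasure (?D (\<lambda>x. ennreal ((-1) * G x))) (box a b)" for a b
  proof -
    have i: "integrable lborel (\<lambda>x. max 0 (s * (indicator (box a b) x * G x)))" for s
      by (intro integrable_max integrable_zero integrable_mult_right int)
    have "max 0 (1 * t) - max 0 ((-1) * t) = t" for t :: real by auto
    then have "(LINT x|lborel. max 0 (1 * (indicator (box a b) x * G x))) -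
        (LINT x|lborel. max 0 ((-1) * (indicator (box a b) x * G x))) = 0"
      using zero[of a b] by (subst Bochner_Integration.integral_diff[symmetric, OF i i]) simp
    then show ?thesis by (simp only: em) simp
  qed
  have "?D (\<lambda>x. ennreal (1 * G x)) = ?D (\<lambda>x. ennreal ((-1) * G x))"
  proof (rule measure_eqI_generator_eq)
    let ?E = "range (\<lambda>(a, b). box a b :: plane set)"
    show "Int_stable ?E"
      by (auto simp: Int_stable_def box_Int_box)
    show "?E \<subseteq> Pow UNIV" "sets (?D (\<lambda>x. ennreal (1 * G x))) = sigma_sets UNIV ?E"
      "sets (?D (\<lambda>x. ennreal ((-1) * G x))) = sigma_sets UNIV ?E"
      by (simp_all add: borel_eq_box)
    let ?A = "\<lambda>n::nat. box (- (real n *\<^sub>R One)) (real n *\<^sub>R One) :: plane set"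
    show "range ?A \<subseteq> ?E" "(\<Union>i. ?A i) = UNIV"
      unfolding UN_box_eq_UNIV by auto
    show "emeasure (?D (\<lambda>x. ennreal (1 * G x))) (?A i) \<noteq> \<infinity>" for i
      by (simp only: em) simp
    show "emeasure (?D (\<lambda>x. ennreal (1 * G x))) X = emeasure (?D (\<lambda>x. ennreal ((-1) * G x))) X" if "X \<in> ?E" for X
      using that eq by auto
  qed
  then have "AE x in lborel. ennreal (1 * G x) = ennreal ((-1) * G x)"
    by (intro sigma_finite_measure.density_unique[OF sigma_finite_lborel]) auto
  then show ?thesis
  proof eventually_elim
    case (elim x)
    show ?case
    proof (rule ccontr)
      assume "G x \<noteq> 0"
      then show False using elim by (cases "G x > 0") (auto simp: ennreal_neg ennreal_eq_0_iff)
    qed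
  qed
qed

text \<open>Cutoff functions carry the hypothesis over to indicators of boxes.\<close>

lemma L2_annihilates_test:
  assumes g: "g \<in> L2" and zero: "\<And>\<phi>. test_function \<phi> \<Longrightarrow> (LINT x|lborel. g x * \<phi> x) = 0"
  shows "AE x in lborel. g x = 0"
proof -
  note [measurable] = L2_measurable[OF g]
  have int: "integrable lborel (\<lambda>x. g x * indicator (box a b) x)" for a b
    by (intro L2_integrable_mult g indicator_L2 emeasure_lborel_box_finite) auto
  have box: "(LINT x|lborel. g x * indicator (box a b) x) = 0" for a b
  proof -
    have "(\<lambda>n. LINT x|lborel. g x * complex_of_real (cutoff n a b x)) \<longlonglongrightarrow>
        (LINT x|lborel. g x * indicator (box a b) x)"
    proof (rule integral_dominated_convergence)
      show "integrable lborel (\<lambda>x. cmod (g x * indicator (box a b) x))"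
        by (rule integrable_norm[OF int])
      have "(\<lambda>n. g x * complex_of_real (cutoff n a b x)) \<longlonglongrightarrow> g x * indicator (box a b) x" for x
      proof -
        have "(\<lambda>n. g x * complex_of_real (cutoff n a b x)) \<longlonglongrightarrow> g x * complex_of_real (indicator (box a b) x)"
          by (intro tendsto_intros cutoff_tendsto)
        also have "complex_of_real (indicator (box a b) x) = indicator (box a b) x"
          by (simp add: indicator_def)
        finally show ?thesis .
      qed
      then show "AE x in lborel. (\<lambda>n. g x * complex_of_real (cutoff n a b x)) \<longlonglongrightarrow> g x * indicator (box a b) x"
        by simp
      have "cmod (g x * complex_of_real (cutoff n a b x)) \<le> cmod (g x * indicator (box a b) x)" for n x
        using cutoff_bounds[of n a b x] cutoff_outside[of x a b n]
        by (cases "x \<in> box a b") (auto simp: norm_mult intro: mult_left_le)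
      then show "AE x in lborel. norm (g x * complex_of_real (cutoff n a b x)) \<le> cmod (g x * indicator (box a b) x)" for n
        by simp
      show "(\<lambda>x. g x * complex_of_real (cutoff n a b x)) \<in> borel_measurable lborel" for n
        using test_function_bounded_measurable(1)[OF test_cutoff] by measurable
    qed measurable
    then show ?thesis using zero[OF test_cutoff] LIMSEQ_unique[OF _ tendsto_const] by fastforce
  qed
  have "AE x in lborel. Re (g x) = 0"
  proof (rule AE_zero_if_box_integrals_zero)
    fix a b :: plane
    have eq: "(\<lambda>x. indicator (box a b) x * Re (g x)) = (\<lambda>x. Re (g x * indicator (box a b) x))"
      by (auto simp: indicator_def fun_eq_iff)
    show "integrable lborel (\<lambda>x. indicator (box a b) x * Re (g x))"
      "(LINT x|lborel. indicator (box a b) x * Re (g x)) = 0"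
      unfolding eq by (simp_all only: integrable_Re[OF int] integral_Re[OF int] box zero_complex.sel)
  qed measurable
  moreover have "AE x in lborel. Im (g x) = 0"
  proof (rule AE_zero_if_box_integrals_zero)
    fix a b :: plane
    have eq: "(\<lambda>x. indicator (box a b) x * Im (g x)) = (\<lambda>x. Im (g x * indicator (box a b) x))"
      by (auto simp: indicator_def fun_eq_iff)
    show "integrable lborel (\<lambda>x. indicator (box a b) x * Im (g x))"
      "(LINT x|lborel. indicator (box a b) x * Im (g x)) = 0"
      unfolding eq by (simp_all only: integrable_Im[OF int] integral_Im[OF int] box zero_complex.sel)
  qed measurable
  ultimately show ?thesis by eventually_elim (simp add: complex_eq_iff)
qed

lemma weak_deriv_unique:
  assumes "is_weak_deriv j f g" "is_weak_deriv j f g'"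
  shows "AE x in lborel. g x = g' x"
proof -
  have L2: "g \<in> L2" "g' \<in> L2" using assms by (auto simp: is_weak_deriv_def)
  have "AE x in lborel. g x - g' x = 0"
  proof (rule L2_annihilates_test)
    show "(\<lambda>x. g x - g' x) \<in> L2" by (intro L2_diff L2)
    fix \<phi> assume t: "test_function \<phi>"
    note p = test_function_bounded_measurable(3)[OF t]
    have "(LINT x|lborel. g x * \<phi> x) = (LINT x|lborel. g' x * \<phi> x)"
      using assms t unfolding is_weak_deriv_def by (metis add.inverse_inverse)
    then show "(LINT x|lborel. (g x - g' x) * \<phi> x) = 0"
      using L2_integrable_mult[OF L2(1) p] L2_integrable_mult[OF L2(2) p] by (simp add: ring_distribs)
  qed
  then show ?thesis by simp
qed

lemma H1_weak_deriv: "f \<in> H1 \<Longrightarrow> is_weak_deriv j f (weak_deriv j f)"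
  unfolding weak_deriv_def using someI_ex[of "is_weak_deriv j f"] by (simp add: H1_def)

lemma H1_L2: "f \<in> H1 \<Longrightarrow> f \<in> L2"
  by (simp add: H1_def)

lemma weak_deriv_L2: "f \<in> H1 \<Longrightarrow> weak_deriv j f \<in> L2"
  using H1_weak_deriv by (auto simp: is_weak_deriv_def)

lemma grad_norm_sq: "(grad_norm f)\<^sup>2 = (\<Sum>j\<in>UNIV. (L2_norm (weak_deriv j f))\<^sup>2)"
  unfolding grad_norm_def by (simp add: sum_nonneg)

lemma grad_norm_nonneg [simp]: "0 \<le> grad_norm f"
  unfolding grad_norm_def by (simp add: sum_nonneg)

text \<open>The gradient norm, defined through a choice of weak derivatives, may be computed from any of them.\<close>

lemma grad_norm_sq_eq:
  assumes "\<And>j. is_weak_deriv j f (g j)"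
  shows "(grad_norm f)\<^sup>2 = (\<Sum>j\<in>UNIV. (L2_norm (g j))\<^sup>2)"
proof -
  have "L2_norm (weak_deriv j f) = L2_norm (g j)" for j
  proof (rule L2_norm_cong_AE)
    have w: "is_weak_deriv j f (weak_deriv j f)"
      unfolding weak_deriv_def using someI[of "is_weak_deriv j f", OF assms] by simp
    show "AE x in lborel. weak_deriv j f x = g j x" by (rule weak_deriv_unique[OF w assms])
    show "weak_deriv j f \<in> borel_measurable borel" "g j \<in> borel_measurable borel"
      using w assms[of j] by (auto simp: is_weak_deriv_def intro: L2_measurable)
  qed
  then show ?thesis by (simp add: grad_norm_sq)
qed

lemma is_weak_deriv_diff:
  assumes f: "f \<in> L2" "f' \<in> L2" and g: "is_weak_deriv j f g" "is_weak_deriv j f' g'"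
  shows "is_weak_deriv j (\<lambda>x. f x - f' x) (\<lambda>x. g x - g' x)"
  unfolding is_weak_deriv_def
proof (intro conjI allI impI)
  have L2: "g \<in> L2" "g' \<in> L2" using g by (auto simp: is_weak_deriv_def)
  then show "(\<lambda>x. g x - g' x) \<in> L2" by (intro L2_diff)
  fix \<phi> assume t: "test_function \<phi>"
  note p = test_function_bounded_measurable(3)[OF t]
    test_function_bounded_measurable(3)[OF test_function_partial[OF t, of j]]
  show "(LINT x|lborel. (f x - f' x) * partial_deriv j \<phi> x) = - (LINT x|lborel. (g x - g' x) * \<phi> x)"
    using g t f L2 p unfolding is_weak_deriv_def
    by (simp add: ring_distribs L2_integrable_mult)
qed

lemma L2_norm_sq_le_double:
  assumes "f \<in> L2" "g \<in> L2"
  shows "(L2_norm f)\<^sup>2 \<le> 2 * (L2_norm (\<lambda>x. f x - g x))\<^sup>2 + 2 * (L2_norm g)\<^sup>2"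
proof -
  let ?d = "L2_norm (\<lambda>x. f x - g x)"
  have "L2_norm f \<le> ?d + L2_norm g"
    using L2_norm_triangle[OF L2_diff[OF assms] assms(2)] by simp
  then have "(L2_norm f)\<^sup>2 \<le> (?d + L2_norm g)\<^sup>2" by (rule power_mono) simp
  also have "\<dots> \<le> 2 * ?d\<^sup>2 + 2 * (L2_norm g)\<^sup>2"
    using sum_squares_bound[of ?d "L2_norm g"] by (simp add: power2_sum)
  finally show ?thesis .
qed

lemma grad_norm_sq_le_double:
  assumes "f \<in> H1" "g \<in> H1"
  shows "(grad_norm f)\<^sup>2 \<le> 2 * (grad_norm (\<lambda>x. f x - g x))\<^sup>2 + 2 * (grad_norm g)\<^sup>2"
proof -
  have "(grad_norm (\<lambda>x. f x - g x))\<^sup>2 = (\<Sum>j\<in>UNIV. (L2_norm (\<lambda>x. weak_deriv j f x - weak_deriv j g x))\<^sup>2)"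
    by (intro grad_norm_sq_eq is_weak_deriv_diff H1_L2 H1_weak_deriv assms)
  then show ?thesis
    unfolding grad_norm_sq[of f] grad_norm_sq[of g]
    by (simp add: sum_distrib_left flip: sum.distrib)
      (intro sum_mono L2_norm_sq_le_double weak_deriv_L2 assms)
qed

text \<open>Products of test functions are test functions, so the classical product rule applies to \<open>\<eta> \<phi>\<close>.\<close>

lemma is_weak_deriv_mult:
  assumes f: "f \<in> L2" and g: "is_weak_deriv j f g" and chi: "test_function \<eta>"
  shows "is_weak_deriv j (\<lambda>x. \<eta> x * f x) (\<lambda>x. \<eta> x * g x + partial_deriv j \<eta> x * f x)"
  unfolding is_weak_deriv_def
proof (intro conjI allI impI)
  have gL2: "g \<in> L2" using g by (auto simp: is_weak_deriv_def)
  have mult_L2: "(\<lambda>x. \<psi> x * h x) \<in> L2" if psi: "test_function \<psi>" and h: "h \<in> L2" for \<psi> h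
  proof -
    obtain B where B: "B \<ge> 0" "\<And>x. cmod (\<psi> x) \<le> B"
      using test_function_bounded_measurable(2)[OF psi] by blast
    note [measurable] = test_function_bounded_measurable(1)[OF psi] L2_measurable[OF h]
    show ?thesis
      by (rule L2_bound[OF h, of _ B]) (auto simp: norm_mult intro!: mult_right_mono B)
  qed
  note dchi = test_function_partial[OF chi, of j]
  show "(\<lambda>x. \<eta> x * g x + partial_deriv j \<eta> x * f x) \<in> L2"
    by (intro L2_add mult_L2 chi dchi gL2 f)
  fix \<phi> assume t: "test_function \<phi>"
  note p = test_function_bounded_measurable(3)[OF t]
    test_function_bounded_measurable(3)[OF test_function_partial[OF t, of j]]
  have i: "integrable lborel (\<lambda>x. \<psi> x * h x * \<theta> x)" if "test_function \<psi>" "h \<in> L2" "\<theta> \<in> L2" for \<psi> h \<theta>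
    by (intro L2_integrable_mult mult_L2 that)
  have "(LINT x|lborel. f x * partial_deriv j (\<lambda>x. \<eta> x * \<phi> x) x) = - (LINT x|lborel. g x * (\<eta> x * \<phi> x))"
    using g test_function_mult[OF chi t] unfolding is_weak_deriv_def by blast
  moreover have "f x * partial_deriv j (\<lambda>x. \<eta> x * \<phi> x) x =
      \<eta> x * f x * partial_deriv j \<phi> x + partial_deriv j \<eta> x * f x * \<phi> x" for x
    by (simp add: partial_deriv_mult test_function_diff chi t algebra_simps)
  ultimately have "(LINT x|lborel. \<eta> x * f x * partial_deriv j \<phi> x) + (LINT x|lborel. partial_deriv j \<eta> x * f x * \<phi> x) =
      - (LINT x|lborel. \<eta> x * g x * \<phi> x)"
    using i[OF chi f p(2)] i[OF dchi f p(1)] by (simp add: ac_simps)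
  then show "(LINT x|lborel. \<eta> x * f x * partial_deriv j \<phi> x) =
      - (LINT x|lborel. (\<eta> x * g x + partial_deriv j \<eta> x * f x) * \<phi> x)"
    using i[OF chi gL2 p(1)] i[OF dchi f p(1)] by (simp add: ring_distribs algebra_simps)
qed

section \<open>Averaging over translated windows\<close>

lemma L2_bounded_L1:
  assumes "integrable lborel f" "\<And>x. cmod (f x) \<le> B"
  shows "f \<in> L2"
proof -
  note [measurable] = borel_measurable_integrable[OF assms(1)]
  have "integrable lborel (\<lambda>x. (cmod (f x))\<^sup>2)"
  proof (rule Bochner_Integration.integrable_bound)
    show "integrable lborel (\<lambda>x. B * cmod (f x))"
      by (intro integrable_mult_right integrable_norm assms(1))
    show "AE x in lborel. norm ((cmod (f x))\<^sup>2) \<le> norm (B * cmod (f x))"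
    proof (rule always_eventually, rule allI)
      fix x
      have "cmod (f x) * cmod (f x) \<le> B * cmod (f x)" by (intro mult_right_mono assms) simp
      also have "\<dots> \<le> norm (B * cmod (f x))" by simp
      finally show "norm ((cmod (f x))\<^sup>2) \<le> norm (B * cmod (f x))" by (simp add: power2_eq_square)
    qed
  qed measurable
  then show ?thesis by (simp add: L2_def)
qed

lemma
  fixes f :: "plane \<Rightarrow> 'b::{banach, second_countable_topology}"
  assumes "f \<in> borel_measurable borel"
  shows integrable_plane_reflect: "integrable lborel (\<lambda>y. f (x - y)) \<longleftrightarrow> integrable lborel f"
    and integral_plane_reflect: "(LINT y|lborel. f (x - y)) = (LINT y|lborel. f y)"
  using integrable_plane_affine[OF assms, of "-1" x] integral_plane_affine[OF assms, of "-1" x]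
  by simp_all

lemma window_kernel_integrable:
  fixes \<phi> f :: fld
  assumes \<phi>: "integrable lborel \<phi>" and f: "integrable lborel f"
    and [measurable]: "(\<lambda>(x, y). a x y) \<in> borel_measurable (lborel \<Otimes>\<^sub>M lborel)"
    and a: "\<And>x y. cmod (a x y) \<le> 1"
  shows "integrable (lborel \<Otimes>\<^sub>M lborel) (\<lambda>(x, y). a x y * (\<phi> (x - y) * f x))"
proof (rule Bochner_Integration.integrable_bound)
  note [measurable] = borel_measurable_integrable[OF \<phi>] borel_measurable_integrable[OF f]
  have \<phi>': "integrable lborel (\<lambda>y. \<phi> (x - y))" for x :: plane
    using \<phi> by (subst integrable_plane_reflect) auto
  show "integrable (lborel \<Otimes>\<^sub>M lborel) (\<lambda>(x, y). \<phi> (x - y) * f x)"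
  proof (rule lborel_pair.Fubini_integrable)
    show "(\<lambda>(x, y). \<phi> (x - y) * f x) \<in> borel_measurable (lborel \<Otimes>\<^sub>M lborel)" by measurable
    show "AE x in lborel. integrable lborel (\<lambda>y. case (x, y) of (x, y) \<Rightarrow> \<phi> (x - y) * f x)"
      using \<phi>' by simp
    have "(LINT y|lborel. cmod (\<phi> (x - y) * f x)) = (LINT y|lborel. cmod (\<phi> y)) * cmod (f x)" for x
      using integral_plane_reflect[of "\<lambda>z. cmod (\<phi> z)" x] by (simp add: norm_mult)
    then show "integrable lborel (\<lambda>x. LINT y|lborel. norm (case (x, y) of (x, y) \<Rightarrow> \<phi> (x - y) * f x))"
      using f by simp
  qed
  show "(\<lambda>(x, y). a x y * (\<phi> (x - y) * f x)) \<in> borel_measurable (lborel \<Otimes>\<^sub>M lborel)" by measurable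
  show "AE p in lborel \<Otimes>\<^sub>M lborel. norm (case p of (x, y) \<Rightarrow> a x y * (\<phi> (x - y) * f x)) \<le>
      norm (case p of (x, y) \<Rightarrow> \<phi> (x - y) * f x)"
    by (intro always_eventually allI)
      (auto simp: case_prod_beta norm_mult intro!: mult_left_le_one_le mult_nonneg_nonneg a)
qed

lemma window_fourier_integrable:
  assumes \<phi>: "integrable lborel \<phi>" and f: "integrable lborel f"
  shows "integrable lborel (\<lambda>y. fourier_integral (\<lambda>x. \<phi> (x - y) * f x) \<xi>)"
  unfolding fourier_integral_def
  by (rule lborel_pair.integrable_snd, rule window_kernel_integrable[OF \<phi> f]) auto

lemma window_fourier_bound:
  assumes \<phi>: "\<phi> \<in> borel_measurable borel" "\<And>x. cmod (\<phi> x) \<le> B" and f: "integrable lborel f"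
  shows "cmod (fourier_integral (\<lambda>x. \<phi> (x - y) * f x) \<xi>) \<le> B * (LINT x|lborel. cmod (f x))"
proof -
  note [measurable] = \<phi>(1) borel_measurable_integrable[OF f]
  have B: "B \<ge> 0" using \<phi>(2)[of 0] norm_ge_zero order_trans by blast
  have "cmod (fourier_integral (\<lambda>x. \<phi> (x - y) * f x) \<xi>) \<le> (LINT x|lborel. cmod (\<phi> (x - y) * f x))"
    by (rule fourier_bound)
  also have "\<dots> \<le> (LINT x|lborel. B * cmod (f x))"
  proof (rule integral_mono)
    show "integrable lborel (\<lambda>x. cmod (\<phi> (x - y) * f x))"
      by (rule Bochner_Integration.integrable_bound[OF integrable_mult_right[OF integrable_norm[OF f], of B]])
        (use \<phi>(2) B in \<open>auto simp: norm_mult abs_mult intro!: mult_right_mono\<close>)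
    show "cmod (\<phi> (x - y) * f x) \<le> B * cmod (f x)" for x
      using \<phi>(2) by (auto simp: norm_mult intro!: mult_right_mono)
  qed (use f in auto)
  finally show ?thesis by simp
qed

text \<open>For a fixed frequency \<open>\<xi>\<close>, the windowed transform is a convolution in the position \<open>y\<close> of the
  window, so its transform in \<open>y\<close> is a product.\<close>

lemma window_fourier_transform:
  assumes \<phi>: "integrable lborel \<phi>" and f: "integrable lborel f"
  shows "fourier_integral (\<lambda>y. fourier_integral (\<lambda>x. \<phi> (x - y) * f x) \<xi>) \<eta> =
    fourier_integral f (\<xi> + \<eta>) * fourier_integral \<phi> (- \<eta>)"
proof -
  note [measurable] = borel_measurable_integrable[OF \<phi>] borel_measurable_integrable[OF f]
  let ?a = "\<lambda>x y. cis (- (y \<bullet> \<eta>)) * cis (- (x \<bullet> \<xi>))"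
  have int: "integrable (lborel \<Otimes>\<^sub>M lborel) (\<lambda>(x, y). ?a x y * (\<phi> (x - y) * f x))"
    by (rule window_kernel_integrable[OF \<phi> f]) (auto simp: norm_mult)
  have "fourier_integral (\<lambda>y. fourier_integral (\<lambda>x. \<phi> (x - y) * f x) \<xi>) \<eta> =
      (LINT y|lborel. LINT x|lborel. ?a x y * (\<phi> (x - y) * f x))"
    unfolding fourier_integral_def by (subst integral_mult_right_zero[symmetric]) (simp add: mult.assoc)
  also have "\<dots> = (LINT x|lborel. LINT y|lborel. ?a x y * (\<phi> (x - y) * f x))"
    by (rule lborel_pair.Fubini_integral[OF int])
  also have "\<dots> = (LINT x|lborel. cis (- (x \<bullet> (\<xi> + \<eta>))) * f x * fourier_integral \<phi> (- \<eta>))"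
  proof (intro Bochner_Integration.integral_cong refl)
    fix x :: plane
    have "(LINT y|lborel. ?a x y * (\<phi> (x - y) * f x)) =
        (LINT y|lborel. ?a x (x - (x - y)) * (\<phi> (x - y) * f x))" by simp
    also have "\<dots> = (LINT z|lborel. ?a x (x - z) * (\<phi> z * f x))"
      by (rule integral_plane_reflect[where f = "\<lambda>z. ?a x (x - z) * (\<phi> z * f x)"]) measurable
    also have "\<dots> = (LINT z|lborel. cis (- (x \<bullet> (\<xi> + \<eta>))) * f x * (cis (- (z \<bullet> (- \<eta>))) * \<phi> z))"
    proof (intro Bochner_Integration.integral_cong refl)
      fix z :: plane
      have "?a x (x - z) = cis (- (x \<bullet> (\<xi> + \<eta>))) * cis (- (z \<bullet> (- \<eta>)))"
        by (simp add: cis_mult algebra_simps)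
      then show "?a x (x - z) * (\<phi> z * f x) =
          cis (- (x \<bullet> (\<xi> + \<eta>))) * f x * (cis (- (z \<bullet> (- \<eta>))) * \<phi> z)"
        by (simp only: ac_simps)
    qed
    also have "\<dots> = cis (- (x \<bullet> (\<xi> + \<eta>))) * f x * fourier_integral \<phi> (- \<eta>)"
      unfolding fourier_integral_def by (rule integral_mult_right_zero)
    finally show "(LINT y|lborel. ?a x y * (\<phi> (x - y) * f x)) =
        cis (- (x \<bullet> (\<xi> + \<eta>))) * f x * fourier_integral \<phi> (- \<eta>)" .
  qed
  also have "\<dots> = fourier_integral f (\<xi> + \<eta>) * fourier_integral \<phi> (- \<eta>)"
    unfolding fourier_integral_def by (rule integral_mult_left_zero)
  finally show ?thesis .
qed

lemma window_Plancherel: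
  assumes \<phi>: "integrable lborel \<phi>" "\<And>x. cmod (\<phi> x) \<le> B" and f: "integrable lborel f"
  shows "ennreal ((2 * pi)\<^sup>2) * (\<integral>\<^sup>+y. ennreal ((cmod (fourier_integral (\<lambda>x. \<phi> (x - y) * f x) \<xi>))\<^sup>2) \<partial>lborel) =
    (\<integral>\<^sup>+\<zeta>. ennreal ((cmod (fourier_integral f \<zeta>))\<^sup>2 * (cmod (fourier_integral \<phi> (\<xi> - \<zeta>)))\<^sup>2) \<partial>lborel)"
proof -
  note [measurable] = borel_measurable_integrable[OF \<phi>(1)] borel_measurable_integrable[OF f]
  let ?H = "\<lambda>y. fourier_integral (\<lambda>x. \<phi> (x - y) * f x) \<xi>"
  have H1: "integrable lborel ?H" by (rule window_fourier_integrable[OF \<phi>(1) f])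
  have H2: "?H \<in> L2"
    by (rule L2_bounded_L1[OF H1 window_fourier_bound[OF _ \<phi>(2) f]]) measurable
  have "ennreal ((2 * pi)\<^sup>2) * (\<integral>\<^sup>+y. ennreal ((cmod (?H y))\<^sup>2) \<partial>lborel) =
      ennreal ((L2_norm (fourier_integral ?H))\<^sup>2)"
    by (simp add: L2_nn_integral[OF H2] Plancherel(2)[OF H1 H2] power_mult_distrib ennreal_mult)
  also have "\<dots> = (\<integral>\<^sup>+\<eta>. ennreal ((cmod (fourier_integral ?H \<eta>))\<^sup>2) \<partial>lborel)"
    by (rule L2_nn_integral[OF Plancherel(1)[OF H1 H2], symmetric])
  also have "\<dots> = (\<integral>\<^sup>+\<eta>. ennreal ((cmod (fourier_integral f (\<eta> + \<xi>)))\<^sup>2 *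
      (cmod (fourier_integral \<phi> (\<xi> - (\<eta> + \<xi>))))\<^sup>2) \<partial>lborel)"
    by (simp add: window_fourier_transform[OF \<phi>(1) f] norm_mult power_mult_distrib add.commute)
  also have "\<dots> = (\<integral>\<^sup>+\<zeta>. ennreal ((cmod (fourier_integral f \<zeta>))\<^sup>2 * (cmod (fourier_integral \<phi> (\<xi> - \<zeta>)))\<^sup>2) \<partial>lborel)"
    by (rule nn_integral_plane_shift[where f = "\<lambda>\<zeta>. ennreal ((cmod (fourier_integral f \<zeta>))\<^sup>2 *
        (cmod (fourier_integral \<phi> (\<xi> - \<zeta>)))\<^sup>2)"]) measurable
  finally show ?thesis .
qed

text \<open>Summation over the positions of the window replaces the weight \<open>W\<close> by its mean around each frequency,
  taken against \<open>|\<phi>\<^sup>^|\<^sup>2\<close>.\<close>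

lemma window_average:
  fixes W :: "plane \<Rightarrow> ennreal"
  assumes \<phi>: "integrable lborel \<phi>" "\<And>x. cmod (\<phi> x) \<le> B" and f: "integrable lborel f"
    and [measurable]: "W \<in> borel_measurable borel"
  shows "ennreal ((2 * pi)\<^sup>2) * (\<integral>\<^sup>+y. \<integral>\<^sup>+\<xi>. W \<xi> *
      ennreal ((cmod (fourier_integral (\<lambda>x. \<phi> (x - y) * f x) \<xi>))\<^sup>2) \<partial>lborel \<partial>lborel) =
    (\<integral>\<^sup>+\<zeta>. ennreal ((cmod (fourier_integral f \<zeta>))\<^sup>2) *
      (\<integral>\<^sup>+\<kappa>. W (\<zeta> + \<kappa>) * ennreal ((cmod (fourier_integral \<phi> \<kappa>))\<^sup>2) \<partial>lborel) \<partial>lborel)"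
proof -
  note [measurable] = borel_measurable_integrable[OF \<phi>(1)] borel_measurable_integrable[OF f]
  let ?f = "\<lambda>\<zeta>. ennreal ((cmod (fourier_integral f \<zeta>))\<^sup>2)"
  let ?\<phi> = "\<lambda>\<zeta>. ennreal ((cmod (fourier_integral \<phi> \<zeta>))\<^sup>2)"
  let ?H = "\<lambda>y \<xi>. ennreal ((cmod (fourier_integral (\<lambda>x. \<phi> (x - y) * f x) \<xi>))\<^sup>2)"
  have [measurable]: "(\<lambda>(y, \<xi>). ?H y \<xi>) \<in> borel_measurable (lborel \<Otimes>\<^sub>M lborel)"
    unfolding fourier_integral_def by measurable
  have swap: "(\<integral>\<^sup>+y. \<integral>\<^sup>+\<xi>. W \<xi> * ?H y \<xi> \<partial>lborel \<partial>lborel) = (\<integral>\<^sup>+\<xi>. \<integral>\<^sup>+y. W \<xi> * ?H y \<xi> \<partial>lborel \<partial>lborel)"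
    by (rule lborel_pair.Fubini'[symmetric]) measurable
  have "(\<integral>\<^sup>+\<xi>. \<integral>\<^sup>+y. W \<xi> * ?H y \<xi> \<partial>lborel \<partial>lborel) = (\<integral>\<^sup>+\<xi>. W \<xi> * (\<integral>\<^sup>+y. ?H y \<xi> \<partial>lborel) \<partial>lborel)"
    by (intro nn_integral_cong nn_integral_cmult) measurable
  then have "ennreal ((2 * pi)\<^sup>2) * (\<integral>\<^sup>+y. \<integral>\<^sup>+\<xi>. W \<xi> * ?H y \<xi> \<partial>lborel \<partial>lborel) =
      ennreal ((2 * pi)\<^sup>2) * (\<integral>\<^sup>+\<xi>. W \<xi> * (\<integral>\<^sup>+y. ?H y \<xi> \<partial>lborel) \<partial>lborel)"
    by (simp only: swap)
  also have "\<dots> =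
      (\<integral>\<^sup>+\<xi>. ennreal ((2 * pi)\<^sup>2) * (W \<xi> * (\<integral>\<^sup>+y. ?H y \<xi> \<partial>lborel)) \<partial>lborel)"
    by (rule nn_integral_cmult[symmetric]) measurable
  also have "\<dots> = (\<integral>\<^sup>+\<xi>. W \<xi> * (ennreal ((2 * pi)\<^sup>2) * (\<integral>\<^sup>+y. ?H y \<xi> \<partial>lborel)) \<partial>lborel)"
    by (simp only: mult.left_commute)
  also have "\<dots> = (\<integral>\<^sup>+\<xi>. W \<xi> * (\<integral>\<^sup>+\<zeta>. ?f \<zeta> * ?\<phi> (\<xi> - \<zeta>) \<partial>lborel) \<partial>lborel)"
    by (simp only: window_Plancherel[OF \<phi> f]) (simp add: ennreal_mult)
  also have "\<dots> = (\<integral>\<^sup>+\<xi>. \<integral>\<^sup>+\<zeta>. W \<xi> * (?f \<zeta> * ?\<phi> (\<xi> - \<zeta>)) \<partial>lborel \<partial>lborel)"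
    by (intro nn_integral_cong nn_integral_cmult[symmetric]) measurable
  also have "\<dots> = (\<integral>\<^sup>+\<zeta>. \<integral>\<^sup>+\<xi>. W \<xi> * (?f \<zeta> * ?\<phi> (\<xi> - \<zeta>)) \<partial>lborel \<partial>lborel)"
    by (rule lborel_pair.Fubini') measurable
  also have "\<dots> = (\<integral>\<^sup>+\<zeta>. ?f \<zeta> * (\<integral>\<^sup>+\<kappa>. W (\<zeta> + \<kappa>) * ?\<phi> \<kappa> \<partial>lborel) \<partial>lborel)"
  proof (intro nn_integral_cong)
    fix \<zeta> :: plane
    have "(\<integral>\<^sup>+\<xi>. W \<xi> * (?f \<zeta> * ?\<phi> (\<xi> - \<zeta>)) \<partial>lborel) = (\<integral>\<^sup>+\<kappa>. W (\<kappa> + \<zeta>) * (?f \<zeta> * ?\<phi> (\<kappa> + \<zeta> - \<zeta>)) \<partial>lborel)"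
      by (rule nn_integral_plane_shift[symmetric]) measurable
    also have "\<dots> = (\<integral>\<^sup>+\<kappa>. ?f \<zeta> * (W (\<zeta> + \<kappa>) * ?\<phi> \<kappa>) \<partial>lborel)"
      by (simp add: ac_simps)
    also have "\<dots> = ?f \<zeta> * (\<integral>\<^sup>+\<kappa>. W (\<zeta> + \<kappa>) * ?\<phi> \<kappa> \<partial>lborel)"
      by (rule nn_integral_cmult) measurable
    finally show "(\<integral>\<^sup>+\<xi>. W \<xi> * (?f \<zeta> * ?\<phi> (\<xi> - \<zeta>)) \<partial>lborel) = ?f \<zeta> * (\<integral>\<^sup>+\<kappa>. W (\<zeta> + \<kappa>) * ?\<phi> \<kappa> \<partial>lborel)" .
  qed
  finally show ?thesis .
qed

lemma window_mass:
  fixes k F :: "plane \<Rightarrow> ennreal"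
  assumes [measurable]: "k \<in> borel_measurable borel" "F \<in> borel_measurable borel" and s: "s > 0"
  shows "(\<integral>\<^sup>+y. \<integral>\<^sup>+x. k ((x - y) /\<^sub>R s) * F x \<partial>lborel \<partial>lborel) =
    ennreal (s\<^sup>2) * (\<integral>\<^sup>+x. k x \<partial>lborel) * (\<integral>\<^sup>+x. F x \<partial>lborel)"
proof -
  have "(\<integral>\<^sup>+y. \<integral>\<^sup>+x. k ((x - y) /\<^sub>R s) * F x \<partial>lborel \<partial>lborel) =
      (\<integral>\<^sup>+x. \<integral>\<^sup>+y. k ((x - y) /\<^sub>R s) * F x \<partial>lborel \<partial>lborel)"
    by (rule lborel_pair.Fubini'[symmetric]) measurable
  also have "\<dots> = (\<integral>\<^sup>+x. ennreal (s\<^sup>2) * (\<integral>\<^sup>+x. k x \<partial>lborel) * F x \<partial>lborel)"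
  proof (intro nn_integral_cong)
    fix x :: plane
    have "(\<integral>\<^sup>+y. k ((x - y) /\<^sub>R s) \<partial>lborel) = ennreal ((- s)\<^sup>2) * (\<integral>\<^sup>+z. k ((x - (x + (- s) *\<^sub>R z)) /\<^sub>R s) \<partial>lborel)"
      using s by (intro nn_integral_plane_affine) auto
    then show "(\<integral>\<^sup>+y. k ((x - y) /\<^sub>R s) * F x \<partial>lborel) = ennreal (s\<^sup>2) * (\<integral>\<^sup>+x. k x \<partial>lborel) * F x"
      using s by (simp add: nn_integral_multc)
  qed
  also have "\<dots> = ennreal (s\<^sup>2) * (\<integral>\<^sup>+x. k x \<partial>lborel) * (\<integral>\<^sup>+x. F x \<partial>lborel)"
    by (rule nn_integral_cmult) measurable
  finally show ?thesis .
qed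

subsection \<open>The multiplier away from the origin\<close>

lemma multiplier_unit: "multiplier z = ((z /\<^sub>R norm z) $ 1)\<^sup>2"
proof -
  have "(norm z)\<^sup>2 = (z $ 1)\<^sup>2 + (z $ 2)\<^sup>2"
    unfolding power2_norm_eq_inner by (simp add: inner_vec_def sum_2 power2_eq_square)
  then show ?thesis
    unfolding multiplier_def by (simp add: power_mult_distrib divide_inverse power_inverse mult.commute)
qed

text \<open>The multiplier at \<open>z\<close> is the square of the first coordinate of \<open>z / |z|\<close>, and moving \<open>z\<close> by \<open>k\<close> moves
  the direction \<open>z / |z|\<close> by at most \<open>2 |k| / |z|\<close>.\<close>

lemma multiplier_diff:
  assumes "z \<noteq> 0"
  shows "multiplier z \<le> multiplier (z + k) + 4 * norm k / norm z"
proof (cases "z + k = 0")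
  case True
  then have "norm k = norm z" by (metis add_eq_0_iff norm_minus_cancel)
  with assms multiplier_bounds[of z] multiplier_bounds[of "z + k"] show ?thesis by simp
next
  case False
  let ?u = "z /\<^sub>R norm z" and ?v = "(z + k) /\<^sub>R norm (z + k)"
  have nu: "norm ?u = 1" "norm ?v = 1" using assms False by auto
  have "norm (?u - ?v) \<le> norm (k /\<^sub>R norm z) + norm ((1 / norm z - 1 / norm (z + k)) *\<^sub>R (z + k))"
  proof -
    have "?u - ?v = (1 / norm z - 1 / norm (z + k)) *\<^sub>R (z + k) - k /\<^sub>R norm z"
      by (simp add: algebra_simps divide_inverse)
    then show ?thesis using norm_triangle_ineq4[of "(1 / norm z - 1 / norm (z + k)) *\<^sub>R (z + k)" "k /\<^sub>R norm z"]
      by simp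
  qed
  also have "norm ((1 / norm z - 1 / norm (z + k)) *\<^sub>R (z + k)) = \<bar>norm (z + k) - norm z\<bar> / norm z"
  proof -
    have "1 / norm z - 1 / norm (z + k) = (norm (z + k) - norm z) / (norm z * norm (z + k))"
      using assms False by (simp add: field_simps)
    then show ?thesis using assms False by (simp add: abs_mult)
  qed
  also have "\<dots> \<le> norm k / norm z"
    using norm_triangle_ineq3[of "z + k" z] by (intro divide_right_mono) auto
  also have "norm (k /\<^sub>R norm z) = norm k / norm z" by (simp add: divide_inverse mult.commute)
  finally have uv: "norm (?u - ?v) \<le> 2 * norm k / norm z" by simp
  have "\<bar>(?u - ?v) $ 1\<bar> \<le> norm (?u - ?v)" by (rule component_le_norm_cart)
  moreover have "\<bar>(?u + ?v) $ 1\<bar> \<le> 2"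
    using component_le_norm_cart[of "?u + ?v" 1] norm_triangle_ineq[of ?u ?v] nu by linarith
  moreover have "multiplier z - multiplier (z + k) = (?u - ?v) $ 1 * (?u + ?v) $ 1"
    unfolding multiplier_unit by (simp add: power2_eq_square algebra_simps)
  ultimately have "\<bar>multiplier z - multiplier (z + k)\<bar> \<le> norm (?u - ?v) * 2"
    by (simp only: abs_mult) (intro mult_mono, auto)
  with uv show ?thesis by simp
qed

section \<open>A localised interpolation inequality\<close>

lemma L2_norm_sq_add_le:
  assumes "f \<in> L2" "g \<in> L2" "e > 0"
  shows "(L2_norm (\<lambda>x. f x + g x))\<^sup>2 \<le> (1 + e) * (L2_norm f)\<^sup>2 + (1 + 1 / e) * (L2_norm g)\<^sup>2"
proof -
  let ?a = "L2_norm f" and ?b = "L2_norm g"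
  have "(L2_norm (\<lambda>x. f x + g x))\<^sup>2 \<le> (?a + ?b)\<^sup>2"
    by (intro power_mono L2_norm_triangle assms) simp
  also have "\<dots> \<le> (1 + e) * ?a\<^sup>2 + (1 + 1 / e) * ?b\<^sup>2"
  proof -
    have "0 \<le> (e * ?a - ?b)\<^sup>2 / e" using assms(3) by simp
    also have "\<dots> = e * ?a\<^sup>2 - 2 * ?a * ?b + ?b\<^sup>2 / e"
      using assms(3) by (simp add: power2_diff field_simps power2_eq_square)
    finally show ?thesis using assms(3) by (simp add: power2_sum field_simps)
  qed
  finally show ?thesis .
qed

lemma fourier_dilate:
  assumes "f \<in> borel_measurable borel" "s > 0"
  shows "fourier_integral (\<lambda>x. f (x /\<^sub>R s)) \<xi> = complex_of_real (s\<^sup>2) * fourier_integral f (s *\<^sub>R \<xi>)"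
proof -
  note [measurable] = assms(1)
  have "fourier_integral f (s *\<^sub>R \<xi>) =
      (LINT x|lborel. cis (- (x \<bullet> (s *\<^sub>R \<xi>))) * f x)" by (simp add: fourier_integral_def)
  moreover have "(LINT x|lborel. cis (- ((0 + (1 / s) *\<^sub>R x) \<bullet> (s *\<^sub>R \<xi>))) * f (0 + (1 / s) *\<^sub>R x)) =
      (LINT x|lborel. cis (- (x \<bullet> (s *\<^sub>R \<xi>))) * f x) /\<^sub>R (1 / s)\<^sup>2"
    using assms(2) by (intro integral_plane_affine) auto
  moreover have "(LINT x|lborel. cis (- ((0 + (1 / s) *\<^sub>R x) \<bullet> (s *\<^sub>R \<xi>))) * f (0 + (1 / s) *\<^sub>R x)) =
      fourier_integral (\<lambda>x. f (x /\<^sub>R s)) \<xi>"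
  proof -
    have "((1 / s) *\<^sub>R x) \<bullet> (s *\<^sub>R \<xi>) = x \<bullet> \<xi>" for x :: plane
      using assms(2) by simp
    then show ?thesis by (simp only: fourier_integral_def add_0_left inverse_eq_divide)
  qed
  ultimately show ?thesis using assms(2) by (simp add: scaleR_conv_of_real power_divide)
qed

text \<open>The profile of the windows. The windows themselves arise by dilation with \<open>s\<close> and translation
  to the centre \<open>y\<close>.\<close>

locale window =
  fixes \<eta> :: "plane \<Rightarrow> real"
  assumes test: "test_function (\<lambda>x. complex_of_real (\<eta> x))"
    and nonneg: "0 \<le> \<eta> x" and le_1: "\<eta> x \<le> 1"
    and outside: "x \<notin> cball 0 1 \<Longrightarrow> \<eta> x = 0"
begin

definition N2 :: real where "N2 = (LINT x|lborel. (\<eta> x)\<^sup>2)"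
definition N4 :: real where "N4 = (LINT x|lborel. (\<eta> x) ^ 4)"
definition D :: real where
  "D = (\<Sum>j\<in>UNIV. (L2_norm (partial_deriv j (\<lambda>x. complex_of_real (\<eta> x))))\<^sup>2)"

definition sq :: fld where "sq x = complex_of_real ((\<eta> x)\<^sup>2)"

text \<open>A bound for the error made by averaging the multiplier against the spectrum of \<open>\<eta>\<^sup>2\<close> around a frequency
  of modulus \<open>r\<close>: the integrand is the bound of \<open>multiplier_diff\<close>, cut off at the trivial bound \<open>1\<close>.\<close>

definition tail :: "real \<Rightarrow> real" where
  "tail r = (LINT \<kappa>|lborel. (cmod (fourier_integral sq \<kappa>))\<^sup>2 * min 1 (4 * norm \<kappa> / r))"

definition win :: "real \<Rightarrow> plane \<Rightarrow> plane \<Rightarrow> real" where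
  "win s y x = \<eta> ((x - y) /\<^sub>R s)"

lemma eta_measurable [measurable]: "\<eta> \<in> borel_measurable borel"
proof -
  have "(\<lambda>x. Re (complex_of_real (\<eta> x))) \<in> borel_measurable borel"
    using test_function_bounded_measurable(1)[OF test] by measurable
  then show ?thesis by simp
qed

lemma eta_power_integrable: "k > 0 \<Longrightarrow> integrable lborel (\<lambda>x. (\<eta> x) ^ k)"
proof (rule Bochner_Integration.integrable_bound)
  show "integrable lborel (indicator (cball 0 1) :: plane \<Rightarrow> real)"
    by (intro integrable_real_indicator emeasure_lborel_cball_finite) simp
  assume k: "k > 0"
  have "(\<eta> x) ^ k \<le> indicator (cball 0 1) x" for x
    using le_1[of x] nonneg[of x] outside[of x] k
    by (cases "x \<in> cball (0::plane) 1") (auto simp: power_le_one zero_power)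
  then show "AE x in lborel. norm ((\<eta> x) ^ k) \<le> norm (indicator (cball 0 1) x :: real)"
    using nonneg by auto
qed measurable

lemma sq_measurable [measurable]: "sq \<in> borel_measurable borel"
  unfolding sq_def[abs_def] by measurable

lemma sq_integrable: "integrable lborel sq"
  unfolding sq_def[abs_def] by (intro integrable_of_real eta_power_integrable) simp

lemma sq_bound: "cmod (sq x) \<le> 1"
  using nonneg[of x] le_1[of x] by (simp add: sq_def norm_power power_le_one)

lemma sq_L2: "sq \<in> L2" "(L2_norm sq)\<^sup>2 = N4"
proof -
  show "sq \<in> L2" by (rule L2_bounded_L1[OF sq_integrable sq_bound])
  show "(L2_norm sq)\<^sup>2 = N4"
    by (simp add: L2_norm_sq sq_def N4_def norm_power flip: power_mult)
qed

lemma sq_fourier_L2: "fourier_integral sq \<in> L2" "(L2_norm (fourier_integral sq))\<^sup>2 = (2 * pi)\<^sup>2 * N4"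
  using Plancherel[OF sq_integrable sq_L2(1)] sq_L2(2) by (auto simp: power_mult_distrib)

lemma N_nonneg: "0 \<le> N2" "0 \<le> N4" "0 \<le> D"
  unfolding N2_def N4_def D_def by (auto intro: sum_nonneg)

lemma tail_integrable:
  "r > 0 \<Longrightarrow> integrable lborel (\<lambda>\<kappa>. (cmod (fourier_integral sq \<kappa>))\<^sup>2 * min 1 (4 * norm \<kappa> / r))"
proof (rule Bochner_Integration.integrable_bound[OF L2_integrable[OF sq_fourier_L2(1)]])
  assume "r > 0"
  then show "AE \<kappa> in lborel. norm ((cmod (fourier_integral sq \<kappa>))\<^sup>2 * min 1 (4 * norm \<kappa> / r))
      \<le> norm ((cmod (fourier_integral sq \<kappa>))\<^sup>2)"
    by (auto simp: abs_mult intro!: mult_left_le)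
qed measurable

lemma tail_tendsto: "(tail \<longlongrightarrow> 0) at_top"
proof -
  have "((\<lambda>r. LINT \<kappa>|lborel. (cmod (fourier_integral sq \<kappa>))\<^sup>2 * min 1 (4 * norm \<kappa> / r)) \<longlongrightarrow>
      (LINT (\<kappa>::plane)|lborel. (0::real))) at_top"
  proof (rule integral_dominated_convergence_at_top)
    show "integrable lborel (\<lambda>\<kappa>. (cmod (fourier_integral sq \<kappa>))\<^sup>2)"
      by (rule L2_integrable[OF sq_fourier_L2(1)])
    have "((\<lambda>r. (cmod (fourier_integral sq \<kappa>))\<^sup>2 * min 1 (4 * norm \<kappa> / r)) \<longlongrightarrow>
        (cmod (fourier_integral sq \<kappa>))\<^sup>2 * min 1 0) at_top" for \<kappa>
      by (intro tendsto_mult tendsto_min tendsto_const tendsto_divide_0[OF tendsto_const]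
          filterlim_at_top_imp_at_infinity filterlim_ident)
    then show "AE \<kappa> in lborel. ((\<lambda>r. (cmod (fourier_integral sq \<kappa>))\<^sup>2 * min 1 (4 * norm \<kappa> / r)) \<longlongrightarrow> 0) at_top"
      by simp
    show "eventually (\<lambda>r. AE \<kappa> in lborel. norm ((cmod (fourier_integral sq \<kappa>))\<^sup>2 * min 1 (4 * norm \<kappa> / r))
        \<le> (cmod (fourier_integral sq \<kappa>))\<^sup>2) at_top"
      using eventually_gt_at_top[of "0::real"]
      by eventually_elim (auto simp: abs_mult intro!: mult_left_le)
  qed measurable
  then show ?thesis unfolding tail_def[abs_def] by simp
qed

lemma win_affine: "win s y x = \<eta> (- (y /\<^sub>R s) + (1 / s) *\<^sub>R x)"
  by (simp add: win_def algebra_simps divide_inverse)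

lemma win_outside: "s > 0 \<Longrightarrow> x \<notin> cball y s \<Longrightarrow> win s y x = 0"
proof -
  assume s: "s > 0" and "x \<notin> cball y s"
  then have "1 < norm (x - y) / s" by (simp add: dist_norm norm_minus_commute)
  also have "norm (x - y) / s = norm ((x - y) /\<^sub>R s)"
    using s by (simp add: divide_inverse mult.commute del: scaleR_right_diff_distrib)
  finally show ?thesis unfolding win_def by (intro outside) simp
qed

lemma win_bounds: "0 \<le> win s y x" "win s y x \<le> 1"
  by (simp_all add: win_def nonneg le_1)

lemma win_test:
  assumes "s > 0" shows "test_function (\<lambda>x. complex_of_real (win s y x))"
  unfolding test_function_def
proof (intro conjI allI exI[of _ "cball y s"] impI)
  show "Ck k (\<lambda>x. complex_of_real (win s y x))" for k
    unfolding win_affine using test Ck_affine unfolding test_function_def by blast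
qed (use win_outside[OF assms] in auto)

lemma win_partial:
  "partial_deriv j (\<lambda>x. complex_of_real (win s y x)) x =
    complex_of_real (1 / s) * partial_deriv j (\<lambda>x. complex_of_real (\<eta> x)) ((x - y) /\<^sub>R s)"
proof -
  have "(x - y) /\<^sub>R s = - (y /\<^sub>R s) + (1 / s) *\<^sub>R x" by (simp add: algebra_simps divide_inverse)
  then show ?thesis
    unfolding win_affine
    using partial_deriv_affine[OF test_function_diff[OF test], of j "- (y /\<^sub>R s)" "1 / s" x] by simp
qed

definition cut :: "real \<Rightarrow> plane \<Rightarrow> fld \<Rightarrow> fld" where
  "cut s y w = (\<lambda>x. complex_of_real (win s y x) * w x)"

lemma win_measurable [measurable]: "win s y \<in> borel_measurable borel"
  unfolding win_def by measurable

lemma cut_L2: "w \<in> L2 \<Longrightarrow> cut s y w \<in> L2"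
proof (rule L2_bound[where c = 1])
  assume w: "w \<in> L2"
  note [measurable] = L2_measurable[OF w]
  show "cut s y w \<in> borel_measurable borel" unfolding cut_def by measurable
  show "cmod (cut s y w x) \<le> 1 * cmod (w x)" for x
    using win_bounds[of s y x] by (simp add: cut_def norm_mult mult_left_le_one_le)
qed

lemma cut_weak_deriv:
  assumes "w \<in> H1" "s > 0"
  shows "is_weak_deriv j (cut s y w) (\<lambda>x. complex_of_real (win s y x) * weak_deriv j w x +
      partial_deriv j (\<lambda>x. complex_of_real (win s y x)) x * w x)"
  unfolding cut_def by (intro is_weak_deriv_mult H1_L2 H1_weak_deriv win_test assms)

lemma cut_H1: "w \<in> H1 \<Longrightarrow> s > 0 \<Longrightarrow> cut s y w \<in> H1"
  using cut_weak_deriv cut_L2 H1_L2 unfolding H1_def by blast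

lemma cut_density: "density (cut s y w) = (\<lambda>x. sq ((x - y) /\<^sub>R s) * density w x)"
  using nonneg by (simp add: density_def cut_def sq_def win_def norm_mult power_mult_distrib fun_eq_iff)

lemma cut_density_L2: "density w \<in> L2 \<Longrightarrow> density (cut s y w) \<in> L2"
proof (rule L2_bound[where c = 1])
  assume w: "density w \<in> L2"
  note [measurable] = L2_measurable[OF w]
  show "density (cut s y w) \<in> borel_measurable borel" unfolding cut_density by measurable
  show "cmod (density (cut s y w) x) \<le> 1 * cmod (density w x)" for x
    unfolding cut_density norm_mult by (intro mult_right_mono sq_bound) simp
qed

lemma cut_mass:
  assumes w: "w \<in> L2" and s: "s > 0"
  shows "(L2_norm (cut s y w))\<^sup>2 \<le> (LINT x:cball y s|lborel. (cmod (w x))\<^sup>2)"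
  unfolding L2_norm_sq set_lebesgue_integral_def
proof (rule integral_mono)
  show "integrable lborel (\<lambda>x. (cmod (cut s y w x))\<^sup>2)" by (intro L2_integrable cut_L2 w)
  show "integrable lborel (\<lambda>x. indicat_real (cball y s) x *\<^sub>R (cmod (w x))\<^sup>2)"
    using L2_integrable[OF w] by (intro integrable_mult_indicator) auto
  show "(cmod (cut s y w x))\<^sup>2 \<le> indicat_real (cball y s) x *\<^sub>R (cmod (w x))\<^sup>2" for x
  proof (cases "x \<in> cball y s")
    case True
    have "cmod (cut s y w x) \<le> cmod (w x)"
      using win_bounds[of s y x] by (simp add: cut_def norm_mult mult_left_le_one_le)
    with True show ?thesis by simp
  next
    case False
    with win_outside[OF s False] show ?thesis by (simp add: cut_def)
  qed
qed

subsection \<open>The upper bound: kinetic energy of the windows\<close>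

text \<open>Young's inequality with weight \<open>e\<close> splits the product rule. The gradient of the window
  contributes \<open>s\<^sup>-\<^sup>2 |\<nabla>\<eta>|\<^sup>2\<close>, and in two dimensions the area \<open>s\<^sup>2\<close> from the integration over \<open>y\<close> cancels the
  power of \<open>s\<close>. The factor \<open>c\<close> stands under the integral because the gradient norm is not known to be measurable
  in \<open>y\<close>.\<close>

lemma cut_grad_average:
  assumes w: "w \<in> H1" and s: "s > 0" and e: "e > 0" and c: "c \<ge> 0"
  shows "(\<integral>\<^sup>+y. ennreal (c * (grad_norm (cut s y w))\<^sup>2) \<partial>lborel) \<le>
    ennreal (c * ((1 + e) * s\<^sup>2 * N2 * (grad_norm w)\<^sup>2 + (1 + 1 / e) * D * (L2_norm w)\<^sup>2))"
proof -
  define d where "d j = partial_deriv j (\<lambda>x. complex_of_real (\<eta> x))" for j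
  have d: "d j \<in> L2" for j
    unfolding d_def by (intro test_function_bounded_measurable(3) test_function_partial test)
  note wL2 = H1_L2[OF w] and wd = weak_deriv_L2[OF w]
  note [measurable] = L2_measurable[OF d] L2_measurable[OF wL2] L2_measurable[OF wd]
  define k1 where "k1 z = ennreal ((\<eta> z)\<^sup>2)" for z
  define k2 where "k2 j z = ennreal ((cmod (d j z))\<^sup>2)" for j z
  define F1 where "F1 j x = ennreal ((cmod (weak_deriv j w x))\<^sup>2)" for j x
  define F2 where "F2 x = ennreal ((cmod (w x))\<^sup>2)" for x
  have [measurable]: "k1 \<in> borel_measurable borel" "k2 j \<in> borel_measurable borel"
    "F1 j \<in> borel_measurable borel" "F2 \<in> borel_measurable borel" for j
    unfolding k1_def k2_def F1_def F2_def by measurable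
  define A where "A j y = (\<integral>\<^sup>+x. k1 ((x - y) /\<^sub>R s) * F1 j x \<partial>lborel)" for j y
  define B where "B j y = (\<integral>\<^sup>+x. k2 j ((x - y) /\<^sub>R s) * F2 x \<partial>lborel)" for j y
  have [measurable]: "A j \<in> borel_measurable borel" "B j \<in> borel_measurable borel" for j
    unfolding A_def B_def by measurable
  have point: "ennreal ((grad_norm (cut s y w))\<^sup>2) \<le>
      (\<Sum>j\<in>UNIV. ennreal (1 + e) * A j y + ennreal ((1 + 1 / e) / s\<^sup>2) * B j y)" for y
  proof -
    let ?f = "\<lambda>j x. complex_of_real (win s y x) * weak_deriv j w x"
    let ?g = "\<lambda>j x. partial_deriv j (\<lambda>x. complex_of_real (win s y x)) x * w x"
    have fL2: "?f j \<in> L2" for j using cut_L2[OF wd, of s y] by (simp add: cut_def)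
    have "(\<lambda>x. (?f j x + ?g j x) - ?f j x) \<in> L2" for j
      using cut_weak_deriv[OF w s, of j y] by (intro L2_diff fL2) (simp add: is_weak_deriv_def)
    then have gL2: "?g j \<in> L2" for j by simp
    have fA: "ennreal ((L2_norm (?f j))\<^sup>2) = A j y" for j
      unfolding L2_nn_integral[OF fL2, symmetric] A_def k1_def F1_def
      by (simp add: win_def norm_mult power_mult_distrib ennreal_mult)
    have gB: "ennreal ((L2_norm (?g j))\<^sup>2) = ennreal (1 / s\<^sup>2) * B j y" for j
    proof -
      have "B j y * ennreal (1 / s\<^sup>2) = (\<integral>\<^sup>+x. k2 j ((x - y) /\<^sub>R s) * F2 x * ennreal (1 / s\<^sup>2) \<partial>lborel)"
        unfolding B_def by (rule nn_integral_multc[symmetric]) measurable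
      also have "\<dots> = (\<integral>\<^sup>+x. ennreal ((cmod (?g j x))\<^sup>2) \<partial>lborel)"
        unfolding k2_def F2_def win_partial d_def
        using s by (intro nn_integral_cong)
          (simp add: norm_mult power_mult_distrib norm_divide power_divide ac_simps flip: ennreal_mult)
      finally show ?thesis unfolding L2_nn_integral[OF gL2] by (simp add: mult.commute)
    qed
    have "(grad_norm (cut s y w))\<^sup>2 = (\<Sum>j\<in>UNIV. (L2_norm (\<lambda>x. ?f j x + ?g j x))\<^sup>2)"
      by (intro grad_norm_sq_eq cut_weak_deriv w s)
    also have "\<dots> \<le> (\<Sum>j\<in>UNIV. (1 + e) * (L2_norm (?f j))\<^sup>2 + (1 + 1 / e) * (L2_norm (?g j))\<^sup>2)"
      by (intro sum_mono L2_norm_sq_add_le fL2 gL2 e)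
    finally have "ennreal ((grad_norm (cut s y w))\<^sup>2) \<le>
        ennreal (\<Sum>j\<in>UNIV. (1 + e) * (L2_norm (?f j))\<^sup>2 + (1 + 1 / e) * (L2_norm (?g j))\<^sup>2)"
      by (rule ennreal_leI)
    also have "\<dots> = (\<Sum>j\<in>UNIV. ennreal ((1 + e) * (L2_norm (?f j))\<^sup>2 + (1 + 1 / e) * (L2_norm (?g j))\<^sup>2))"
      using e by (intro sum_ennreal[symmetric]) auto
    also have "\<dots> = (\<Sum>j\<in>UNIV. ennreal (1 + e) * A j y + ennreal ((1 + 1 / e) / s\<^sup>2) * B j y)"
    proof (intro sum.cong refl)
      fix j :: 2
      have "ennreal ((1 + e) * (L2_norm (?f j))\<^sup>2 + (1 + 1 / e) * (L2_norm (?g j))\<^sup>2) =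
          ennreal (1 + e) * ennreal ((L2_norm (?f j))\<^sup>2) + ennreal (1 + 1 / e) * ennreal ((L2_norm (?g j))\<^sup>2)"
        using e by (simp add: ennreal_plus ennreal_mult del: ennreal_plus[symmetric])
      moreover have "ennreal (1 + 1 / e) * ennreal (1 / s\<^sup>2) = ennreal ((1 + 1 / e) / s\<^sup>2)"
        using e s by (subst ennreal_mult[symmetric]) auto
      ultimately show "ennreal ((1 + e) * (L2_norm (?f j))\<^sup>2 + (1 + 1 / e) * (L2_norm (?g j))\<^sup>2) =
          ennreal (1 + e) * A j y + ennreal ((1 + 1 / e) / s\<^sup>2) * B j y"
        unfolding fA gB by (simp flip: mult.assoc)
    qed
    finally show ?thesis .
  qed
  have intA: "(\<integral>\<^sup>+y. A j y \<partial>lborel) = ennreal (s\<^sup>2 * N2 * (L2_norm (weak_deriv j w))\<^sup>2)" for j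
  proof -
    have "(\<integral>\<^sup>+z. k1 z \<partial>lborel) = ennreal N2"
      unfolding k1_def N2_def by (intro nn_integral_eq_integral eta_power_integrable) auto
    moreover have "(\<integral>\<^sup>+x. F1 j x \<partial>lborel) = ennreal ((L2_norm (weak_deriv j w))\<^sup>2)"
      unfolding F1_def by (rule L2_nn_integral[OF wd])
    ultimately show ?thesis
      unfolding A_def using window_mass[of k1 "F1 j" s] s N_nonneg by (simp add: ennreal_mult)
  qed
  have intB: "(\<integral>\<^sup>+y. B j y \<partial>lborel) = ennreal (s\<^sup>2 * (L2_norm (d j))\<^sup>2 * (L2_norm w)\<^sup>2)" for j
  proof -
    have "(\<integral>\<^sup>+z. k2 j z \<partial>lborel) = ennreal ((L2_norm (d j))\<^sup>2)" "(\<integral>\<^sup>+x. F2 x \<partial>lborel) = ennreal ((L2_norm w)\<^sup>2)"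
      unfolding k2_def F2_def by (intro L2_nn_integral d wL2)+
    then show ?thesis
      unfolding B_def using window_mass[of "k2 j" F2 s] s by (simp add: ennreal_mult)
  qed
  have "(\<integral>\<^sup>+y. (\<Sum>j\<in>UNIV. ennreal (1 + e) * A j y + ennreal ((1 + 1 / e) / s\<^sup>2) * B j y) \<partial>lborel) = (\<Sum>j\<in>UNIV. ennreal (1 + e) * (\<integral>\<^sup>+y. A j y \<partial>lborel) + ennreal ((1 + 1 / e) / s\<^sup>2) * (\<integral>\<^sup>+y. B j y \<partial>lborel))"
    by (subst nn_integral_sum) (simp_all add: nn_integral_add nn_integral_cmult)
  also have "\<dots> = (\<Sum>j\<in>UNIV. ennreal ((1 + e) * s\<^sup>2 * N2 * (L2_norm (weak_deriv j w))\<^sup>2 +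
      (1 + 1 / e) * (L2_norm (d j))\<^sup>2 * (L2_norm w)\<^sup>2))"
  proof (intro sum.cong refl)
    fix j :: 2
    have "ennreal (1 + e) * (\<integral>\<^sup>+y. A j y \<partial>lborel) = ennreal ((1 + e) * s\<^sup>2 * N2 * (L2_norm (weak_deriv j w))\<^sup>2)"
      unfolding intA using e N_nonneg by (subst ennreal_mult[symmetric]) (auto simp: mult.assoc)
    moreover have "ennreal ((1 + 1 / e) / s\<^sup>2) * (\<integral>\<^sup>+y. B j y \<partial>lborel) = ennreal ((1 + 1 / e) * (L2_norm (d j))\<^sup>2 * (L2_norm w)\<^sup>2)"
      unfolding intB using e s by (subst ennreal_mult[symmetric]) (auto simp: field_simps)
    ultimately show "ennreal (1 + e) * (\<integral>\<^sup>+y. A j y \<partial>lborel) + ennreal ((1 + 1 / e) / s\<^sup>2) * (\<integral>\<^sup>+y. B j y \<partial>lborel) =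
        ennreal ((1 + e) * s\<^sup>2 * N2 * (L2_norm (weak_deriv j w))\<^sup>2 + (1 + 1 / e) * (L2_norm (d j))\<^sup>2 * (L2_norm w)\<^sup>2)"
      using e N_nonneg by (simp add: ennreal_plus del: ennreal_plus[symmetric])
  qed
  also have "\<dots> = ennreal (\<Sum>j\<in>UNIV. (1 + e) * s\<^sup>2 * N2 * (L2_norm (weak_deriv j w))\<^sup>2 +
      (1 + 1 / e) * (L2_norm (d j))\<^sup>2 * (L2_norm w)\<^sup>2)"
    using e N_nonneg by (intro sum_ennreal) (auto intro!: add_nonneg_nonneg mult_nonneg_nonneg)
  also have "(\<Sum>j\<in>UNIV. (1 + e) * s\<^sup>2 * N2 * (L2_norm (weak_deriv j w))\<^sup>2 + (1 + 1 / e) * (L2_norm (d j))\<^sup>2 * (L2_norm w)\<^sup>2) =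
      (1 + e) * s\<^sup>2 * N2 * (grad_norm w)\<^sup>2 + (1 + 1 / e) * D * (L2_norm w)\<^sup>2"
    unfolding grad_norm_sq D_def d_def
    by (simp add: sum.distrib sum_distrib_left sum_distrib_right)
  finally have total: "(\<integral>\<^sup>+y. (\<Sum>j\<in>UNIV. ennreal (1 + e) * A j y + ennreal ((1 + 1 / e) / s\<^sup>2) * B j y) \<partial>lborel) =
      ennreal ((1 + e) * s\<^sup>2 * N2 * (grad_norm w)\<^sup>2 + (1 + 1 / e) * D * (L2_norm w)\<^sup>2)" .
  have "(\<integral>\<^sup>+y. ennreal (c * (grad_norm (cut s y w))\<^sup>2) \<partial>lborel) \<le>
      (\<integral>\<^sup>+y. ennreal c * (\<Sum>j\<in>UNIV. ennreal (1 + e) * A j y + ennreal ((1 + 1 / e) / s\<^sup>2) * B j y) \<partial>lborel)"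
    using c by (intro nn_integral_mono) (simp only: ennreal_mult' mult_left_mono[OF point] zero_le)
  also have "\<dots> = ennreal c * (\<integral>\<^sup>+y. (\<Sum>j\<in>UNIV. ennreal (1 + e) * A j y + ennreal ((1 + 1 / e) / s\<^sup>2) * B j y) \<partial>lborel)"
    by (rule nn_integral_cmult) measurable
  also have "\<dots> = ennreal (c * ((1 + e) * s\<^sup>2 * N2 * (grad_norm w)\<^sup>2 + (1 + 1 / e) * D * (L2_norm w)\<^sup>2))"
    unfolding total using c by (rule ennreal_mult'[symmetric])
  finally show ?thesis .
qed

subsection \<open>The lower bound: interaction energy of the windows\<close>

text \<open>The case \<open>W = 1 + \<gamma> m\<close> of \<open>window_average\<close>; the dilation of the window has been moved into the
  argument of the multiplier.\<close>

lemma cut_interaction_average: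
  assumes w: "w \<in> L2" "density w \<in> L2" and g: "\<gamma> \<ge> 0" and s: "s > 0"
  shows "ennreal ((2 * pi) ^ 4 / s\<^sup>2) * (\<integral>\<^sup>+y. ennreal (quartic 1 \<gamma> (cut s y w)) \<partial>lborel) =
    (\<integral>\<^sup>+\<zeta>. ennreal ((cmod (fourier_integral (density w) \<zeta>))\<^sup>2) *
      (\<integral>\<^sup>+\<kappa>. ennreal (1 + \<gamma> * multiplier (\<zeta> + \<kappa> /\<^sub>R s)) * ennreal ((cmod (fourier_integral sq \<kappa>))\<^sup>2) \<partial>lborel) \<partial>lborel)"
proof -
  let ?W = "\<lambda>\<xi>. ennreal (1 + \<gamma> * multiplier \<xi>)"
  let ?f = "\<lambda>\<zeta>. ennreal ((cmod (fourier_integral (density w) \<zeta>))\<^sup>2)"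
  let ?q = "\<lambda>\<kappa>. ennreal ((cmod (fourier_integral sq \<kappa>))\<^sup>2)"
  let ?sq = "\<lambda>x. sq (x /\<^sub>R s)"
  note [measurable] = L2_measurable[OF w(2)]
  have sq_int: "integrable lborel ?sq"
    using integrable_plane_affine[of sq "1 / s" 0] sq_integrable s by (simp add: inverse_eq_divide)
  have inner: "(\<integral>\<^sup>+\<kappa>. ?W (\<zeta> + \<kappa>) * ennreal ((cmod (fourier_integral ?sq \<kappa>))\<^sup>2) \<partial>lborel) =
      ennreal (s\<^sup>2) * (\<integral>\<^sup>+\<kappa>. ?W (\<zeta> + \<kappa> /\<^sub>R s) * ?q \<kappa> \<partial>lborel)" for \<zeta>
  proof -
    have "(\<integral>\<^sup>+\<kappa>. ?W (\<zeta> + \<kappa>) * ennreal ((cmod (fourier_integral ?sq \<kappa>))\<^sup>2) \<partial>lborel) =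
        (\<integral>\<^sup>+\<kappa>. ?W (\<zeta> + \<kappa>) * (ennreal (s ^ 4) * ?q (s *\<^sub>R \<kappa>)) \<partial>lborel)"
      using s by (intro nn_integral_cong)
        (simp add: fourier_dilate norm_mult norm_power power_mult_distrib flip: ennreal_mult power_mult)
    also have "\<dots> = ennreal ((1 / s)\<^sup>2) * (\<integral>\<^sup>+\<kappa>. ?W (\<zeta> + (0 + (1 / s) *\<^sub>R \<kappa>)) *
        (ennreal (s ^ 4) * ?q (s *\<^sub>R (0 + (1 / s) *\<^sub>R \<kappa>))) \<partial>lborel)"
      using s by (intro nn_integral_plane_affine) auto
    also have "\<dots> = ennreal ((1 / s)\<^sup>2) * (\<integral>\<^sup>+\<kappa>. ennreal (s ^ 4) * (?W (\<zeta> + \<kappa> /\<^sub>R s) * ?q \<kappa>) \<partial>lborel)"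
      using s by (simp add: mult.left_commute inverse_eq_divide)
    also have "\<dots> = ennreal ((1 / s)\<^sup>2) * (ennreal (s ^ 4) * (\<integral>\<^sup>+\<kappa>. ?W (\<zeta> + \<kappa> /\<^sub>R s) * ?q \<kappa> \<partial>lborel))"
      by (subst nn_integral_cmult) measurable
    also have "\<dots> = ennreal (s\<^sup>2) * (\<integral>\<^sup>+\<kappa>. ?W (\<zeta> + \<kappa> /\<^sub>R s) * ?q \<kappa> \<partial>lborel)"
    proof -
      have "(1 / s)\<^sup>2 * s ^ 4 = s\<^sup>2" using s by (simp add: power_divide field_simps flip: power_add)
      then have "ennreal ((1 / s)\<^sup>2) * ennreal (s ^ 4) = ennreal (s\<^sup>2)" by (subst ennreal_mult[symmetric]) auto
      then show ?thesis by (simp only: mult.assoc[symmetric])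
    qed
    finally show ?thesis .
  qed
  have slice: "(\<integral>\<^sup>+\<xi>. ?W \<xi> * ennreal ((cmod (fourier_integral (\<lambda>x. ?sq (x - y) * density w x) \<xi>))\<^sup>2) \<partial>lborel) =
      ennreal ((2 * pi)\<^sup>2) * ennreal (quartic 1 \<gamma> (cut s y w))" for y
    using quartic_nn_integral(1)[OF cut_L2[OF w(1)] cut_density_L2[OF w(2)] g, of s y]
    unfolding cut_density by (simp add: ennreal_mult')
  then have "ennreal ((2 * pi)\<^sup>2) * (\<integral>\<^sup>+y. ennreal ((2 * pi)\<^sup>2) * ennreal (quartic 1 \<gamma> (cut s y w)) \<partial>lborel) =
      (\<integral>\<^sup>+\<zeta>. ?f \<zeta> * (\<integral>\<^sup>+\<kappa>. ?W (\<zeta> + \<kappa>) * ennreal ((cmod (fourier_integral ?sq \<kappa>))\<^sup>2) \<partial>lborel) \<partial>lborel)"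
    using window_average[OF sq_int sq_bound density_L1[OF w(1)], of ?W] by simp
  also have "\<dots> = (\<integral>\<^sup>+\<zeta>. ennreal (s\<^sup>2) * (?f \<zeta> * (\<integral>\<^sup>+\<kappa>. ?W (\<zeta> + \<kappa> /\<^sub>R s) * ?q \<kappa> \<partial>lborel)) \<partial>lborel)"
    unfolding inner by (simp only: mult.left_commute)
  also have "\<dots> = ennreal (s\<^sup>2) * (\<integral>\<^sup>+\<zeta>. ?f \<zeta> * (\<integral>\<^sup>+\<kappa>. ?W (\<zeta> + \<kappa> /\<^sub>R s) * ?q \<kappa> \<partial>lborel) \<partial>lborel)"
    by (rule nn_integral_cmult) measurable
  finally have eq: "ennreal ((2 * pi)\<^sup>2) * (\<integral>\<^sup>+y. ennreal ((2 * pi)\<^sup>2) * ennreal (quartic 1 \<gamma> (cut s y w)) \<partial>lborel) =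
      ennreal (s\<^sup>2) * (\<integral>\<^sup>+\<zeta>. ?f \<zeta> * (\<integral>\<^sup>+\<kappa>. ?W (\<zeta> + \<kappa> /\<^sub>R s) * ?q \<kappa> \<partial>lborel) \<partial>lborel)" .
  have [measurable]: "(\<lambda>y. ennreal (quartic 1 \<gamma> (cut s y w))) \<in> borel_measurable borel"
  proof -
    have "(\<lambda>y. ennreal (1 / (2 * pi)\<^sup>2) * (\<integral>\<^sup>+\<xi>. ?W \<xi> * ennreal ((cmod (fourier_integral (\<lambda>x. ?sq (x - y) * density w x) \<xi>))\<^sup>2) \<partial>lborel)) \<in> borel_measurable borel"
      unfolding fourier_integral_def by measurable
    moreover have "ennreal (1 / (2 * pi)\<^sup>2) * (ennreal ((2 * pi)\<^sup>2) * a) = a" for a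
      by (simp add: mult.assoc[symmetric] ennreal_mult[symmetric])
    ultimately show ?thesis
      unfolding slice by simp
  qed
  have "ennreal ((2 * pi) ^ 4 / s\<^sup>2) * (\<integral>\<^sup>+y. ennreal (quartic 1 \<gamma> (cut s y w)) \<partial>lborel) =
      ennreal (1 / s\<^sup>2) * (ennreal ((2 * pi)\<^sup>2) * (\<integral>\<^sup>+y. ennreal ((2 * pi)\<^sup>2) * ennreal (quartic 1 \<gamma> (cut s y w)) \<partial>lborel))"
  proof -
    have "(2 * pi) ^ 4 / s\<^sup>2 = 1 / s\<^sup>2 * ((2 * pi)\<^sup>2 * (2 * pi)\<^sup>2)" by (simp flip: power_add)
    then have "ennreal ((2 * pi) ^ 4 / s\<^sup>2) = ennreal (1 / s\<^sup>2) * (ennreal ((2 * pi)\<^sup>2) * ennreal ((2 * pi)\<^sup>2))"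
      using ennreal_mult[of "1 / s\<^sup>2" "(2 * pi)\<^sup>2 * (2 * pi)\<^sup>2"] ennreal_mult[of "(2 * pi)\<^sup>2" "(2 * pi)\<^sup>2"]
      by (simp only: zero_le_power2 zero_le_divide_1_iff mult_nonneg_nonneg)
    then show ?thesis by (subst nn_integral_cmult) (simp_all only: mult.assoc, measurable)
  qed
  also have "\<dots> = (\<integral>\<^sup>+\<zeta>. ?f \<zeta> * (\<integral>\<^sup>+\<kappa>. ?W (\<zeta> + \<kappa> /\<^sub>R s) * ?q \<kappa> \<partial>lborel) \<partial>lborel)"
  proof -
    have "ennreal (1 / s\<^sup>2) * (ennreal (s\<^sup>2) * a) = a" for a
      using s by (simp add: mult.assoc[symmetric] ennreal_mult[symmetric])
    then show ?thesis unfolding eq .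
  qed
  finally show ?thesis .
qed

text \<open>The average over the windows replaces the multiplier by its mean against \<open>|(\<eta>\<^sup>2)\<^sup>^|\<^sup>2\<close> dilated to
  scale \<open>1 / s\<close>. Since the multiplier is homogeneous of degree \<open>0\<close> and Lipschitz on the unit circle,
  this changes little at frequencies beyond \<open>k\<close> if \<open>s k\<close> is large; the contribution of the frequencies
  below \<open>k\<close> is bounded because the transform of \<open>|w|\<^sup>2\<close> is at most \<open>\<parallel>w\<parallel>\<^sup>2\<close>.\<close>

lemma cut_interaction_lower:
  assumes w: "w \<in> L2" "density w \<in> L2" and g: "\<gamma> \<ge> 0" and s: "s > 0" and k: "k > 0"
  shows "ennreal ((2 * pi) ^ 4 * N4 * quartic 1 \<gamma> w) \<le>
    ennreal ((2 * pi) ^ 4 / s\<^sup>2) * (\<integral>\<^sup>+y. ennreal (quartic 1 \<gamma> (cut s y w)) \<partial>lborel) +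
    ennreal (\<gamma> * ((2 * pi)\<^sup>2 * N4 * (pi * k\<^sup>2 * (L2_norm w) ^ 4) + tail (s * k) * ((2 * pi)\<^sup>2 * quartic 1 \<gamma> w)))"
proof -
  let ?W = "\<lambda>\<xi>. ennreal (1 + \<gamma> * multiplier \<xi>)"
  let ?F = "fourier_integral (density w)"
  let ?f = "\<lambda>\<zeta>. ennreal ((cmod (?F \<zeta>))\<^sup>2)"
  let ?q = "\<lambda>\<kappa>. ennreal ((cmod (fourier_integral sq \<kappa>))\<^sup>2)"
  note [measurable] = L2_measurable[OF w(2)]
  note P = Plancherel[OF density_L1[OF w(1)] w(2)]
  have q: "quartic 1 \<gamma> w \<ge> 0"
    using quartic_nn_integral(2)[OF w g] zero_le_power2 order_trans by blast
  define m where "m \<kappa> = min 1 (4 * norm \<kappa> / (s * k))" for \<kappa> :: plane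
  have m: "0 \<le> m \<kappa>" for \<kappa> using s k by (simp add: m_def)
  have [measurable]: "m \<in> borel_measurable borel" unfolding m_def by measurable
  have [measurable]: "Measurable.pred borel (\<lambda>x::plane. x \<in> ball 0 k)"
    unfolding mem_ball by measurable
  have tail: "(\<integral>\<^sup>+\<kappa>. ennreal (m \<kappa>) * ?q \<kappa> \<partial>lborel) = ennreal (tail (s * k))"
  proof -
    have "(\<integral>\<^sup>+\<kappa>. ennreal (m \<kappa>) * ?q \<kappa> \<partial>lborel) = (\<integral>\<^sup>+\<kappa>. ennreal ((cmod (fourier_integral sq \<kappa>))\<^sup>2 * m \<kappa>) \<partial>lborel)"
      using m by (intro nn_integral_cong) (simp add: ennreal_mult mult.commute)
    also have "\<dots> = ennreal (tail (s * k))"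
      unfolding tail_def m_def using tail_integrable[of "s * k"] s k
      by (intro nn_integral_eq_integral) auto
    finally show ?thesis .
  qed
  have tail_nonneg: "0 \<le> tail (s * k)"
    unfolding tail_def using s k by (intro Bochner_Integration.integral_nonneg) auto
  have N: "(\<integral>\<^sup>+\<kappa>. ?q \<kappa> \<partial>lborel) = ennreal ((2 * pi)\<^sup>2 * N4)"
    using L2_nn_integral[OF sq_fourier_L2(1)] sq_fourier_L2(2) by simp
  \<comment> \<open>below \<open>k\<close> the multiplier is compared trivially, which also covers the origin\<close>
  have W_le: "?W \<zeta> \<le> ?W (\<zeta> + \<kappa> /\<^sub>R s) + ennreal \<gamma> * (indicator (ball 0 k) \<zeta> + ennreal (m \<kappa>))" for \<zeta> \<kappa>
  proof -
    have "multiplier \<zeta> \<le> multiplier (\<zeta> + \<kappa> /\<^sub>R s) + (indicator (ball 0 k) \<zeta> + m \<kappa>)"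
    proof (cases "\<zeta> \<in> ball 0 k")
      case True
      then show ?thesis using multiplier_bounds[of \<zeta>] multiplier_bounds[of "\<zeta> + \<kappa> /\<^sub>R s"] m[of \<kappa>] by simp
    next
      case False
      then have z: "norm \<zeta> \<ge> k" "\<zeta> \<noteq> 0" using k by auto
      have "4 * norm (\<kappa> /\<^sub>R s) / norm \<zeta> \<le> 4 * norm (\<kappa> /\<^sub>R s) / k"
        using z k by (intro divide_left_mono) auto
      also have "\<dots> = 4 * norm \<kappa> / (s * k)" using s by (simp add: field_simps)
      finally have "multiplier \<zeta> \<le> multiplier (\<zeta> + \<kappa> /\<^sub>R s) + 4 * norm \<kappa> / (s * k)"
        using multiplier_diff[OF z(2), of "\<kappa> /\<^sub>R s"] by linarith
      with multiplier_bounds[of \<zeta>] multiplier_bounds[of "\<zeta> + \<kappa> /\<^sub>R s"] False show ?thesis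
        by (simp add: m_def min_def)
    qed
    from mult_left_mono[OF this g]
    have "1 + \<gamma> * multiplier \<zeta> \<le> (1 + \<gamma> * multiplier (\<zeta> + \<kappa> /\<^sub>R s)) + \<gamma> * (indicator (ball 0 k) \<zeta> + m \<kappa>)"
      by (simp add: ring_distribs)
    from ennreal_leI[OF this] show ?thesis
      using g m[of \<kappa>] multiplier_bounds[of "\<zeta> + \<kappa> /\<^sub>R s"]
      by (subst (asm) ennreal_plus) (auto simp: ennreal_mult ennreal_indicator)
  qed
  have "ennreal ((2 * pi) ^ 4 * N4 * quartic 1 \<gamma> w) = ennreal ((2 * pi)\<^sup>2 * quartic 1 \<gamma> w) * ennreal ((2 * pi)\<^sup>2 * N4)"
  proof -
    have "(2 * pi) ^ 4 * N4 * quartic 1 \<gamma> w = ((2 * pi)\<^sup>2 * quartic 1 \<gamma> w) * ((2 * pi)\<^sup>2 * N4)"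
      by (simp add: power2_eq_square power4_eq_xxxx)
    then show ?thesis using q N_nonneg by (simp only:) (rule ennreal_mult, auto)
  qed
  also have "\<dots> = (\<integral>\<^sup>+\<zeta>. ?W \<zeta> * ?f \<zeta> * ennreal ((2 * pi)\<^sup>2 * N4) \<partial>lborel)"
    unfolding quartic_nn_integral(1)[OF w g, symmetric] by (rule nn_integral_multc[symmetric]) measurable
  also have "\<dots> = (\<integral>\<^sup>+\<zeta>. ?f \<zeta> * (\<integral>\<^sup>+\<kappa>. ?W \<zeta> * ?q \<kappa> \<partial>lborel) \<partial>lborel)"
    by (intro nn_integral_cong) (simp add: nn_integral_cmult N mult.assoc mult.left_commute)
  also have "\<dots> \<le> (\<integral>\<^sup>+\<zeta>. ?f \<zeta> * (\<integral>\<^sup>+\<kappa>. ?W (\<zeta> + \<kappa> /\<^sub>R s) * ?q \<kappa> +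
      ennreal \<gamma> * (indicator (ball 0 k) \<zeta> * ?q \<kappa> + ennreal (m \<kappa>) * ?q \<kappa>) \<partial>lborel) \<partial>lborel)"
  proof (intro nn_integral_mono mult_left_mono zero_le)
    fix \<zeta> \<kappa> :: plane
    from mult_right_mono[OF W_le[of \<zeta> \<kappa>] zero_le[of "?q \<kappa>"]]
    show "?W \<zeta> * ?q \<kappa> \<le> ?W (\<zeta> + \<kappa> /\<^sub>R s) * ?q \<kappa> +
      ennreal \<gamma> * (indicator (ball 0 k) \<zeta> * ?q \<kappa> + ennreal (m \<kappa>) * ?q \<kappa>)"
      by (simp add: distrib_left distrib_right mult.assoc)
  qed
  also have "\<dots> = (\<integral>\<^sup>+\<zeta>. ?f \<zeta> * ((\<integral>\<^sup>+\<kappa>. ?W (\<zeta> + \<kappa> /\<^sub>R s) * ?q \<kappa> \<partial>lborel) +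
      ennreal \<gamma> * (indicator (ball 0 k) \<zeta> * ennreal ((2 * pi)\<^sup>2 * N4) + ennreal (tail (s * k)))) \<partial>lborel)"
    by (simp add: nn_integral_add nn_integral_cmult N tail)
  also have "\<dots> = (\<integral>\<^sup>+\<zeta>. ?f \<zeta> * (\<integral>\<^sup>+\<kappa>. ?W (\<zeta> + \<kappa> /\<^sub>R s) * ?q \<kappa> \<partial>lborel) +
      (ennreal (\<gamma> * ((2 * pi)\<^sup>2 * N4)) * (?f \<zeta> * indicator (ball 0 k) \<zeta>) + ennreal (\<gamma> * tail (s * k)) * ?f \<zeta>) \<partial>lborel)"
    using g N_nonneg tail_nonneg by (intro nn_integral_cong) (simp add: distrib_left ennreal_mult ac_simps)
  also have "\<dots> = (\<integral>\<^sup>+\<zeta>. ?f \<zeta> * (\<integral>\<^sup>+\<kappa>. ?W (\<zeta> + \<kappa> /\<^sub>R s) * ?q \<kappa> \<partial>lborel) \<partial>lborel) +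
      (ennreal (\<gamma> * ((2 * pi)\<^sup>2 * N4)) * (\<integral>\<^sup>+\<zeta>. ?f \<zeta> * indicator (ball 0 k) \<zeta> \<partial>lborel) +
      ennreal (\<gamma> * tail (s * k)) * (\<integral>\<^sup>+\<zeta>. ?f \<zeta> \<partial>lborel))"
  proof -
    have "(\<integral>\<^sup>+\<zeta>. ennreal (\<gamma> * ((2 * pi)\<^sup>2 * N4)) * (?f \<zeta> * indicator (ball 0 k) \<zeta>) +
        ennreal (\<gamma> * tail (s * k)) * ?f \<zeta> \<partial>lborel) =
        (\<integral>\<^sup>+\<zeta>. ennreal (\<gamma> * ((2 * pi)\<^sup>2 * N4)) * (?f \<zeta> * indicator (ball 0 k) \<zeta>) \<partial>lborel) +
        (\<integral>\<^sup>+\<zeta>. ennreal (\<gamma> * tail (s * k)) * ?f \<zeta> \<partial>lborel)"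
      by (rule nn_integral_add) measurable
    also have "(\<integral>\<^sup>+\<zeta>. ennreal (\<gamma> * ((2 * pi)\<^sup>2 * N4)) * (?f \<zeta> * indicator (ball 0 k) \<zeta>) \<partial>lborel) =
        ennreal (\<gamma> * ((2 * pi)\<^sup>2 * N4)) * (\<integral>\<^sup>+\<zeta>. ?f \<zeta> * indicator (ball 0 k) \<zeta> \<partial>lborel)"
      by (rule nn_integral_cmult) measurable
    also have "(\<integral>\<^sup>+\<zeta>. ennreal (\<gamma> * tail (s * k)) * ?f \<zeta> \<partial>lborel) =
        ennreal (\<gamma> * tail (s * k)) * (\<integral>\<^sup>+\<zeta>. ?f \<zeta> \<partial>lborel)"
      by (rule nn_integral_cmult) measurable
    finally show ?thesis by (subst nn_integral_add) (simp_all only:, measurable)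
  qed
  also have "\<dots> \<le> (\<integral>\<^sup>+\<zeta>. ?f \<zeta> * (\<integral>\<^sup>+\<kappa>. ?W (\<zeta> + \<kappa> /\<^sub>R s) * ?q \<kappa> \<partial>lborel) \<partial>lborel) +
      (ennreal (\<gamma> * ((2 * pi)\<^sup>2 * N4)) * ennreal (pi * k\<^sup>2 * (L2_norm w) ^ 4) +
      ennreal (\<gamma> * tail (s * k)) * ennreal ((2 * pi)\<^sup>2 * quartic 1 \<gamma> w))"
  proof (intro add_mono mult_left_mono order_refl zero_le)
    have F_bound: "(cmod (?F \<zeta>))\<^sup>2 \<le> (L2_norm w) ^ 4" for \<zeta>
    proof -
      have "cmod (?F \<zeta>) \<le> (L2_norm w)\<^sup>2"
        using fourier_bound[of "density w" \<zeta>] by (simp add: density_def L2_norm_sq norm_power)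
      from power_mono[OF this, of 2] show ?thesis by (simp flip: power_mult)
    qed
    have "(\<integral>\<^sup>+\<zeta>. ?f \<zeta> * indicator (ball 0 k) \<zeta> \<partial>lborel) \<le>
        (\<integral>\<^sup>+(\<zeta>::plane). ennreal ((L2_norm w) ^ 4) * indicator (ball 0 k) \<zeta> \<partial>lborel)"
      by (intro nn_integral_mono mult_right_mono ennreal_leI F_bound) auto
    also have "\<dots> = ennreal ((L2_norm w) ^ 4) * emeasure lborel (ball (0::plane) k)"
      by (rule nn_integral_cmult_indicator) auto
    also have "\<dots> = ennreal (pi * k\<^sup>2 * (L2_norm w) ^ 4)"
      using k by (simp add: emeasure_ball unit_ball_vol_2 ennreal_mult[symmetric] mult.commute)
    finally show "(\<integral>\<^sup>+\<zeta>. ?f \<zeta> * indicator (ball 0 k) \<zeta> \<partial>lborel) \<le> ennreal (pi * k\<^sup>2 * (L2_norm w) ^ 4)" .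
    show "(\<integral>\<^sup>+\<zeta>. ?f \<zeta> \<partial>lborel) \<le> ennreal ((2 * pi)\<^sup>2 * quartic 1 \<gamma> w)"
      unfolding L2_nn_integral[OF P(1)] P(2)
      using quartic_nn_integral(2)[OF w g] by (intro ennreal_leI) (simp add: power_mult_distrib)
  qed
  also have "ennreal (\<gamma> * ((2 * pi)\<^sup>2 * N4)) * ennreal (pi * k\<^sup>2 * (L2_norm w) ^ 4) +
      ennreal (\<gamma> * tail (s * k)) * ennreal ((2 * pi)\<^sup>2 * quartic 1 \<gamma> w) =
      ennreal (\<gamma> * ((2 * pi)\<^sup>2 * N4 * (pi * k\<^sup>2 * (L2_norm w) ^ 4) + tail (s * k) * ((2 * pi)\<^sup>2 * quartic 1 \<gamma> w)))"
  proof -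
    have a: "0 \<le> \<gamma> * ((2 * pi)\<^sup>2 * N4)" "0 \<le> pi * k\<^sup>2 * (L2_norm w) ^ 4" "0 \<le> \<gamma> * tail (s * k)"
      "0 \<le> (2 * pi)\<^sup>2 * quartic 1 \<gamma> w"
      using g N_nonneg tail_nonneg q by auto
    show ?thesis
      unfolding ennreal_mult[OF a(1,2), symmetric] ennreal_mult[OF a(3,4), symmetric]
        ennreal_plus[OF mult_nonneg_nonneg[OF a(1,2)] mult_nonneg_nonneg[OF a(3,4)], symmetric]
      by (simp add: distrib_left mult.assoc)
  qed
  finally show ?thesis unfolding cut_interaction_average[OF w g s] .
qed

text \<open>The interpolation inequality holds for each windowed function, whose mass is at most \<open>S\<close>; the two
  averages over the centres compare both sides.\<close>

theorem localised_interpolation: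
  assumes C: "interpolation_bound 1 \<gamma> C" "C \<ge> 0" and g: "\<gamma> \<ge> 0"
    and w: "w \<in> H1" "density w \<in> L2"
    and s: "s > 0" and k: "k > 0" and e: "e > 0"
    and S: "\<And>y. (LINT x:cball y s|lborel. (cmod (w x))\<^sup>2) \<le> S"
  shows "N4 * quartic 1 \<gamma> w \<le>
    C * S * ((1 + e) * N2 * (grad_norm w)\<^sup>2 + (1 + 1 / e) * D * (L2_norm w)\<^sup>2 / s\<^sup>2) +
    \<gamma> * (N4 * k\<^sup>2 * (L2_norm w) ^ 4 / (4 * pi) + tail (s * k) * quartic 1 \<gamma> w / (2 * pi)\<^sup>2)"
proof -
  note wL2 = H1_L2[OF w(1)]
  let ?K = "(1 + e) * s\<^sup>2 * N2 * (grad_norm w)\<^sup>2 + (1 + 1 / e) * D * (L2_norm w)\<^sup>2"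
  let ?E = "\<gamma> * ((2 * pi)\<^sup>2 * N4 * (pi * k\<^sup>2 * (L2_norm w) ^ 4) + tail (s * k) * ((2 * pi)\<^sup>2 * quartic 1 \<gamma> w))"
  have S0: "0 \<le> S"
    using S[of 0] order_trans[OF _ S[of 0]] unfolding set_lebesgue_integral_def
    by (auto intro!: Bochner_Integration.integral_nonneg)
  have q: "quartic 1 \<gamma> w \<ge> 0"
    using quartic_nn_integral(2)[OF wL2 w(2) g] zero_le_power2 order_trans by blast
  have tail_nonneg: "0 \<le> tail (s * k)"
    unfolding tail_def using s k by (intro Bochner_Integration.integral_nonneg) auto
  have K0: "0 \<le> ?K" using e N_nonneg by auto
  have E0: "0 \<le> ?E" using g N_nonneg tail_nonneg q by auto
  have point: "quartic 1 \<gamma> (cut s y w) \<le> (C * S) * (grad_norm (cut s y w))\<^sup>2" for y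
  proof -
    have "quartic 1 \<gamma> (cut s y w) \<le> C * (grad_norm (cut s y w))\<^sup>2 * (L2_norm (cut s y w))\<^sup>2"
      using C(1) cut_H1[OF w(1) s] unfolding interpolation_bound_def by blast
    also have "\<dots> \<le> C * (grad_norm (cut s y w))\<^sup>2 * S"
      using C(2) order_trans[OF cut_mass[OF wL2 s] S] by (intro mult_left_mono) auto
    finally show ?thesis by (simp add: ac_simps)
  qed
  have "(\<integral>\<^sup>+y. ennreal (quartic 1 \<gamma> (cut s y w)) \<partial>lborel) \<le>
      (\<integral>\<^sup>+y. ennreal (C * S * (grad_norm (cut s y w))\<^sup>2) \<partial>lborel)"
    by (intro nn_integral_mono ennreal_leI point)
  also have "\<dots> \<le> ennreal (C * S * ?K)"
    using C(2) S0 by (intro cut_grad_average w s e) auto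
  finally have "(\<integral>\<^sup>+y. ennreal (quartic 1 \<gamma> (cut s y w)) \<partial>lborel) \<le> ennreal (C * S * ?K)" .
  then have "ennreal ((2 * pi) ^ 4 / s\<^sup>2) * (\<integral>\<^sup>+y. ennreal (quartic 1 \<gamma> (cut s y w)) \<partial>lborel) + ennreal ?E \<le>
      ennreal ((2 * pi) ^ 4 / s\<^sup>2) * ennreal (C * S * ?K) + ennreal ?E"
    by (intro add_mono mult_left_mono order_refl) auto
  also have "\<dots> = ennreal ((2 * pi) ^ 4 / s\<^sup>2 * (C * S * ?K) + ?E)"
  proof -
    have a: "0 \<le> (2 * pi) ^ 4 / s\<^sup>2" "0 \<le> C * S * ?K"
      using C(2) S0 K0 by (auto intro!: mult_nonneg_nonneg)
    show ?thesis unfolding ennreal_mult[OF a, symmetric] ennreal_plus[OF mult_nonneg_nonneg[OF a] E0, symmetric] ..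
  qed
  finally have "ennreal ((2 * pi) ^ 4 * N4 * quartic 1 \<gamma> w) \<le> ennreal ((2 * pi) ^ 4 / s\<^sup>2 * (C * S * ?K) + ?E)"
    using cut_interaction_lower[OF wL2 w(2) g s k] by (rule order_trans[rotated])
  then have "(2 * pi) ^ 4 * N4 * quartic 1 \<gamma> w \<le> (2 * pi) ^ 4 / s\<^sup>2 * (C * S * ?K) + ?E"
    using C(2) S0 K0 E0 by (subst (asm) ennreal_le_iff) (auto intro!: add_nonneg_nonneg mult_nonneg_nonneg)
  also have "\<dots> = (2 * pi) ^ 4 * (C * S * ((1 + e) * N2 * (grad_norm w)\<^sup>2 + (1 + 1 / e) * D * (L2_norm w)\<^sup>2 / s\<^sup>2) +
    \<gamma> * (N4 * k\<^sup>2 * (L2_norm w) ^ 4 / (4 * pi) + tail (s * k) * quartic 1 \<gamma> w / (2 * pi)\<^sup>2))"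
    using s e by (simp add: field_simps power2_eq_square power4_eq_xxxx)
  finally show ?thesis by (simp add: mult.assoc)
qed

end

lemma window_cutoff:
  defines "h \<equiv> (\<chi> i. 1 / 2) :: plane"
  shows "window (cutoff n (- h) h)"
proof
  show "test_function (\<lambda>x. complex_of_real (cutoff n (- h) h x))" by (rule test_cutoff)
  show "0 \<le> cutoff n (- h) h x" "cutoff n (- h) h x \<le> 1" for x by (rule cutoff_bounds)+
  show "cutoff n (- h) h x = 0" if "x \<notin> cball 0 1" for x
  proof (rule cutoff_outside, rule notI)
    assume "x \<in> box (- h) h"
    then have "- (1 / 2) < x $ i \<and> x $ i < 1 / 2" for i by (simp add: mem_box_cart h_def)
    then have "\<bar>x $ i\<bar> < 1 / 2" for i by (simp only: abs_less_iff minus_less_iff[of "x $ i"])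
    then have "(\<Sum>i\<in>UNIV. \<bar>x $ i\<bar>) \<le> (\<Sum>i\<in>(UNIV :: 2 set). 1 / 2)"
      by (intro sum_mono less_imp_le)
    then have "norm x \<le> 1" using norm_le_l1_cart[of x] by simp
    with that show False by simp
  qed
qed

text \<open>Averaging costs the ratio of \<open>\<integral>\<eta>\<^sup>2\<close> to \<open>\<integral>\<eta>\<^sup>4\<close>, which is as close to \<open>1\<close> as desired when \<open>\<eta>\<close> is
  close to an indicator function.\<close>

lemma sharp_window:
  assumes "\<delta> > 0"
  obtains \<eta> where "window \<eta>" "window.N4 \<eta> > 0" "window.N2 \<eta> < (1 + \<delta>) * window.N4 \<eta>"
proof -
  define h where "h = ((\<chi> i. 1 / 2) :: plane)"
  define \<eta> where "\<eta> n = cutoff n (- h) h" for n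
  have w: "window (\<eta> n)" for n unfolding \<eta>_def h_def by (rule window_cutoff)
  define L where "L = measure lborel (box (- h) h)"
  have "ball 0 (1 / 2) \<subseteq> box (- h) h"
  proof
    fix x :: plane
    assume "x \<in> ball 0 (1 / 2)"
    then have "\<bar>x $ i\<bar> < 1 / 2" for i using component_le_norm_cart[of x i] by simp
    then have "- (1 / 2) < x $ i \<and> x $ i < 1 / 2" for i using abs_less_iff[of "x $ i" "1 / 2"] by auto
    then show "x \<in> box (- h) h" by (simp add: mem_box_cart h_def)
  qed
  then have "measure lborel (ball (0::plane) (1 / 2)) \<le> L"
    unfolding L_def using emeasure_lborel_box_finite by (intro measure_mono_fmeasurable fmeasurableI) auto
  moreover have "measure lborel (ball (0::plane) (1 / 2)) > 0"
    using content_ball_pos[of "1 / 2" "0 :: plane"] by simp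
  ultimately have L: "L > 0" by linarith
  have lim: "(\<lambda>n. LINT x|lborel. (\<eta> n x) ^ k) \<longlonglongrightarrow> L" if "k > 0" for k
  proof -
    have int: "integrable lborel (indicator (box (- h) h) :: plane \<Rightarrow> real)"
      by (intro integrable_real_indicator emeasure_lborel_box_finite) simp
    have "(\<lambda>n. LINT x|lborel. (\<eta> n x) ^ k) \<longlonglongrightarrow> (LINT x|lborel. indicator (box (- h) h) x)"
    proof (rule integral_dominated_convergence[OF _ _ int])
      have "(\<lambda>n. (\<eta> n x) ^ k) \<longlonglongrightarrow> (indicator (box (- h) h) x) ^ k" for x
        unfolding \<eta>_def by (intro tendsto_power cutoff_tendsto)
      moreover have "(indicator (box (- h) h) x) ^ k = (indicator (box (- h) h) x :: real)" for x
        using that by (simp add: indicator_def zero_power)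
      ultimately show "AE x in lborel. (\<lambda>n. (\<eta> n x) ^ k) \<longlonglongrightarrow> indicator (box (- h) h) x" by simp
      have "norm ((\<eta> n x) ^ k) \<le> indicator (box (- h) h) x" for n x
        using cutoff_bounds[of n "- h" h x] cutoff_outside[of x "- h" h n] that
        by (cases "x \<in> box (- h) h") (auto simp: \<eta>_def power_le_one zero_power)
      then show "AE x in lborel. norm ((\<eta> n x) ^ k) \<le> indicator (box (- h) h) x" for n by simp
      show "(\<lambda>x. (\<eta> n x) ^ k) \<in> borel_measurable lborel" for n
        using window.eta_measurable[OF w] by measurable
    qed measurable
    then show ?thesis unfolding L_def by simp
  qed
  have N: "(\<lambda>n. window.N2 (\<eta> n)) \<longlonglongrightarrow> L" "(\<lambda>n. window.N4 (\<eta> n)) \<longlonglongrightarrow> L"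
    using lim[of 2] lim[of 4] by (simp_all add: window.N2_def[OF w] window.N4_def[OF w])
  have "(\<lambda>n. (1 + \<delta>) * window.N4 (\<eta> n) - window.N2 (\<eta> n)) \<longlonglongrightarrow> (1 + \<delta>) * L - L"
    by (intro tendsto_intros N)
  then have "eventually (\<lambda>n. (1 + \<delta>) * window.N4 (\<eta> n) - window.N2 (\<eta> n) > 0) sequentially"
    by (rule order_tendstoD) (use L assms in \<open>simp add: algebra_simps\<close>)
  moreover have "eventually (\<lambda>n. window.N4 (\<eta> n) > 0) sequentially"
    by (rule order_tendstoD(1)[OF N(2) L])
  ultimately have "eventually (\<lambda>n. window.N4 (\<eta> n) > 0 \<and> window.N2 (\<eta> n) < (1 + \<delta>) * window.N4 (\<eta> n)) sequentially"
    by eventually_elim simp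
  then obtain n where "window.N4 (\<eta> n) > 0" "window.N2 (\<eta> n) < (1 + \<delta>) * window.N4 (\<eta> n)"
    using eventually_happens'[OF sequentially_bot] by blast
  with w show ?thesis by (rule that)
qed

section \<open>Solutions at a fixed time\<close>

lemma AE_in_interval:
  assumes "AE s in lborel. P s" "a < (b::real)"
  obtains s where "a < s" "s < b" "P s"
proof -
  have "\<exists>s\<in>{a<..<b}. P s"
  proof (rule ccontr)
    assume "\<not> ?thesis"
    then have "AE s in lborel. s \<notin> {a<..<b}" using assms(1) by (auto elim!: eventually_mono)
    then have "{a<..<b} \<in> null_sets lborel" by (subst AE_iff_null_sets) auto
    then have "emeasure lborel {a<..<b} = 0" by auto
    with assms(2) show False by simp
  qed
  then show ?thesis using that by auto
qed

lemma L2_norm_le_H1_norm: "L2_norm f \<le> H1_norm f" "grad_norm f \<le> H1_norm f"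
  unfolding H1_norm_def by (auto intro!: real_le_rsqrt)

lemma L4_spacetime_AE:
  assumes "L4_spacetime t u" "\<And>s. 0 < s \<Longrightarrow> s < t \<Longrightarrow> u s \<in> L2"
  shows "AE s in lborel. s \<in> {0<..<t} \<longrightarrow> density (u s) \<in> L2"
proof -
  obtain U :: "real \<times> plane \<Rightarrow> complex" where U: "U \<in> borel_measurable lborel"
    "AE s in lborel. s \<in> {0<..<t} \<longrightarrow> (AE x in lborel. U (s, x) = u s x)"
    "set_integrable lborel ({0<..<t} \<times> UNIV) (\<lambda>p. (cmod (U p)) ^ 4)"
    using assms(1) unfolding L4_spacetime_def by blast
  have "integrable (lborel \<Otimes>\<^sub>M lborel) (\<lambda>p. indicat_real ({0<..<t} \<times> UNIV) p *\<^sub>R (cmod (U p)) ^ 4)"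
    using U(3) unfolding set_integrable_def lborel_prod .
  from lborel_pair.AE_integrable_fst'[OF this] U(2) show ?thesis
  proof eventually_elim
    case (elim s)
    show ?case
    proof
      assume s: "s \<in> {0<..<t}"
      then have us: "u s \<in> L2" using assms(2) by simp
      note [measurable] = L2_measurable[OF us]
      have int: "integrable lborel (\<lambda>x. (cmod (U (s, x))) ^ 4)"
        using elim(1) s by simp
      have "AE x in lborel. (cmod (U (s, x))) ^ 4 = (cmod (u s x)) ^ 4"
        using elim(2) s by auto
      from integrable_cong_AE_imp[OF int _ this]
      have "integrable lborel (\<lambda>x. (cmod (u s x)) ^ 4)" by simp
      then show "density (u s) \<in> L2"
        by (simp add: L2_def density_def norm_power flip: power_mult)
    qed
  qed
qed

text \<open>The spacetime bound gives \<open>u s \<in> L\<^sup>4\<close> for almost every time only. At such times the interpolation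
  inequality bounds the \<open>L\<^sup>4\<close> norm by the \<open>H\<^sup>1\<close> norm, and as \<open>s \<rightarrow> t\<close> the bound passes to \<open>u t\<close> by
  Fatou's lemma.\<close>

lemma solution_L4:
  assumes u: "continuous_H1 (ereal T) u" "\<And>t. 0 < t \<Longrightarrow> t < T \<Longrightarrow> L4_spacetime t u"
    and C: "interpolation_bound 1 \<gamma> C" "C \<ge> 0" and g: "\<gamma> \<ge> 0" and t: "0 < t" "t < T"
  shows "density (u t) \<in> L2"
proof -
  have H1: "u s \<in> H1" if "0 \<le> s" "s < T" for s
    using u(1) that unfolding continuous_H1_def lifespan_def by auto
  \<comment> \<open>any time strictly between \<open>t\<close> and \<open>T\<close>: the spacetime bound is only available up to such times\<close>
  define t' where "t' = (t + T) / 2"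
  have t': "t < t'" "t' < T" using t by (auto simp: t'_def)
  have ae: "AE s in lborel. s \<in> {0<..<t'} \<longrightarrow> density (u s) \<in> L2"
    using t t' by (intro L4_spacetime_AE u H1_L2 H1) auto
  have "\<exists>s. t < s \<and> s < t + (t' - t) / real (Suc n) \<and> (s \<in> {0<..<t'} \<longrightarrow> density (u s) \<in> L2)" for n
    by (rule AE_in_interval[OF ae, of t "t + (t' - t) / real (Suc n)"]) (use t' in auto)
  then obtain s where s: "\<And>n. t < s n" "\<And>n. s n < t + (t' - t) / real (Suc n)"
    "\<And>n. s n \<in> {0<..<t'} \<longrightarrow> density (u (s n)) \<in> L2"
    by metis
  have s_lt: "s n < t'" for n
  proof -
    have "(t' - t) / real (Suc n) \<le> (t' - t) / 1" using t' by (intro divide_left_mono) auto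
    then show ?thesis using s(2)[of n] by simp
  qed
  have sL4: "density (u (s n)) \<in> L2" for n using s(3)[of n] s(1)[of n] s_lt[of n] t by simp
  have sH1: "u (s n) \<in> H1" for n using s(1)[of n] s_lt[of n] t t' by (intro H1) auto
  have tH1: "u t \<in> H1" using t by (intro H1) auto
  have s_lim: "s \<longlonglongrightarrow> t"
  proof (rule tendsto_sandwich[OF _ _ tendsto_const])
    have "(\<lambda>n. t + (t' - t) * inverse (real (Suc n))) \<longlonglongrightarrow> t + (t' - t) * 0"
      by (intro tendsto_intros LIMSEQ_inverse_real_of_nat)
    then show "(\<lambda>n. t + (t' - t) / real (Suc n)) \<longlonglongrightarrow> t" by (simp add: divide_inverse)
  qed (use s in \<open>auto intro: less_imp_le always_eventually\<close>)
  have "filterlim s (at t within lifespan (ereal T)) sequentially"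
    unfolding filterlim_at using s_lim s(1) s_lt t t'
    by (auto simp: lifespan_def less_imp_neq[symmetric] intro!: always_eventually less_imp_le intro: less_trans)
  moreover have "((\<lambda>s. H1_norm (\<lambda>x. u s x - u t x)) \<longlongrightarrow> 0) (at t within lifespan (ereal T))"
    using u(1) t unfolding continuous_H1_def lifespan_def by auto
  ultimately have H1_lim: "(\<lambda>n. H1_norm (\<lambda>x. u (s n) x - u t x)) \<longlonglongrightarrow> 0"
    by (rule filterlim_compose[rotated])
  have L2_lim: "(\<lambda>n. L2_norm (\<lambda>x. u (s n) x - u t x)) \<longlonglongrightarrow> 0"
    by (rule tendsto_sandwich[OF _ _ tendsto_const H1_lim])
      (use L2_norm_le_H1_norm in \<open>auto intro: always_eventually\<close>)
  obtain r :: "nat \<Rightarrow> nat" where r: "strict_mono r" "AE x in lborel. (\<lambda>n. u (s (r n)) x) \<longlonglongrightarrow> u t x"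
    using L2_AE_subseq[OF H1_L2[OF sH1] H1_L2[OF tH1] L2_lim] .
  define K where "K = C * (2 + 2 * (grad_norm (u t))\<^sup>2) * (2 + 2 * (L2_norm (u t))\<^sup>2)"
  have K: "K \<ge> 0" using C(2) by (simp add: K_def)
  have "eventually (\<lambda>n. H1_norm (\<lambda>x. u (s n) x - u t x) < 1) sequentially"
    by (rule order_tendstoD(2)[OF H1_lim]) simp
  then have "eventually (\<lambda>n. (L2_norm (density (u (s n))))\<^sup>2 \<le> K) sequentially"
  proof eventually_elim
    case (elim n)
    let ?d = "\<lambda>x. u (s n) x - u t x"
    have d: "(L2_norm ?d)\<^sup>2 \<le> 1" "(grad_norm ?d)\<^sup>2 \<le> 1"
      using L2_norm_le_H1_norm[of ?d] elim by (auto intro!: power_le_one)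
    have "(grad_norm (u (s n)))\<^sup>2 \<le> 2 + 2 * (grad_norm (u t))\<^sup>2"
      using grad_norm_sq_le_double[OF sH1 tH1, of n] d by linarith
    moreover have "(L2_norm (u (s n)))\<^sup>2 \<le> 2 + 2 * (L2_norm (u t))\<^sup>2"
      using L2_norm_sq_le_double[OF H1_L2[OF sH1] H1_L2[OF tH1], of n] d by linarith
    ultimately have "C * (grad_norm (u (s n)))\<^sup>2 * (L2_norm (u (s n)))\<^sup>2 \<le> K"
      unfolding K_def using C(2) by (intro mult_mono mult_left_mono) auto
    moreover have "quartic 1 \<gamma> (u (s n)) \<le> C * (grad_norm (u (s n)))\<^sup>2 * (L2_norm (u (s n)))\<^sup>2"
      using C(1) sH1 unfolding interpolation_bound_def by blast
    moreover have "(L2_norm (density (u (s n))))\<^sup>2 \<le> quartic 1 \<gamma> (u (s n))"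
      by (intro quartic_nn_integral(2) H1_L2 sH1 sL4 g)
    ultimately show ?case by linarith
  qed
  then have "eventually (\<lambda>n. (L2_norm (density (u (s (r n)))))\<^sup>2 \<le> K) sequentially"
    by (rule filterlim_iff[THEN iffD1, rule_format, OF filterlim_subseq[OF r(1)]])
  then have ev: "eventually (\<lambda>n. (\<integral>\<^sup>+x. ennreal ((cmod (density (u (s (r n))) x))\<^sup>2) \<partial>lborel) \<le> ennreal K) sequentially"
    by eventually_elim (simp add: L2_nn_integral[OF sL4] ennreal_leI)
  note [measurable] = H1_L2[OF sH1, THEN L2_measurable] H1_L2[OF tH1, THEN L2_measurable]
  have [measurable]: "density (u (s n)) \<in> borel_measurable borel" "density (u t) \<in> borel_measurable borel" for n
    unfolding density_def by measurable
  have "(\<integral>\<^sup>+x. ennreal ((cmod (density (u t) x))\<^sup>2) \<partial>lborel) \<le>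
      (\<integral>\<^sup>+x. liminf (\<lambda>n. ennreal ((cmod (density (u (s (r n))) x))\<^sup>2)) \<partial>lborel)"
  proof (rule nn_integral_mono_AE, use r(2) in eventually_elim)
    case (elim x)
    have "(\<lambda>n. ennreal ((cmod (density (u (s (r n))) x))\<^sup>2)) \<longlonglongrightarrow> ennreal ((cmod (density (u t) x))\<^sup>2)"
      unfolding density_def by (intro tendsto_ennrealI tendsto_intros elim)
    from lim_imp_Liminf[OF sequentially_bot this] show ?case by simp
  qed
  also have "\<dots> \<le> liminf (\<lambda>n. \<integral>\<^sup>+x. ennreal ((cmod (density (u (s (r n))) x))\<^sup>2) \<partial>lborel)"
    by (rule nn_integral_liminf) measurable
  also have "\<dots> \<le> ennreal K"
    by (rule Liminf_le[OF _ ev]) simp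
  finally show ?thesis by (intro L2I_nn(1)[OF _ _ K]) auto
qed

section \<open>Mass concentration\<close>

lemma near_optimal_centre:
  assumes "w \<in> L2" "d > 0"
  obtains y where "\<And>z. (LINT x:cball z s|lborel. (cmod (w x))\<^sup>2) \<le>
    (LINT x:cball y s|lborel. (cmod (w x))\<^sup>2) + d"
proof -
  let ?\<mu> = "\<lambda>z. LINT x:cball z s|lborel. (cmod (w x))\<^sup>2"
  have le: "?\<mu> z \<le> (L2_norm w)\<^sup>2" for z
    unfolding L2_norm_sq set_lebesgue_integral_def
    using L2_integrable[OF assms(1)]
    by (intro integral_mono integrable_mult_indicator) (auto simp: indicator_def)
  then have bdd: "bdd_above (range ?\<mu>)" by (intro bdd_aboveI2)
  have "(SUP z. ?\<mu> z) - d < (SUP z. ?\<mu> z)" using assms(2) by simp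
  then obtain y where "(SUP z. ?\<mu> z) - d < ?\<mu> y"
    by (subst (asm) less_cSUP_iff[OF _ bdd]) auto
  then have "?\<mu> z \<le> ?\<mu> y + d" for z using cSUP_upper[OF UNIV_I bdd, of z] by linarith
  then show ?thesis by (rule that)
qed

lemma choose_parameter:
  fixes C a c :: real
  assumes "C > 0" "c < 2 / C"
  obtains h where "h > 0" "2 - a * h\<^sup>2 > 0" "c < (2 - a * h\<^sup>2) / (C * (1 + h) * (1 + h))"
proof -
  have "((\<lambda>h. (2 - a * h\<^sup>2) / (C * (1 + h) * (1 + h))) \<longlongrightarrow> (2 - a * 0\<^sup>2) / (C * (1 + 0) * (1 + 0))) (at_right 0)"
    using assms(1) by (intro tendsto_intros) auto
  then have "eventually (\<lambda>h. c < (2 - a * h\<^sup>2) / (C * (1 + h) * (1 + h))) (at_right 0)"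
    by (rule order_tendstoD) (use assms in simp)
  moreover have "((\<lambda>h. 2 - a * h\<^sup>2) \<longlongrightarrow> 2 - a * 0\<^sup>2) (at_right 0)"
    by (intro tendsto_intros)
  then have "eventually (\<lambda>h. 2 - a * h\<^sup>2 > 0) (at_right 0)"
    by (rule order_tendstoD) simp
  ultimately have "eventually (\<lambda>h. h > 0 \<and> 2 - a * h\<^sup>2 > 0 \<and> c < (2 - a * h\<^sup>2) / (C * (1 + h) * (1 + h))) (at_right 0)"
    using eventually_at_right_less[of 0] by eventually_elim simp
  then show ?thesis using that eventually_happens'[OF trivial_limit_at_right_real] by blast
qed

text \<open>Divide the localised inequality by \<open>G\<^sup>2\<close> and let \<open>G\<close> and \<open>s G\<close> tend to infinity. Here \<open>G\<close>, \<open>s\<close> and \<open>S\<close>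
  stand for the gradient norm, the radius and a bound for the mass in balls of that radius; the low
  frequencies are those below \<open>k G\<close>.\<close>

lemma (in window) concentration_limit:
  fixes G s S :: "real \<Rightarrow> real"
  assumes C: "C > 0" and N4: "N4 > 0" and e: "e > 0" and k: "k > 0"
    and G: "filterlim G at_top F" and sG: "filterlim (\<lambda>t. s t * G t) at_top F"
    and ineq: "eventually (\<lambda>t. s t > 0 \<and> N4 * (2 * (G t)\<^sup>2 - 4 * E) \<le>
      C * S t * ((1 + e) * N2 * (G t)\<^sup>2 + (1 + 1 / e) * D * M\<^sup>2 / (s t)\<^sup>2) +
      \<gamma> * (N4 * (k * G t)\<^sup>2 * M ^ 4 / (4 * pi) + tail (s t * (k * G t)) * (2 * (G t)\<^sup>2 - 4 * E) / (2 * pi)\<^sup>2)) F"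
    and c: "c < (2 - \<gamma> * M ^ 4 / (4 * pi) * k\<^sup>2) / (C * (1 + e) * (N2 / N4))" and N2: "N2 > 0"
  shows "eventually (\<lambda>t. c < S t) F"
proof -
  define a where "a t = 2 - 4 * E * (inverse (G t))\<^sup>2" for t
  define b where "b t = C * ((1 + e) * (N2 / N4) + (1 + 1 / e) * (D / N4) * M\<^sup>2 * (inverse (s t * G t))\<^sup>2)" for t
  define q where "q t = \<gamma> * M ^ 4 / (4 * pi) * k\<^sup>2 + \<gamma> * tail (k * (s t * G t)) * a t / ((2 * pi)\<^sup>2 * N4)" for t
  have iG: "((\<lambda>t. inverse (G t)) \<longlongrightarrow> 0) F" "((\<lambda>t. inverse (s t * G t)) \<longlongrightarrow> 0) F"
    by (rule filterlim_compose[OF tendsto_inverse_0_at_top G] filterlim_compose[OF tendsto_inverse_0_at_top sG]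
      tendsto_inverse_0_at_top G sG)+
  have "filterlim (\<lambda>t. k * (s t * G t)) at_top F"
    by (rule filterlim_tendsto_pos_mult_at_top[OF tendsto_const k sG])
  from filterlim_compose[OF tail_tendsto this]
  have tl: "((\<lambda>t. tail (k * (s t * G t))) \<longlongrightarrow> 0) F" .
  have "(a \<longlongrightarrow> 2 - 4 * E * 0\<^sup>2) F" unfolding a_def by (intro tendsto_intros iG)
  then have a: "(a \<longlongrightarrow> 2) F" by simp
  have "(b \<longlongrightarrow> C * ((1 + e) * (N2 / N4) + (1 + 1 / e) * (D / N4) * M\<^sup>2 * 0\<^sup>2)) F"
    unfolding b_def by (intro tendsto_intros iG)
  then have b: "(b \<longlongrightarrow> C * (1 + e) * (N2 / N4)) F" by (simp add: mult.assoc)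
  have "(q \<longlongrightarrow> \<gamma> * M ^ 4 / (4 * pi) * k\<^sup>2 + \<gamma> * 0 * 2 / ((2 * pi)\<^sup>2 * N4)) F"
    unfolding q_def using N4 by (intro tendsto_intros tl a) auto
  then have q: "(q \<longlongrightarrow> \<gamma> * M ^ 4 / (4 * pi) * k\<^sup>2) F" by simp
  have b_pos: "C * (1 + e) * (N2 / N4) > 0" using C e N2 N4 by simp
  have "((\<lambda>t. (a t - q t) / b t) \<longlongrightarrow> (2 - \<gamma> * M ^ 4 / (4 * pi) * k\<^sup>2) / (C * (1 + e) * (N2 / N4))) F"
    using b_pos by (intro tendsto_intros a b q) auto
  from order_tendstoD(1)[OF this c] order_tendstoD(1)[OF b b_pos] ineq
    filterlim_at_top_dense[THEN iffD1, OF G, rule_format, of 0]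
  show ?thesis
  proof eventually_elim
    case (elim t)
    have eq: "2 * (G t)\<^sup>2 - 4 * E = a t * (G t)\<^sup>2"
      using elim(4) by (simp add: a_def field_simps)
    have "N4 * (a t * (G t)\<^sup>2) \<le> N4 * (G t)\<^sup>2 * (S t * b t + q t)"
    proof -
      have "C * S t * ((1 + e) * N2 * (G t)\<^sup>2 + (1 + 1 / e) * D * M\<^sup>2 / (s t)\<^sup>2) = N4 * (G t)\<^sup>2 * (S t * b t)"
        using elim(3,4) N4 e by (simp add: b_def field_simps)
      moreover have "\<gamma> * (N4 * (k * G t)\<^sup>2 * M ^ 4 / (4 * pi) + tail (s t * (k * G t)) * (a t * (G t)\<^sup>2) / (2 * pi)\<^sup>2) =
          N4 * (G t)\<^sup>2 * q t"
        using elim(4) N4 by (simp add: q_def power_mult_distrib field_simps)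
      ultimately show ?thesis
        using elim(3) unfolding eq by (simp add: distrib_left)
    qed
    then have "N4 * (G t)\<^sup>2 * a t \<le> N4 * (G t)\<^sup>2 * (S t * b t + q t)" by (simp add: ac_simps)
    then have "a t \<le> S t * b t + q t"
      by (rule mult_left_le_imp_le) (use N4 elim(4) in simp)
    then have "(a t - q t) / b t \<le> S t" using elim(2) by (simp add: field_simps)
    with elim(1) show ?case by linarith
  qed
qed

theorem theorem6:
  fixes \<gamma> T C_opt :: real
    and u0 :: "real ^ 2 \<Rightarrow> complex"
    and u :: "real \<Rightarrow> real ^ 2 \<Rightarrow> complex"
    and lam :: "real \<Rightarrow> real"
  assumes "\<gamma> > 0"
    and "optimal_constant 1 \<gamma> C_opt"
    and "u0 \<in> H1"
    and "maximal_solution 1 \<gamma> u0 (ereal T) u"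
    and "\<forall>t\<in>{0..<T}. lam t > 0"
    and "filterlim (\<lambda>t. lam t * grad_norm (u t)) at_top (at_left T)"
  shows "\<exists>y :: real \<Rightarrow> real ^ 2.
    Liminf (at_left T)
      (\<lambda>t. ereal (LINT x:cball (y t) (lam t)|lborel. (cmod (u t x))\<^sup>2)) \<ge> ereal (2 / C_opt)"
proof -
  have C: "C_opt > 0" "interpolation_bound 1 \<gamma> C_opt"
    using assms(2) by (auto simp: optimal_constant_def)
  have T: "T > 0" and cont: "continuous_H1 (ereal T) u"
    and L4: "\<And>t. 0 < t \<Longrightarrow> t < T \<Longrightarrow> L4_spacetime t u"
    and blowup: "filterlim (\<lambda>t. H1_norm (u t)) at_top (at_left T)"
    and mass: "\<And>t. 0 < t \<Longrightarrow> t < T \<Longrightarrow> L2_norm (u t) = L2_norm u0"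
    and energy: "\<And>t. 0 < t \<Longrightarrow> t < T \<Longrightarrow> energy 1 \<gamma> (u t) = energy 1 \<gamma> u0"
    using assms(4) by (auto simp: maximal_solution_def lifespan_def)
  have H1: "u t \<in> H1" if "0 < t" "t < T" for t
    using cont that by (auto simp: continuous_H1_def lifespan_def)
  have uL4: "density (u t) \<in> L2" if "0 < t" "t < T" for t
    using assms(1) C by (intro solution_L4[OF cont L4 C(2)] that) auto
  have ev: "eventually (\<lambda>t. 0 < t \<and> t < T) (at_left T)"
    using eventually_at_left_real[OF T] by eventually_elim auto
  define M where "M = L2_norm u0"
  define E where "E = energy 1 \<gamma> u0"
  let ?G = "\<lambda>t. grad_norm (u t)"
  let ?\<mu> = "\<lambda>t z. LINT x:cball z (lam t)|lborel. (cmod (u t x))\<^sup>2"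
  have G: "filterlim ?G at_top (at_left T)"
  proof (rule filterlim_at_top_mono)
    show "filterlim (\<lambda>t. - M + H1_norm (u t)) at_top (at_left T)"
      by (rule filterlim_tendsto_add_at_top[OF tendsto_const blowup])
    show "eventually (\<lambda>t. - M + H1_norm (u t) \<le> ?G t) (at_left T)"
      using ev
    proof eventually_elim
      case (elim t)
      have "H1_norm (u t) \<le> L2_norm (u t) + grad_norm (u t)"
        unfolding H1_norm_def by (rule sqrt_sum_squares_le_sum) simp_all
      then show ?case using mass elim by (simp add: M_def)
    qed
  qed
  \<comment> \<open>the supremum over the centres need not be attained; the tolerance \<open>T - t\<close> disappears in the limit\<close>
  have "\<exists>y. 0 < t \<and> t < T \<longrightarrow> (\<forall>z. ?\<mu> t z \<le> ?\<mu> t y + (T - t))" for t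
    using near_optimal_centre[OF H1_L2[OF H1], of t "T - t" "lam t"] by (metis diff_gt_0_iff_gt)
  then obtain y where y: "\<And>t z. 0 < t \<Longrightarrow> t < T \<Longrightarrow> ?\<mu> t z \<le> ?\<mu> t (y t) + (T - t)"
    by metis
  have conc: "eventually (\<lambda>t. c < ?\<mu> t (y t)) (at_left T)" if c: "c < 2 / C_opt" for c
  proof -
    obtain c' where c': "c < c'" "c' < 2 / C_opt" using dense[OF c] by blast
    \<comment> \<open>\<open>h\<close> serves as the weight in Young's inequality, as the sharpness of the window and as the
      ratio of the low-frequency threshold to \<open>G\<close>\<close>
    obtain h where h: "h > 0" "2 - \<gamma> * M ^ 4 / (4 * pi) * h\<^sup>2 > 0"
      "c' < (2 - \<gamma> * M ^ 4 / (4 * pi) * h\<^sup>2) / (C_opt * (1 + h) * (1 + h))"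
      by (rule choose_parameter[OF C(1) c'(2)])
    obtain \<eta> where \<eta>: "window \<eta>" "window.N4 \<eta> > 0" "window.N2 \<eta> < (1 + h) * window.N4 \<eta>"
      using sharp_window[OF h(1)] .
    interpret window \<eta> by (rule \<eta>(1))
    have N2: "N2 > 0"
    proof -
      have "N4 \<le> N2"
        unfolding N4_def N2_def using nonneg le_1
        by (intro integral_mono eta_power_integrable power_decreasing) auto
      then show ?thesis using \<eta>(2) by linarith
    qed
    have "c' < (2 - \<gamma> * M ^ 4 / (4 * pi) * h\<^sup>2) / (C_opt * (1 + h) * (N2 / N4))"
    proof -
      have "N2 / N4 \<le> 1 + h" using \<eta> by (simp add: field_simps)
      then have "(2 - \<gamma> * M ^ 4 / (4 * pi) * h\<^sup>2) / (C_opt * (1 + h) * (1 + h)) \<le>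
          (2 - \<gamma> * M ^ 4 / (4 * pi) * h\<^sup>2) / (C_opt * (1 + h) * (N2 / N4))"
        using h C(1) N2 \<eta>(2) by (intro divide_left_mono mult_left_mono mult_pos_pos) auto
      with h(3) show ?thesis by linarith
    qed
    moreover have "eventually (\<lambda>t. lam t > 0 \<and> N4 * (2 * (?G t)\<^sup>2 - 4 * E) \<le>
      C_opt * (?\<mu> t (y t) + (T - t)) * ((1 + h) * N2 * (?G t)\<^sup>2 + (1 + 1 / h) * D * M\<^sup>2 / (lam t)\<^sup>2) +
      \<gamma> * (N4 * (h * ?G t)\<^sup>2 * M ^ 4 / (4 * pi) + tail (lam t * (h * ?G t)) * (2 * (?G t)\<^sup>2 - 4 * E) / (2 * pi)\<^sup>2)) (at_left T)"
      using ev filterlim_at_top_dense[THEN iffD1, OF G, rule_format, of 0]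
    proof eventually_elim
      case (elim t)
      have t: "0 < t" "t < T" using elim by auto
      have lam: "lam t > 0" using assms(5) t by simp
      have Q: "quartic 1 \<gamma> (u t) = 2 * (?G t)\<^sup>2 - 4 * E"
        using energy[OF t] by (simp add: energy_def E_def)
      have "N4 * quartic 1 \<gamma> (u t) \<le>
        C_opt * (?\<mu> t (y t) + (T - t)) * ((1 + h) * N2 * (?G t)\<^sup>2 + (1 + 1 / h) * D * (L2_norm (u t))\<^sup>2 / (lam t)\<^sup>2) +
        \<gamma> * (N4 * (h * ?G t)\<^sup>2 * (L2_norm (u t)) ^ 4 / (4 * pi) + tail (lam t * (h * ?G t)) * quartic 1 \<gamma> (u t) / (2 * pi)\<^sup>2)"
        by (rule localised_interpolation[OF C(2) _ _ H1[OF t] uL4[OF t] lam _ h(1) y[OF t]])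
          (use assms(1) C h elim in auto)
      then show ?case using lam unfolding mass[OF t] M_def Q by simp
    qed
    ultimately have "eventually (\<lambda>t. c' < ?\<mu> t (y t) + (T - t)) (at_left T)"
      by (intro concentration_limit[OF C(1) \<eta>(2) h(1) h(1) G assms(6)] N2)
    moreover have "((\<lambda>t. T - t) \<longlongrightarrow> T - T) (at_left T)"
      by (intro tendsto_intros)
    then have "eventually (\<lambda>t. T - t < c' - c) (at_left T)"
      by (rule order_tendstoD) (use c' in simp)
    ultimately show ?thesis by eventually_elim linarith
  qed
  have "ereal (2 / C_opt) \<le> Liminf (at_left T) (\<lambda>t. ereal (?\<mu> t (y t)))"
    unfolding le_Liminf_iff
  proof (intro allI impI)
    fix r assume "r < ereal (2 / C_opt)"
    then show "eventually (\<lambda>t. r < ereal (?\<mu> t (y t))) (at_left T)"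
      using conc by (cases r) auto
  qed
  then show ?thesis by blast
qed

end
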